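(* Let $\phi\in\mathcal{A}_1$. If $E\subset(0,\infty)\times\mathbb{R}^d$ is a measurable thin set, then there exists $c>0$ such that $$\int_{((0,\infty)\times\mathbb{R}^d)\setminus E}|W_\phi f(a,b)|^2\,\frac{da\,db}{a}\ge c\|f\|^2$$ for all $f\in L^2(\mathbb{R}^d)$.
   Context: For $\phi\in L^2(\mathbb{R}^d)$, $a\in(0,\infty)$, $b\in\mathbb{R}^d$, put $\phi_{a,b}(x)=a^{-d/2}\phi(a^{-1}x-b)$ and $W_\phi f(a,b)=\langle f,\phi_{a,b}\rangle_{L^2(\mathbb{R}^d)}$. The index set is the group $(0,\infty)\times\mathbb{R}^d$ with operation $(a_1,b_1)(a_2,b_2)=(a_1a_2,\,a_2^{-1}b_1+b_2)$ and left Haar measure $d\lambda(a,b)=a^{-1}\,da\,db$. With $\hat\phi$ the unitarily normalized Fourier transform, $\mathcal{A}$ is the set of admissible $\phi\in L^2(\mathbb{R}^d)$, i.e. those with $\int_0^\infty\frac{|\hat\phi(x\xi)|^2}{\xi}\,d\xi=1$ for a.e. $x\in\mathbb{R}^d$. For a weight $w$ on the group, $\mathcal{B}^1_w=\{\phi\in L^2(\mathbb{R}^d):W_\phi\phi\in L^1(w\,d\lambda)\}$. For $\varepsilon>0$ let $w_\varepsilon(a,b)=a^{d/2+\varepsilon}$, and set $\mathcal{A}_1=\left(\bigcup_{0<\varepsilon<1}\mathcal{B}^1_{w_\varepsilon}\right)\cap\mathcal{A}$. Fix a proper (balls are precompact) left-invariant metric on the group inducing its topology; $(a',b')\to\infty$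 means that the distance from $(a',b')$ to $(1,0)$ tends to infinity. A set $E$ is thin if $\int_E|\langle\phi_{a,b},\phi_{a',b'}\rangle|^2\,d\lambda(a,b)\to0$ as $(a',b')\to\infty$. *)

theory Defs
  imports "HOL-Analysis.Analysis"
begin

text \<open>Elements of \<open>L\<^sup>2\<close> are represented by Lebesgue measurable functions.\<close>

definition L2 :: "('a::euclidean_space \<Rightarrow> complex) set" where
  "L2 = {f. f \<in> borel_measurable lebesgue \<and> integrable lebesgue (\<lambda>x. (cmod (f x))\<^sup>2)}"

definition L2_inner :: "('a::euclidean_space \<Rightarrow> complex) \<Rightarrow> ('a \<Rightarrow> complex) \<Rightarrow> complex" where
  "L2_inner f g = (\<integral>x. f x * cnj (g x) \<partial>lebesgue)"

definition L2_norm :: "('a::euclidean_space \<Rightarrow> complex) \<Rightarrow> real" where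
  "L2_norm f = sqrt (\<integral>x. (cmod (f x))\<^sup>2 \<partial>lebesgue)"

text \<open>
  Of the two unitary normalizations we take the one with \<open>2\<pi>\<close> in the exponent: with it
  admissibility (defined below) says that the wavelet transform is an isometry. The other one,
  with factor \<open>(2\<pi>)\<close> to the power \<open>-d/2\<close>, amounts to multiplying admissible functions
  by a positive constant.
\<close>

definition fourier_integral :: "('a::euclidean_space \<Rightarrow> complex) \<Rightarrow> 'a \<Rightarrow> complex" where
  "fourier_integral f \<xi> = (\<integral>x. f x * cis (- 2 * pi * (x \<bullet> \<xi>)) \<partial>lebesgue)"

text \<open>
  The Fourier transform on \<open>L\<^sup>2\<close> is the \<open>L\<^sup>2\<close>-limit of the Fourier integrals of the truncations
  of \<open>f\<close> to balls. By Plancherel's theorem the limit exists for every \<open>f\<close> in \<open>L\<^sup>2\<close>; it is unique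
  only up to null sets, hence the choice of a representative.
\<close>

definition is_fourier_L2 :: "('a::euclidean_space \<Rightarrow> complex) \<Rightarrow> ('a \<Rightarrow> complex) \<Rightarrow> bool" where
  "is_fourier_L2 f g \<longleftrightarrow> g \<in> L2 \<and>
    ((\<lambda>R::real. \<integral>\<^sup>+\<xi>. ennreal ((cmod (fourier_integral (\<lambda>x. indicator (cball 0 R) x * f x) \<xi> - g \<xi>))\<^sup>2)
        \<partial>lebesgue) \<longlongrightarrow> 0) at_top"

definition fourier_L2 :: "('a::euclidean_space \<Rightarrow> complex) \<Rightarrow> 'a \<Rightarrow> complex" where
  "fourier_L2 f = (SOME g. is_fourier_L2 f g)"

definition grp :: "(real \<times> 'a::euclidean_space) set" where
  "grp = {0<..} \<times> UNIV"

fun grp_mult :: "real \<times> 'a::euclidean_space \<Rightarrow> real \<times> 'a \<Rightarrow> real \<times> 'a" where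
  "grp_mult (a1, b1) (a2, b2) = (a1 * a2, inverse a2 *\<^sub>R b1 + b2)"

text \<open>The measurable sets of \<open>haar\<close> are the Lebesgue measurable subsets of \<open>grp\<close>.\<close>

definition haar :: "(real \<times> 'a::euclidean_space) measure" where
  "haar = density (lebesgue_on grp) (\<lambda>(a, b). ennreal (1 / a))"

fun wavelet :: "('a::euclidean_space \<Rightarrow> complex) \<Rightarrow> real \<times> 'a \<Rightarrow> 'a \<Rightarrow> complex" where
  "wavelet \<phi> (a, b) = (\<lambda>x. of_real (a powr (- real DIM('a) / 2)) * \<phi> (inverse a *\<^sub>R x - b))"

definition W :: "('a::euclidean_space \<Rightarrow> complex) \<Rightarrow> ('a \<Rightarrow> complex) \<Rightarrow> real \<times> 'a \<Rightarrow> complex" where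
  "W \<phi> f p = L2_inner f (wavelet \<phi> p)"

definition admissible :: "('a::euclidean_space \<Rightarrow> complex) set" where
  "admissible = {\<phi> \<in> L2. AE x in lebesgue.
     (\<integral>\<^sup>+\<xi>\<in>{0<..}. ennreal ((cmod (fourier_L2 \<phi> (\<xi> *\<^sub>R x)))\<^sup>2 / \<xi>) \<partial>lebesgue) = 1}"

definition B1 :: "(real \<times> 'a::euclidean_space \<Rightarrow> real) \<Rightarrow> ('a \<Rightarrow> complex) set" where
  "B1 w = {\<phi> \<in> L2. integrable (density haar (\<lambda>p. ennreal (w p))) (W \<phi> \<phi>)}"

definition weight :: "real \<Rightarrow> real \<times> 'a::euclidean_space \<Rightarrow> real" where
  "weight \<epsilon> = (\<lambda>(a, b). a powr (real DIM('a) / 2 + \<epsilon>))"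

definition A1 :: "('a::euclidean_space \<Rightarrow> complex) set" where
  "A1 = (\<Union>\<epsilon>\<in>{0<..<1}. B1 (weight \<epsilon>)) \<inter> admissible"

definition proper_left_invariant_metric ::
    "(real \<times> 'a::euclidean_space \<Rightarrow> real \<times> 'a \<Rightarrow> real) \<Rightarrow> bool" where
  "proper_left_invariant_metric \<rho> \<longleftrightarrow>
     Metric_space grp \<rho> \<and>
     Metric_space.mtopology grp \<rho> = top_of_set grp \<and>
     (\<forall>g\<in>grp. \<forall>h\<in>grp. \<forall>k\<in>grp. \<rho> (grp_mult g h) (grp_mult g k) = \<rho> h k) \<and>
     (\<forall>g\<in>grp. \<forall>r. compactin (top_of_set grp) (top_of_set grp closure_of Metric_space.mball grp \<rho> g r))"

definition to_infinity ::
    "(real \<times> 'a::euclidean_space \<Rightarrow> real \<times> 'a \<Rightarrow> real) \<Rightarrow> (real \<times> 'a) filter" where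
  "to_infinity \<rho> = inf (filtercomap (\<lambda>p. \<rho> p (1, 0)) at_top) (principal grp)"

text \<open>Thinness is stated with the nonnegative integral, so that an infinite integral is not read
  as 0.\<close>

definition thin ::
    "(real \<times> 'a::euclidean_space \<Rightarrow> real \<times> 'a \<Rightarrow> real) \<Rightarrow> ('a \<Rightarrow> complex) \<Rightarrow> (real \<times> 'a) set \<Rightarrow> bool" where
  "thin \<rho> \<phi> E \<longleftrightarrow>
     ((\<lambda>q. \<integral>\<^sup>+p\<in>E. ennreal ((cmod (L2_inner (wavelet \<phi> p) (wavelet \<phi> q)))\<^sup>2) \<partial>haar) \<longlongrightarrow> 0)
       (to_infinity \<rho>)"

end

theory Submission
  imports Defs "HOL-Probability.Characteristic_Functions" "HOL-Complex_Analysis.Great_Picard"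
    "HOL-Computational_Algebra.Fundamental_Theorem_Algebra"
begin

text \<open>
  By Plancherel, admissibility makes the wavelet transform an isometry onto a reproducing kernel
  space with kernel \<open>\<langle>\<phi>\<^sub>q, \<phi>\<^sub>p\<rangle>\<close>. Split the reproducing formula at \<open>p\<close> into the part where
  \<open>p\<inverse>q\<close> lies in a large box and the rest. The far part is small in \<open>L\<^sup>2\<close> by Schur's test with
  weight \<open>a\<close> to the power \<open>d/2 + \<epsilon>\<close>; the near part is small on \<open>E\<close> outside a compact set, by
  Cauchy--Schwarz and thinness. So the transform restricted to \<open>E\<close> is compact. If the bound failed,
  compactness would give \<open>f \<noteq> 0\<close> whose transform vanishes off \<open>E\<close>. As in Amrein--Berthier,
  translates of \<open>f\<close> by multiples of a small vector are linearly independent, and their transforms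
  live on a set barely larger than \<open>E\<close>; taking more and more of them contradicts compactness.
\<close>

section \<open>Square integrable functions\<close>

text \<open>The argument runs on Borel functions over \<open>lborel\<close> and \<open>hm\<close>,
  where Tonelli is available for products; the Lebesgue notions of the statement are exchanged for
  Borel representatives only at the end. The square integrable toolkit is generic in the measure
  because it serves both sides of the transform. A Schur test function has to reproduce itself when
  integrated against the kernel. A character \<open>a powr s\<close> of the group does, because left
  translation multiplies it by a constant, and membership in \<open>B1\<close> is the integrability
  that makes that constant finite. Weak topologies are avoided: a norm-bounded sequence whose
  transforms tend to 0 at every point plays the weakly null sequence, and strong continuity of the
  action lets countably many points decide. In the Amrein--Berthier step the order of choices
  matters. Vanishing at N points costs N + 1 translates, and the shift is chosen after N, so that
  the N + 1 enlargements of \<open>E\<close> together carry at most half of the mass. Independence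
  of the translates keeps the combination from being zero; it rests on the fact that a nontrivial
  translation has no square integrable eigenfunction.\<close>

definition sq_integrable :: "'a measure \<Rightarrow> ('a \<Rightarrow> complex) \<Rightarrow> bool" where
  "sq_integrable M f \<longleftrightarrow> f \<in> borel_measurable M \<and> integrable M (\<lambda>x. (cmod (f x))\<^sup>2)"

definition ip :: "'a measure \<Rightarrow> ('a \<Rightarrow> complex) \<Rightarrow> ('a \<Rightarrow> complex) \<Rightarrow> complex" where
  "ip M f g = (\<integral>x. f x * cnj (g x) \<partial>M)"

definition nrm :: "'a measure \<Rightarrow> ('a \<Rightarrow> complex) \<Rightarrow> real" where
  "nrm M f = sqrt (\<integral>x. (cmod (f x))\<^sup>2 \<partial>M)"

lemma sq_integrable_integrable: "sq_integrable M f \<Longrightarrow> integrable M (\<lambda>x. (cmod (f x))\<^sup>2)"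
  by (simp add: sq_integrable_def)

lemma sq_integrable_iff_nn_integral:
  "sq_integrable M f \<longleftrightarrow> f \<in> borel_measurable M \<and> (\<integral>\<^sup>+x. ennreal ((cmod (f x))\<^sup>2) \<partial>M) < \<infinity>"
  unfolding sq_integrable_def by (auto simp: integrable_iff_bounded)

lemma nrm_nonneg [simp]: "0 \<le> nrm M f"
  by (simp add: nrm_def)

lemma nrm_square: "(nrm M f)\<^sup>2 = (\<integral>x. (cmod (f x))\<^sup>2 \<partial>M)"
  by (simp add: nrm_def)

lemma nn_integral_square_eq_nrm:
  assumes "sq_integrable M f"
  shows "(\<integral>\<^sup>+x. ennreal ((cmod (f x))\<^sup>2) \<partial>M) = ennreal ((nrm M f)\<^sup>2)"
  unfolding nrm_square using assms by (intro nn_integral_eq_integral) (auto simp: sq_integrable_def)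

lemma sq_integrable_add:
  assumes "sq_integrable M f" "sq_integrable M g"
  shows "sq_integrable M (\<lambda>x. f x + g x)"
  unfolding sq_integrable_def
proof (intro conjI)
  have [measurable]: "f \<in> borel_measurable M" "g \<in> borel_measurable M"
    using assms by (auto simp: sq_integrable_def)
  show "(\<lambda>x. f x + g x) \<in> borel_measurable M" by measurable
  show "integrable M (\<lambda>x. (cmod (f x + g x))\<^sup>2)"
  proof (rule Bochner_Integration.integrable_bound)
    show "integrable M (\<lambda>x. 2 * (cmod (f x))\<^sup>2 + 2 * (cmod (g x))\<^sup>2)"
      using assms by (auto simp: sq_integrable_def)
    have "(cmod (z + w))\<^sup>2 \<le> 2 * (cmod z)\<^sup>2 + 2 * (cmod w)\<^sup>2" for z w
    proof -
      have "(cmod (z + w))\<^sup>2 \<le> (cmod z + cmod w)\<^sup>2"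
        by (intro power_mono norm_triangle_ineq) simp
      also have "\<dots> \<le> 2 * (cmod z)\<^sup>2 + 2 * (cmod w)\<^sup>2"
        using sum_squares_bound[of "cmod z" "cmod w"] by (simp add: power2_sum)
      finally show ?thesis .
    qed
    then show "AE x in M. norm ((cmod (f x + g x))\<^sup>2) \<le> norm (2 * (cmod (f x))\<^sup>2 + 2 * (cmod (g x))\<^sup>2)"
      by simp
  qed measurable
qed

lemma sq_integrable_cmult:
  assumes "sq_integrable M f" shows "sq_integrable M (\<lambda>x. c * f x)"
  using assms by (auto simp: sq_integrable_def norm_mult power_mult_distrib)

lemma sq_integrable_diff:
  assumes "sq_integrable M f" "sq_integrable M g"
  shows "sq_integrable M (\<lambda>x. f x - g x)"
  using sq_integrable_add[OF assms(1) sq_integrable_cmult[OF assms(2), of "-1"]] by simp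

lemma sq_integrable_zero [simp]: "sq_integrable M (\<lambda>x. 0)"
  by (simp add: sq_integrable_def)

lemma sq_integrable_sum:
  assumes "\<And>i. i \<in> I \<Longrightarrow> sq_integrable M (f i)"
  shows "sq_integrable M (\<lambda>x. \<Sum>i\<in>I. f i x)"
  using assms by (induction I rule: infinite_finite_induct) (auto intro!: sq_integrable_add)

lemma nrm_cmult: "nrm M (\<lambda>x. c * f x) = cmod c * nrm M f"
  by (simp add: nrm_def norm_mult power_mult_distrib real_sqrt_mult)

lemma nrm_minus_commute: "nrm M (\<lambda>x. f x - g x) = nrm M (\<lambda>x. g x - f x)"
  by (simp add: nrm_def norm_minus_commute)

lemma borel_measurable_cnj [measurable (raw)]:
  "f \<in> borel_measurable M \<Longrightarrow> (\<lambda>x. cnj (f x)) \<in> borel_measurable M"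
  by (rule measurable_compose[OF _ borel_measurable_continuous_onI]) (auto intro: continuous_intros)

lemma sq_integrable_mult_integrable:
  assumes "sq_integrable M f" "sq_integrable M g"
  shows "integrable M (\<lambda>x. cmod (f x) * cmod (g x))"
proof (rule Bochner_Integration.integrable_bound)
  have [measurable]: "f \<in> borel_measurable M" "g \<in> borel_measurable M"
    using assms by (auto simp: sq_integrable_def)
  show "integrable M (\<lambda>x. (cmod (f x))\<^sup>2 + (cmod (g x))\<^sup>2)"
    using assms by (auto simp: sq_integrable_def)
  have "\<bar>u * v\<bar> \<le> u\<^sup>2 + v\<^sup>2" if "u \<ge> 0" "v \<ge> 0" for u v :: real
    using sum_squares_bound[of u v] that mult_nonneg_nonneg[OF that] by (simp del: mult_nonneg_nonneg)
  then show "AE x in M. norm (cmod (f x) * cmod (g x)) \<le> norm ((cmod (f x))\<^sup>2 + (cmod (g x))\<^sup>2)"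
    by auto
  show "(\<lambda>x. cmod (f x) * cmod (g x)) \<in> borel_measurable M" by measurable
qed

lemma ip_integrable:
  assumes "sq_integrable M f" "sq_integrable M g"
  shows "integrable M (\<lambda>x. f x * cnj (g x))"
proof (rule Bochner_Integration.integrable_bound[OF sq_integrable_mult_integrable[OF assms]])
  have [measurable]: "f \<in> borel_measurable M" "g \<in> borel_measurable M"
    using assms by (auto simp: sq_integrable_def)
  show "(\<lambda>x. f x * cnj (g x)) \<in> borel_measurable M" by measurable
qed (simp add: norm_mult)

lemma ip_add_left:
  assumes "sq_integrable M f" "sq_integrable M g" "sq_integrable M h"
  shows "ip M (\<lambda>x. f x + g x) h = ip M f h + ip M g h"
  unfolding ip_def using assms by (simp add: ip_integrable distrib_right)

lemma ip_diff_left: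
  assumes "sq_integrable M f" "sq_integrable M g" "sq_integrable M h"
  shows "ip M (\<lambda>x. f x - g x) h = ip M f h - ip M g h"
  unfolding ip_def using assms by (simp add: ip_integrable left_diff_distrib)

lemma ip_cmult_left: "ip M (\<lambda>x. c * f x) h = c * ip M f h"
  unfolding ip_def by (simp add: mult.assoc)

lemma ip_commute: "ip M g f = cnj (ip M f g)"
  unfolding ip_def by (simp add: mult.commute flip: Bochner_Integration.integral_cnj)

lemma ip_add_right:
  assumes "sq_integrable M f" "sq_integrable M g" "sq_integrable M h"
  shows "ip M h (\<lambda>x. f x + g x) = ip M h f + ip M h g"
  using ip_add_left[OF assms] by (metis complex_cnj_add ip_commute)

lemma ip_diff_right:
  assumes "sq_integrable M f" "sq_integrable M g" "sq_integrable M h"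
  shows "ip M h (\<lambda>x. f x - g x) = ip M h f - ip M h g"
  using ip_diff_left[OF assms] by (metis complex_cnj_diff ip_commute)

lemma ip_cmult_right: "ip M h (\<lambda>x. c * f x) = cnj c * ip M h f"
  using ip_cmult_left[of M c f h] by (metis complex_cnj_mult ip_commute)

lemma ip_sum_left:
  assumes "\<And>i. i \<in> I \<Longrightarrow> sq_integrable M (f i)" "sq_integrable M h"
  shows "ip M (\<lambda>x. \<Sum>i\<in>I. f i x) h = (\<Sum>i\<in>I. ip M (f i) h)"
  unfolding ip_def sum_distrib_right
  by (rule Bochner_Integration.integral_sum) (use assms in \<open>auto intro: ip_integrable\<close>)

lemma ip_self: "ip M f f = of_real ((nrm M f)\<^sup>2)"
  unfolding ip_def nrm_square by (subst integral_complex_of_real[symmetric])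
    (simp add: complex_norm_square[symmetric])

text \<open>The integral of (t u - v)^2 is a quadratic polynomial in t that is never negative; its
  value at t = I / A is the inequality. If A = 0 the polynomial is linear in t, which forces I =
  0.\<close>

lemma Cauchy_Schwarz_real_integral:
  fixes u v :: "'a \<Rightarrow> real"
  assumes "integrable M (\<lambda>x. (u x)\<^sup>2)" "integrable M (\<lambda>x. (v x)\<^sup>2)" "integrable M (\<lambda>x. u x * v x)"
  shows "(\<integral>x. u x * v x \<partial>M)\<^sup>2 \<le> (\<integral>x. (u x)\<^sup>2 \<partial>M) * (\<integral>x. (v x)\<^sup>2 \<partial>M)"
proof -
  define A where "A = (\<integral>x. (u x)\<^sup>2 \<partial>M)"
  define B where "B = (\<integral>x. (v x)\<^sup>2 \<partial>M)"
  define I where "I = (\<integral>x. u x * v x \<partial>M)"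
  have q: "0 \<le> t\<^sup>2 * A - 2 * t * I + B" for t
  proof -
    have "0 \<le> (\<integral>x. (t * u x - v x)\<^sup>2 \<partial>M)" by simp
    also have "\<dots> = (\<integral>x. t\<^sup>2 * (u x)\<^sup>2 - (2 * t) * (u x * v x) + (v x)\<^sup>2 \<partial>M)"
      by (intro Bochner_Integration.integral_cong) (auto simp: power2_eq_square algebra_simps)
    also have "\<dots> = t\<^sup>2 * A - 2 * t * I + B"
      using assms by (simp add: A_def B_def I_def)
    finally show ?thesis .
  qed
  have "A \<ge> 0" by (simp add: A_def)
  have "I\<^sup>2 \<le> A * B"
  proof (cases "A = 0")
    case True
    have "I = 0"
    proof (rule ccontr)
      assume "I \<noteq> 0"
      \<comment> \<open>At this t the linear expression - 2 t I + B takes the value -1.\<close>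
      with q[of "(B + 1) / (2 * I)"] True show False by (simp add: field_simps)
    qed
    with True show ?thesis by simp
  next
    case False
    with \<open>A \<ge> 0\<close> have "A > 0" by simp
    have "0 \<le> A * ((I / A)\<^sup>2 * A - 2 * (I / A) * I + B)"
      using q[of "I / A"] \<open>A > 0\<close> by simp
    also have "\<dots> = A * B - I\<^sup>2"
      using \<open>A > 0\<close> by (simp add: field_simps power2_eq_square)
    finally show ?thesis by simp
  qed
  then show ?thesis by (simp add: A_def B_def I_def)
qed

text \<open>Extended values allow the kernel estimates to be carried out before anything is known to
  be finite. The case of a vanishing factor comes first, since 0 times infinity is 0 on the right
  and the left side has to be shown to vanish too.\<close>

lemma Cauchy_Schwarz_nn_integral:
  fixes u v :: "'a \<Rightarrow> ennreal"
  assumes [measurable]: "u \<in> borel_measurable M" "v \<in> borel_measurable M"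
  shows "(\<integral>\<^sup>+x. u x * v x \<partial>M)\<^sup>2 \<le> (\<integral>\<^sup>+x. (u x)\<^sup>2 \<partial>M) * (\<integral>\<^sup>+x. (v x)\<^sup>2 \<partial>M)"
proof -
  let ?A = "\<integral>\<^sup>+x. (u x)\<^sup>2 \<partial>M" and ?B = "\<integral>\<^sup>+x. (v x)\<^sup>2 \<partial>M"
  consider (z) "?A = 0 \<or> ?B = 0" | (i) "?A \<noteq> 0" "?B \<noteq> 0" "?A = \<infinity> \<or> ?B = \<infinity>"
    | (f) "?A < \<infinity>" "?B < \<infinity>" by (metis infinity_ennreal_def top.not_eq_extremum)
  then show ?thesis
  proof cases
    case z
    then have "AE x in M. u x * v x = 0"
      by (subst (asm) (1 2) nn_integral_0_iff_AE) auto
    then have "(\<integral>\<^sup>+x. u x * v x \<partial>M) = 0" by (subst nn_integral_0_iff_AE) auto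
    then show ?thesis by simp
  next
    case i
    then have "?A * ?B = \<infinity>" by (auto simp: ennreal_mult_eq_top_iff)
    then show ?thesis by simp
  next
    case f
    define u' where "u' = (\<lambda>x. enn2real (u x))"
    define v' where "v' = (\<lambda>x. enn2real (v x))"
    have [measurable]: "u' \<in> borel_measurable M" "v' \<in> borel_measurable M"
      by (auto simp: u'_def v'_def)
    have "AE x in M. (u x)\<^sup>2 \<noteq> \<infinity>"
      by (rule nn_integral_PInf_AE) (use f in auto)
    moreover have "AE x in M. (v x)\<^sup>2 \<noteq> \<infinity>"
      by (rule nn_integral_PInf_AE) (use f in auto)
    ultimately
    have ae: "AE x in M. u x = ennreal (u' x) \<and> v x = ennreal (v' x)"
    proof eventually_elim
      case (elim x)
      then have "u x \<noteq> top" "v x \<noteq> top"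
        by (auto simp: power2_eq_square ennreal_mult_eq_top_iff)
      then show ?case by (simp add: u'_def v'_def ennreal_enn2real_if)
    qed
    have nn: "u' x \<ge> 0" "v' x \<ge> 0" for x by (auto simp: u'_def v'_def)
    have A: "?A = (\<integral>\<^sup>+x. ennreal ((u' x)\<^sup>2) \<partial>M)"
      by (intro nn_integral_cong_AE) (use ae in eventually_elim, auto simp: ennreal_power nn)
    have B: "?B = (\<integral>\<^sup>+x. ennreal ((v' x)\<^sup>2) \<partial>M)"
      by (intro nn_integral_cong_AE) (use ae in eventually_elim, auto simp: ennreal_power nn)
    have I: "(\<integral>\<^sup>+x. u x * v x \<partial>M) = (\<integral>\<^sup>+x. ennreal (u' x * v' x) \<partial>M)"
      by (intro nn_integral_cong_AE) (use ae in eventually_elim, auto simp: ennreal_mult nn)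
    have iu: "integrable M (\<lambda>x. (u' x)\<^sup>2)" and iv: "integrable M (\<lambda>x. (v' x)\<^sup>2)"
      using f A B by (auto simp: integrable_iff_bounded)
    have iuv: "integrable M (\<lambda>x. u' x * v' x)"
    proof (rule Bochner_Integration.integrable_bound[OF Bochner_Integration.integrable_add[OF iu iv]])
      have "\<bar>a * b\<bar> \<le> a\<^sup>2 + b\<^sup>2" if "a \<ge> 0" "b \<ge> 0" for a b :: real
        using sum_squares_bound[of a b] that mult_nonneg_nonneg[OF that] by (simp del: mult_nonneg_nonneg)
      then show "AE x in M. norm (u' x * v' x) \<le> norm ((u' x)\<^sup>2 + (v' x)\<^sup>2)"
        using nn by auto
    qed measurable
    have "(\<integral>\<^sup>+x. u x * v x \<partial>M)\<^sup>2 = ennreal ((\<integral>x. u' x * v' x \<partial>M)\<^sup>2)"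
      unfolding I using nn iuv by (subst nn_integral_eq_integral) (auto simp: ennreal_power)
    also have "\<dots> \<le> ennreal ((\<integral>x. (u' x)\<^sup>2 \<partial>M) * (\<integral>x. (v' x)\<^sup>2 \<partial>M))"
      by (intro ennreal_leI Cauchy_Schwarz_real_integral iu iv iuv)
    also have "\<dots> = ?A * ?B"
      unfolding A B using iu iv
      by (subst (1 2) nn_integral_eq_integral) (auto simp: ennreal_mult)
    finally show ?thesis .
  qed
qed

lemma Cauchy_Schwarz_ip:
  assumes "sq_integrable M f" "sq_integrable M g"
  shows "(\<integral>x. cmod (f x) * cmod (g x) \<partial>M) \<le> nrm M f * nrm M g"
    and "cmod (ip M f g) \<le> nrm M f * nrm M g"
proof -
  have "(\<integral>x. cmod (f x) * cmod (g x) \<partial>M)\<^sup>2 \<le> (nrm M f * nrm M g)\<^sup>2"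
    unfolding power_mult_distrib nrm_square
    by (intro Cauchy_Schwarz_real_integral sq_integrable_mult_integrable assms sq_integrable_integrable)
  then show 1: "(\<integral>x. cmod (f x) * cmod (g x) \<partial>M) \<le> nrm M f * nrm M g"
    by (rule power2_le_imp_le) simp
  have "cmod (ip M f g) \<le> (\<integral>x. cmod (f x * cnj (g x)) \<partial>M)"
    unfolding ip_def by (rule integral_norm_bound)
  also have "\<dots> = (\<integral>x. cmod (f x) * cmod (g x) \<partial>M)" by (simp add: norm_mult)
  finally show "cmod (ip M f g) \<le> nrm M f * nrm M g" using 1 by simp
qed

lemma nrm_add_square:
  assumes "sq_integrable M f" "sq_integrable M g"
  shows "(nrm M (\<lambda>x. f x + g x))\<^sup>2 = (nrm M f)\<^sup>2 + 2 * Re (ip M f g) + (nrm M g)\<^sup>2"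
proof -
  have "complex_of_real ((nrm M (\<lambda>x. f x + g x))\<^sup>2) = ip M f f + ip M g f + (ip M f g + ip M g g)"
    unfolding ip_self[symmetric]
    by (simp add: ip_add_left ip_add_right assms sq_integrable_add)
  also have "ip M g f = cnj (ip M f g)" by (rule ip_commute)
  finally have "complex_of_real ((nrm M (\<lambda>x. f x + g x))\<^sup>2)
      = of_real ((nrm M f)\<^sup>2 + 2 * Re (ip M f g) + (nrm M g)\<^sup>2)"
    unfolding ip_self by (simp add: complex_eq_iff)
  then show ?thesis by (simp only: of_real_eq_iff)
qed

lemma nrm_triangle:
  assumes "sq_integrable M f" "sq_integrable M g"
  shows "nrm M (\<lambda>x. f x + g x) \<le> nrm M f + nrm M g"
proof (rule power2_le_imp_le)
  have "Re (ip M f g) \<le> nrm M f * nrm M g"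
    using Cauchy_Schwarz_ip(2)[OF assms] complex_Re_le_cmod order_trans by blast
  then show "(nrm M (\<lambda>x. f x + g x))\<^sup>2 \<le> (nrm M f + nrm M g)\<^sup>2"
    unfolding nrm_add_square[OF assms] by (simp add: power2_sum)
qed simp

lemma nrm_triangle_diff:
  assumes "sq_integrable M f" "sq_integrable M g" "sq_integrable M h"
  shows "nrm M (\<lambda>x. f x - h x) \<le> nrm M (\<lambda>x. f x - g x) + nrm M (\<lambda>x. g x - h x)"
  using nrm_triangle[OF sq_integrable_diff[OF assms(1,2)] sq_integrable_diff[OF assms(2,3)]] by simp

lemma nrm_diff_le:
  assumes "sq_integrable M f" "sq_integrable M g"
  shows "\<bar>nrm M f - nrm M g\<bar> \<le> nrm M (\<lambda>x. f x - g x)"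
proof -
  have "nrm M f \<le> nrm M (\<lambda>x. f x - g x) + nrm M g"
    using nrm_triangle[OF sq_integrable_diff[OF assms] assms(2)] by simp
  moreover have "nrm M g \<le> nrm M (\<lambda>x. f x - g x) + nrm M f"
    using nrm_triangle[OF sq_integrable_diff[OF assms(2,1)] assms(1)]
    by (simp add: nrm_minus_commute[of M f g])
  ultimately show ?thesis by linarith
qed

lemma nrm_tendsto:
  assumes "\<And>n. sq_integrable M (f n)" "sq_integrable M g"
    "((\<lambda>n. nrm M (\<lambda>x. f n x - g x)) \<longlongrightarrow> 0) F"
  shows "((\<lambda>n. nrm M (f n)) \<longlongrightarrow> nrm M g) F"
proof -
  have "((\<lambda>n. nrm M (f n) - nrm M g) \<longlongrightarrow> 0) F"
    by (rule Lim_null_comparison[OF _ assms(3)]) (use nrm_diff_le[OF assms(1,2)] in auto)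
  then show ?thesis using LIM_zero_iff by blast
qed

text \<open>Fatou's lemma in the second index turns the Cauchy bound on \<open>F n - F k\<close>
  into a bound on \<open>F n - G\<close>. Unlike bare completeness, this identifies the limit in
  norm with a limit that is already known pointwise.\<close>

lemma sq_integrable_pointwise_limit:
  fixes F :: "nat \<Rightarrow> 'a \<Rightarrow> complex"
  assumes F: "\<And>n. sq_integrable M (F n)" and [measurable]: "G \<in> borel_measurable M"
    and lim: "AE x in M. (\<lambda>n. F n x) \<longlonglongrightarrow> G x"
    and C: "\<And>e. e > 0 \<Longrightarrow> \<exists>N. \<forall>m\<ge>N. \<forall>n\<ge>N. nrm M (\<lambda>x. F m x - F n x) \<le> e"
  shows "sq_integrable M G" and "(\<lambda>n. nrm M (\<lambda>x. F n x - G x)) \<longlonglongrightarrow> 0"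
proof -
  have [measurable]: "F n \<in> borel_measurable M" for n using F by (simp add: sq_integrable_def)
  have bound: "(\<integral>\<^sup>+x. ennreal ((cmod (F n x - G x))\<^sup>2) \<partial>M) \<le> ennreal (e\<^sup>2)"
    if N: "\<And>m. m \<ge> N \<Longrightarrow> nrm M (\<lambda>x. F n x - F m x) \<le> e" for n N e
  proof -
    have "(\<integral>\<^sup>+x. ennreal ((cmod (F n x - G x))\<^sup>2) \<partial>M)
        = (\<integral>\<^sup>+x. liminf (\<lambda>k. ennreal ((cmod (F n x - F k x))\<^sup>2)) \<partial>M)"
    proof (rule nn_integral_cong_AE, use lim in eventually_elim)
      case (elim x)
      then have "(\<lambda>k. ennreal ((cmod (F n x - F k x))\<^sup>2)) \<longlonglongrightarrow> ennreal ((cmod (F n x - G x))\<^sup>2)"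
        by (intro tendsto_ennrealI tendsto_intros)
      then show ?case by (intro lim_imp_Liminf[symmetric]) auto
    qed
    also have "\<dots> \<le> liminf (\<lambda>k. \<integral>\<^sup>+x. ennreal ((cmod (F n x - F k x))\<^sup>2) \<partial>M)"
      by (rule nn_integral_liminf) measurable
    also have "\<dots> \<le> liminf (\<lambda>k. ennreal (e\<^sup>2))"
    proof (rule Liminf_mono)
      show "\<forall>\<^sub>F k in sequentially. (\<integral>\<^sup>+x. ennreal ((cmod (F n x - F k x))\<^sup>2) \<partial>M) \<le> ennreal (e\<^sup>2)"
        using eventually_ge_at_top[of N]
      proof eventually_elim
        case (elim k)
        show ?case
          by (subst nn_integral_square_eq_nrm)
             (use N[OF elim] in \<open>auto intro!: sq_integrable_diff F ennreal_leI power_mono\<close>)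
      qed
    qed
    also have "\<dots> = ennreal (e\<^sup>2)" by (simp add: Liminf_const)
    finally show ?thesis .
  qed
  obtain N0 where N0: "\<forall>m\<ge>N0. \<forall>n\<ge>N0. nrm M (\<lambda>x. F m x - F n x) \<le> 1" using C[of 1] by auto
  have "sq_integrable M (\<lambda>x. F N0 x - G x)"
    unfolding sq_integrable_iff_nn_integral using bound[of N0 N0 1] N0 by (auto intro: le_less_trans)
  from sq_integrable_diff[OF F[of N0] this] show G: "sq_integrable M G" by simp
  show "(\<lambda>n. nrm M (\<lambda>x. F n x - G x)) \<longlonglongrightarrow> 0"
  proof (rule LIMSEQ_I)
    fix e :: real assume "e > 0"
    then obtain N where N: "\<forall>m\<ge>N. \<forall>n\<ge>N. nrm M (\<lambda>x. F m x - F n x) \<le> e/2" using C[of "e/2"] by auto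
    have "nrm M (\<lambda>x. F n x - G x) < e" if "n \<ge> N" for n
    proof -
      have "ennreal ((nrm M (\<lambda>x. F n x - G x))\<^sup>2) \<le> ennreal ((e/2)\<^sup>2)"
        unfolding nn_integral_square_eq_nrm[OF sq_integrable_diff[OF F G], symmetric]
        by (rule bound[of N]) (use that N in auto)
      then have "(nrm M (\<lambda>x. F n x - G x))\<^sup>2 \<le> (e/2)\<^sup>2" by (subst (asm) ennreal_le_iff) auto
      then have "nrm M (\<lambda>x. F n x - G x) \<le> e/2" by (rule power2_le_imp_le) (use \<open>e > 0\<close> in simp)
      with \<open>e > 0\<close> show ?thesis by simp
    qed
    then show "\<exists>no. \<forall>n\<ge>no. norm (nrm M (\<lambda>x. F n x - G x) - 0) < e" by auto
  qed
qed

text \<open>Riesz--Fischer: a rapidly Cauchy subsequence converges almost everywhere, and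
  \<open>sq_integrable_pointwise_limit\<close> upgrades this to convergence in norm.\<close>

lemma sq_integrable_complete:
  fixes f :: "nat \<Rightarrow> 'a \<Rightarrow> complex"
  assumes f: "\<And>n. sq_integrable M (f n)"
    and C: "\<And>e. e > 0 \<Longrightarrow> \<exists>N. \<forall>m\<ge>N. \<forall>n\<ge>N. nrm M (\<lambda>x. f m x - f n x) \<le> e"
  shows "\<exists>g. sq_integrable M g \<and> (\<lambda>n. nrm M (\<lambda>x. f n x - g x)) \<longlonglongrightarrow> 0"
proof -
  have [measurable]: "f n \<in> borel_measurable M" for n using f by (simp add: sq_integrable_def)
  have "\<forall>k. \<exists>N. \<forall>m\<ge>N. \<forall>n\<ge>N. nrm M (\<lambda>x. f m x - f n x) \<le> (1/2)^k"
    using C by simp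
  then obtain N where N: "\<And>k m n. m \<ge> N k \<Longrightarrow> n \<ge> N k \<Longrightarrow> nrm M (\<lambda>x. f m x - f n x) \<le> (1/2)^k"
    by metis
  \<comment> \<open>The sum dominates \<open>N j\<close> for every j <= k, so each level's estimate
    stays available later on; \<open>r\<close> need not be strictly increasing.\<close>
  define r where "r k = (\<Sum>i\<le>k. N i)" for k
  have rN: "r k \<ge> N j" if "j \<le> k" for j k
    unfolding r_def using that by (intro member_le_sum) auto
  \<comment> \<open>The increments are at most 2^-k in norm, so the squares stay summable after
    weighting by 2^k. The weight is what controls \<open>d k x\<close> itself: wherever it exceeds
    2^-k, it is at most 2^k times its square.\<close>
  define d where "d k x = cmod (f (r (Suc k)) x - f (r k) x)" for k x
  have [measurable]: "d k \<in> borel_measurable M" for k unfolding d_def by measurable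
  have "(\<integral>\<^sup>+x. (\<Sum>k. ennreal (2^k * (d k x)\<^sup>2)) \<partial>M) = (\<Sum>k. \<integral>\<^sup>+x. ennreal (2^k * (d k x)\<^sup>2) \<partial>M)"
    by (rule nn_integral_suminf) measurable
  also have "\<dots> \<le> (\<Sum>k. ennreal ((1/2)^k))"
  proof (intro suminf_le)
    fix k
    have "(\<integral>\<^sup>+x. ennreal (2^k * (d k x)\<^sup>2) \<partial>M) = ennreal (2^k) * (\<integral>\<^sup>+x. ennreal ((d k x)\<^sup>2) \<partial>M)"
      by (simp add: ennreal_mult nn_integral_cmult)
    also have "\<dots> = ennreal (2^k) * ennreal ((nrm M (\<lambda>x. f (r (Suc k)) x - f (r k) x))\<^sup>2)"
      unfolding d_def by (subst nn_integral_square_eq_nrm) (auto intro: sq_integrable_diff f)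
    also have "\<dots> = ennreal (2^k * (nrm M (\<lambda>x. f (r (Suc k)) x - f (r k) x))\<^sup>2)"
      by (simp add: ennreal_mult)
    also have "\<dots> \<le> ennreal (2^k * ((1/2)^k)\<^sup>2)"
      by (intro ennreal_leI mult_left_mono power_mono N rN) auto
    also have "2^k * ((1/2)^k)\<^sup>2 = (1/2::real)^k"
      by (simp add: power2_eq_square power_divide)
    finally show "(\<integral>\<^sup>+x. ennreal (2^k * (d k x)\<^sup>2) \<partial>M) \<le> ennreal ((1/2)^k)" .
  qed auto
  also have "\<dots> = ennreal (\<Sum>k. (1/2)^k)"
    by (rule suminf_ennreal2) (auto intro: summable_geometric)
  also have "\<dots> < \<infinity>" by simp
  finally have "AE x in M. (\<Sum>k. ennreal (2^k * (d k x)\<^sup>2)) \<noteq> \<infinity>"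
    by (intro nn_integral_PInf_AE) auto
  then have conv: "AE x in M. convergent (\<lambda>k. f (r k) x)"
  proof eventually_elim
    case (elim x)
    have s1: "summable (\<lambda>k. 2^k * (d k x)\<^sup>2)"
      by (rule summable_suminf_not_top) (use elim in auto)
    have s2: "summable (\<lambda>k. (1/2)^k + 2^k * (d k x)\<^sup>2)"
      by (intro summable_add s1 summable_geometric) auto
    have "d k x \<le> (1/2)^k + 2^k * (d k x)\<^sup>2" for k
    proof (cases "d k x \<le> (1/2)^k")
      case True then show ?thesis by (smt (verit) zero_le_mult_iff zero_le_power zero_le_power2)
    next
      case False
      then have "1 \<le> 2^k * d k x" by (simp add: power_divide field_simps)
      then have "d k x * 1 \<le> d k x * (2^k * d k x)" by (intro mult_left_mono) (auto simp: d_def)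
      then show ?thesis by (simp add: power2_eq_square mult_ac add_increasing)
    qed
    then have "summable (\<lambda>k. f (r (Suc k)) x - f (r k) x)"
      by (intro summable_norm_cancel[OF summable_comparison_test[OF _ s2]]) (auto simp: d_def)
    then have "(\<lambda>n. \<Sum>k<n. f (r (Suc k)) x - f (r k) x) \<longlonglongrightarrow> (\<Sum>k. f (r (Suc k)) x - f (r k) x)"
      by (simp add: summable_LIMSEQ)
    then have "(\<lambda>n. f (r n) x - f (r 0) x + f (r 0) x) \<longlonglongrightarrow> (\<Sum>k. f (r (Suc k)) x - f (r k) x) + f (r 0) x"
      by (intro tendsto_add) (auto simp: sum_lessThan_telescope[of "\<lambda>k. f (r k) x"])
    then show "convergent (\<lambda>k. f (r k) x)" by (auto simp: convergent_def)
  qed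
  define g where "g x = lim (\<lambda>k. f (r k) x)" for x
  have [measurable]: "g \<in> borel_measurable M"
    unfolding g_def by (rule borel_measurable_lim_metric) measurable
  have lim: "AE x in M. (\<lambda>k. f (r k) x) \<longlonglongrightarrow> g x"
    using conv by eventually_elim (auto simp: g_def convergent_LIMSEQ_iff)
  have sub: "\<exists>N. \<forall>m\<ge>N. \<forall>n\<ge>N. nrm M (\<lambda>x. f (r m) x - f (r n) x) \<le> e" if e: "e > 0" for e
  proof -
    obtain j where j: "(1/2::real)^j < e" using real_arch_pow_inv[of e "1/2"] e by auto
    have "nrm M (\<lambda>x. f (r m) x - f (r n) x) \<le> e" if "m \<ge> j" "n \<ge> j" for m n
      using N[OF rN[OF that(1)] rN[OF that(2)]] j by linarith
    then show ?thesis by blast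
  qed
  have fr: "\<And>k. sq_integrable M (f (r k))" by (rule f)
  have g: "sq_integrable M g" and gl: "(\<lambda>k. nrm M (\<lambda>x. f (r k) x - g x)) \<longlonglongrightarrow> 0"
    by (rule sq_integrable_pointwise_limit[where F="\<lambda>k. f (r k)", OF fr _ lim sub]; simp)+
  have "(\<lambda>n. nrm M (\<lambda>x. f n x - g x)) \<longlonglongrightarrow> 0"
  proof (rule LIMSEQ_I)
    fix e :: real assume e: "e > 0"
    then obtain j where j: "(1/2::real)^j < e/2" using real_arch_pow_inv[of "e/2" "1/2"] by auto
    from LIMSEQ_D[OF gl, of "e/2"] e obtain K
      where K: "\<And>k. k \<ge> K \<Longrightarrow> nrm M (\<lambda>x. f (r k) x - g x) < e/2" by auto
    have "nrm M (\<lambda>x. f n x - g x) < e" if n: "n \<ge> N j" for n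
      using nrm_triangle_diff[OF f f g, of n "r (max j K)"] N[OF n rN[of j "max j K"]] K[of "max j K"] j by simp
    then show "\<exists>no. \<forall>n\<ge>no. norm (nrm M (\<lambda>x. f n x - g x) - 0) < e" by auto
  qed
  with g show ?thesis by blast
qed

section \<open>Density of continuous functions and continuity of the wavelet action\<close>

lemma nrm_tendsto_zero_dominated:
  fixes f :: "nat \<Rightarrow> 'a \<Rightarrow> complex"
  assumes [measurable]: "\<And>n. f n \<in> borel_measurable M" and w: "integrable M w"
    and lim: "AE x in M. (\<lambda>n. f n x) \<longlonglongrightarrow> 0"
    and bd: "\<And>n. AE x in M. (cmod (f n x))\<^sup>2 \<le> w x"
  shows "(\<lambda>n. nrm M (f n)) \<longlonglongrightarrow> 0"
proof -
  have "(\<lambda>n. \<integral>x. (cmod (f n x))\<^sup>2 \<partial>M) \<longlonglongrightarrow> (\<integral>x. 0 \<partial>M)"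
  proof (rule integral_dominated_convergence[OF _ _ w])
    show "AE x in M. (\<lambda>n. (cmod (f n x))\<^sup>2) \<longlonglongrightarrow> 0"
      using lim
    proof eventually_elim
      case (elim x)
      from tendsto_power[OF tendsto_norm[OF elim], of 2] show ?case by simp
    qed
  qed (use bd in auto)
  then have "(\<lambda>n. sqrt (\<integral>x. (cmod (f n x))\<^sup>2 \<partial>M)) \<longlonglongrightarrow> sqrt 0"
    by (intro tendsto_real_sqrt) simp
  then show ?thesis by (simp add: nrm_def)
qed

lemma integrable_indicator_cball [simp]:
  "integrable lborel (indicat_real (cball (x::'a::euclidean_space) R))"
  using emeasure_bounded_finite[OF bounded_cball, of x R] by (auto simp: integrable_indicator_iff less_top)

text \<open>First f is cut off in space and in size. The cut-off function is measurable, hence an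
  almost everywhere limit of continuous functions \<open>h k\<close>; clipping these to a fixed
  bound and a fixed ball makes dominated convergence applicable.\<close>

lemma continuous_compact_support_dense:
  fixes f :: "'a::euclidean_space \<Rightarrow> complex"
  assumes f: "sq_integrable lborel f" and e: "e > 0"
  shows "\<exists>g R. continuous_on UNIV g \<and> (\<forall>x. norm x > R \<longrightarrow> g x = 0) \<and> sq_integrable lborel g
      \<and> nrm lborel (\<lambda>x. f x - g x) < e"
proof -
  have [measurable]: "f \<in> borel_measurable borel" using f by (simp add: sq_integrable_def)
  define t where "t n x = (if norm x \<le> real n \<and> cmod (f x) \<le> real n then f x else 0)" for n x
  have [measurable]: "t n \<in> borel_measurable borel" for n unfolding t_def by measurable
  have "(\<lambda>n. nrm lborel (\<lambda>x. f x - t n x)) \<longlonglongrightarrow> 0"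
  proof (rule nrm_tendsto_zero_dominated[OF _ sq_integrable_integrable[OF f]])
    have "(\<lambda>n. f x - t n x) \<longlonglongrightarrow> 0" for x
    proof (rule tendsto_eventually)
      have "\<forall>\<^sub>F n in sequentially. max (norm x) (cmod (f x)) \<le> real n"
        using filterlim_real_sequentially unfolding filterlim_at_top by blast
      then show "\<forall>\<^sub>F n in sequentially. f x - t n x = 0"
        by eventually_elim (auto simp: t_def)
    qed
    then show "AE x in lborel. (\<lambda>n. f x - t n x) \<longlonglongrightarrow> 0" by simp
  qed (auto simp: t_def)
  then obtain n where n: "nrm lborel (\<lambda>x. f x - t n x) < e/2"
    using e by (auto dest!: LIMSEQ_D[where r="e/2"])
  have "t n \<in> borel_measurable lebesgue" by (rule measurable_completion) simp
  then have "t n measurable_on UNIV" by (rule lebesgue_measurable_imp_measurable_on) simp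
  then obtain N h where N: "negligible N" and hc: "\<And>k. continuous_on UNIV (h k)"
    and h: "\<And>x. x \<notin> N \<Longrightarrow> (\<lambda>k. h k x) \<longlonglongrightarrow> t n x"
    by (auto simp: measurable_on_def)
  define B where "B = real n + 1"
  have B: "B > 0" by (simp add: B_def)
  \<comment> \<open>\<open>c\<close> is the radial projection to the disc of radius B and fixes the
    values of \<open>t n\<close>. The cutoff in \<open>g\<close> is 1 on the ball of radius n and 0
    beyond B = n + 1; the extra 1 is the room for its ramp.\<close>
  define c where "c z = z * of_real (B / max B (cmod z))" for z
  define g where "g k x = of_real (max 0 (min 1 (B - norm x))) * c (h k x)" for k x
  have cc: "continuous_on UNIV c" unfolding c_def using B by (intro continuous_intros) auto
  have gc: "continuous_on UNIV (g k)" for k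
    unfolding g_def
    by (intro continuous_intros continuous_on_compose2[OF cc hc]) auto
  have [measurable]: "g k \<in> borel_measurable borel" for k
    by (rule borel_measurable_continuous_onI[OF gc])
  have c_bound: "cmod (c z) \<le> B" for z
    using B by (auto simp: c_def norm_mult norm_divide max_def field_simps)
  have g_bound: "cmod (g k x) \<le> B" for k x
  proof -
    have "cmod (g k x) \<le> 1 * B"
      unfolding g_def norm_mult by (intro mult_mono c_bound) auto
    then show ?thesis by simp
  qed
  have g_supp: "g k x = 0" if "norm x > B" for k x using that by (simp add: g_def)
  have t_bound: "cmod (t n x) \<le> B" for x by (simp add: t_def B_def)
  have t_supp: "t n x = 0" if "norm x > B" for x using that by (simp add: t_def B_def)
  have w: "integrable lborel (\<lambda>x::'a. (2 * B)\<^sup>2 * indicat_real (cball 0 B) x)" by simp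
  have diff_bound: "(cmod (u x - v x))\<^sup>2 \<le> (2 * B)\<^sup>2 * indicat_real (cball 0 B) x"
    if "\<And>x. cmod (u x) \<le> B" "\<And>x. cmod (v x) \<le> B" "\<And>x. norm x > B \<Longrightarrow> u x = 0"
      "\<And>x. norm x > B \<Longrightarrow> v x = 0" for u v :: "'a \<Rightarrow> complex" and x
  proof (cases "norm x > B")
    case False
    have "cmod (u x - v x) \<le> 2 * B"
      using norm_triangle_ineq4[of "u x" "v x"] that(1,2)[of x] by linarith
    then have "(cmod (u x - v x))\<^sup>2 \<le> (2 * B)\<^sup>2" by (intro power_mono) auto
    with False show ?thesis by simp
  qed (use that in auto)
  have sg: "sq_integrable lborel (g k)" for k
    unfolding sq_integrable_def
  proof (intro conjI)
    show "integrable lborel (\<lambda>x. (cmod (g k x))\<^sup>2)"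
    proof (rule Bochner_Integration.integrable_bound[OF w])
      show "AE x in lborel. norm ((cmod (g k x))\<^sup>2) \<le> norm ((2 * B)\<^sup>2 * indicat_real (cball 0 B) x)"
        using diff_bound[of "g k" "\<lambda>_. 0"] g_bound g_supp B by auto
    qed measurable
  qed simp
  have st: "sq_integrable lborel (t n)"
    unfolding sq_integrable_def
  proof (intro conjI)
    show "integrable lborel (\<lambda>x. (cmod (t n x))\<^sup>2)"
    proof (rule Bochner_Integration.integrable_bound[OF w])
      show "AE x in lborel. norm ((cmod (t n x))\<^sup>2) \<le> norm ((2 * B)\<^sup>2 * indicat_real (cball 0 B) x)"
        using diff_bound[of "t n" "\<lambda>_. 0"] t_bound t_supp B by auto
    qed measurable
  qed simp
  have "AE x in lborel. x \<notin> N"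
    using AE_not_in[of N lebesgue] N
    by (simp add: negligible_iff_null_sets AE_completion_iff)
  then have "AE x in lborel. (\<lambda>k. t n x - g k x) \<longlonglongrightarrow> 0"
  proof eventually_elim
    case (elim x)
    show ?case
    proof (cases "norm x > real n")
      case True
      then have tz: "t n x = 0" by (simp add: t_def)
      have "isCont c (t n x)" using cc by (simp add: continuous_on_eq_continuous_at)
      from isCont_tendsto_compose[OF this h[OF elim]] have "(\<lambda>k. c (h k x)) \<longlonglongrightarrow> 0"
        by (simp add: tz c_def)
      from tendsto_mult_left[OF this, of "of_real (max 0 (min 1 (B - norm x)))"]
      have "(\<lambda>k. g k x) \<longlonglongrightarrow> 0" by (simp add: g_def)
      from tendsto_minus[OF this] show ?thesis by (simp add: tz)
    next
      case False
      then have "g k x = c (h k x)" for k by (simp add: g_def B_def)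
      moreover have "isCont c (t n x)" using cc by (simp add: continuous_on_eq_continuous_at)
      from isCont_tendsto_compose[OF this h[OF elim]] have "(\<lambda>k. c (h k x)) \<longlonglongrightarrow> c (t n x)" .
      moreover have "c (t n x) = t n x" using t_bound[of x] B by (simp add: c_def max_def)
      ultimately have "(\<lambda>k. g k x) \<longlonglongrightarrow> t n x" by simp
      from tendsto_diff[OF tendsto_const[of "t n x"] this] show ?thesis by simp
    qed
  qed
  then have "(\<lambda>k. nrm lborel (\<lambda>x. t n x - g k x)) \<longlonglongrightarrow> 0"
    by (intro nrm_tendsto_zero_dominated[OF _ w])
       (use diff_bound t_bound t_supp g_bound g_supp in auto)
  then obtain k where k: "nrm lborel (\<lambda>x. t n x - g k x) < e/2"
    using e by (auto dest!: LIMSEQ_D[where r="e/2"])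
  have "nrm lborel (\<lambda>x. f x - g k x) < e"
    using nrm_triangle_diff[OF f st sg, of k] n k by linarith
  with gc g_supp sg show ?thesis by (intro exI[of _ "g k"] exI[of _ B]) auto
qed

lemma nn_integral_lborel_affine:
  fixes f :: "'a::euclidean_space \<Rightarrow> ennreal"
  assumes [measurable]: "f \<in> borel_measurable borel" and c: "c \<noteq> 0"
  shows "(\<integral>\<^sup>+x. f x \<partial>lborel) = ennreal (\<bar>c\<bar> ^ DIM('a)) * (\<integral>\<^sup>+x. f (t + c *\<^sub>R x) \<partial>lborel)"
  by (subst lborel_affine[OF c, of t])
     (simp add: nn_integral_density nn_integral_distr nn_integral_cmult)

lemma integral_lborel_affine:
  fixes f :: "'a::euclidean_space \<Rightarrow> complex"
  assumes [measurable]: "f \<in> borel_measurable borel" and c: "c \<noteq> 0"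
  shows "(\<integral>x. f x \<partial>lborel) = of_real (\<bar>c\<bar> ^ DIM('a)) * (\<integral>x. f (t + c *\<^sub>R x) \<partial>lborel)"
  by (subst lborel_affine[OF c, of t])
     (simp add: integral_density integral_distr scaleR_conv_of_real)

lemma integrable_scaleR_iff:
  fixes f :: "'a \<Rightarrow> 'b::{second_countable_topology, banach}"
  assumes "c \<noteq> 0"
  shows "integrable M (\<lambda>x. c *\<^sub>R f x) \<longleftrightarrow> integrable M f"
proof
  assume "integrable M (\<lambda>x. c *\<^sub>R f x)"
  then have "integrable M (\<lambda>x. inverse c *\<^sub>R c *\<^sub>R f x)" by (rule integrable_scaleR_right)
  with assms show "integrable M f" by simp
qed (rule integrable_scaleR_right)

lemma integrable_lborel_affine:
  fixes f :: "'a::euclidean_space \<Rightarrow> complex"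
  assumes [measurable]: "f \<in> borel_measurable borel" and c: "c \<noteq> 0"
  shows "integrable lborel (\<lambda>x. f (t + c *\<^sub>R x)) \<longleftrightarrow> integrable lborel f"
  by (subst (2) lborel_affine[OF c, of t])
     (use c in \<open>simp add: integrable_density integrable_distr_eq integrable_scaleR_iff\<close>)

lemma wavelet_alt:
  "wavelet f p = (\<lambda>x. of_real (fst p powr (- real DIM('a) / 2)) * f (inverse (fst p) *\<^sub>R x - snd p))"
  for f :: "'a::euclidean_space \<Rightarrow> complex"
  by (cases p) simp

lemma borel_measurable_fst_snd [measurable (raw)]:
  fixes u :: "'b \<Rightarrow> 'c::second_countable_topology \<times> 'a::second_countable_topology"
  assumes "u \<in> borel_measurable M"
  shows "(\<lambda>x. fst (u x)) \<in> borel_measurable M" "(\<lambda>x. snd (u x)) \<in> borel_measurable M"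
  by (rule measurable_compose[OF assms borel_measurable_continuous_onI];
      intro continuous_intros)+

lemma wavelet_measurable_compose [measurable (raw)]:
  fixes f :: "'a::euclidean_space \<Rightarrow> complex"
  assumes [measurable]: "f \<in> borel_measurable borel" "u \<in> borel_measurable M" "v \<in> borel_measurable M"
  shows "(\<lambda>x. wavelet f (u x) (v x)) \<in> borel_measurable M"
  unfolding wavelet_alt by measurable

lemma wavelet_measurable [measurable]:
  fixes f :: "'a::euclidean_space \<Rightarrow> complex"
  assumes [measurable]: "f \<in> borel_measurable borel"
  shows "wavelet f p \<in> borel_measurable borel"
  unfolding wavelet_alt by measurable

text \<open>The action is unitary: after the substitution x = a (b + y) the Jacobian a^d cancels the
  two normalizing factors a^(-d/2).\<close>

lemma integral_wavelet:
  fixes f g :: "'a::euclidean_space \<Rightarrow> complex"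
  assumes [measurable]: "f \<in> borel_measurable borel" "g \<in> borel_measurable borel" and a: "fst p > 0"
  shows "ip lborel (wavelet f p) (wavelet g p) = ip lborel f g"
proof -
  define a b where "a = fst p" and "b = snd p"
  have a0: "a > 0" using a by (simp add: a_def)
  have d: "of_real (a powr (- real DIM('a) / 2)) * of_real (a powr (- real DIM('a) / 2)) * of_real (a ^ DIM('a)) = (1::complex)"
    using a0 by (simp flip: of_real_mult powr_add powr_realpow)
  have "ip lborel (wavelet f p) (wavelet g p) = of_real (\<bar>a\<bar> ^ DIM('a)) *
     (\<integral>x. wavelet f p (a *\<^sub>R b + a *\<^sub>R x) * cnj (wavelet g p (a *\<^sub>R b + a *\<^sub>R x)) \<partial>lborel)"
    unfolding ip_def using a0 by (intro integral_lborel_affine) auto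
  also have "(\<lambda>x. wavelet f p (a *\<^sub>R b + a *\<^sub>R x) * cnj (wavelet g p (a *\<^sub>R b + a *\<^sub>R x)))
     = (\<lambda>x. (of_real (a powr (- real DIM('a) / 2)) * of_real (a powr (- real DIM('a) / 2))) * (f x * cnj (g x)))"
    using a0 by (auto simp: wavelet_alt a_def[symmetric] b_def[symmetric] scaleR_add_right)
  also have "of_real (\<bar>a\<bar> ^ DIM('a)) * (\<integral>x. (of_real (a powr (- real DIM('a) / 2)) * of_real (a powr (- real DIM('a) / 2))) * (f x * cnj (g x)) \<partial>lborel)
      = (of_real (a powr (- real DIM('a) / 2)) * of_real (a powr (- real DIM('a) / 2)) * of_real (a ^ DIM('a))) * ip lborel f g"
    unfolding ip_def using a0 by simp
  finally show ?thesis unfolding d by simp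
qed

lemma sq_integrable_wavelet:
  fixes f :: "'a::euclidean_space \<Rightarrow> complex"
  assumes f: "sq_integrable lborel f" and a: "fst p > 0"
  shows "sq_integrable lborel (wavelet f p)" and "nrm lborel (wavelet f p) = nrm lborel f"
proof -
  have [measurable]: "f \<in> borel_measurable borel" using f by (simp add: sq_integrable_def)
  define a b where "a = fst p" and "b = snd p"
  have a0: "a > 0" using a by (simp add: a_def)
  have "integrable lborel (\<lambda>x. complex_of_real ((cmod (wavelet f p (a *\<^sub>R b + a *\<^sub>R x)))\<^sup>2))"
    using a0 sq_integrable_integrable[OF f]
    by (auto simp: wavelet_alt a_def[symmetric] b_def[symmetric] scaleR_add_right norm_mult power_mult_distrib
       simp del: of_real_power)
  then have "integrable lborel (\<lambda>x. complex_of_real ((cmod (wavelet f p x))\<^sup>2))"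
    using a0 by (subst (asm) integrable_lborel_affine) auto
  then show s: "sq_integrable lborel (wavelet f p)"
    by (auto simp: sq_integrable_def complex_of_real_integrable_eq simp del: of_real_power)
  have "complex_of_real ((nrm lborel (wavelet f p))\<^sup>2) = of_real ((nrm lborel f)\<^sup>2)"
    unfolding ip_self[symmetric] by (rule integral_wavelet) (use a in auto)
  then have "(nrm lborel (wavelet f p))\<^sup>2 = (nrm lborel f)\<^sup>2" by (simp only: of_real_eq_iff)
  then show "nrm lborel (wavelet f p) = nrm lborel f" by simp
qed

lemma wavelet_diff: "(\<lambda>x. wavelet f p x - wavelet g p x) = wavelet (\<lambda>x. f x - g x) p"
  by (auto simp: wavelet_alt right_diff_distrib)

text \<open>Strong continuity of the action. By unitarity f may be replaced by a continuous g of
  compact support at the cost of two small errors; for g the functions converge pointwise, with a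
  common bound and a common bounded support.\<close>

lemma wavelet_continuous:
  fixes f :: "'a::euclidean_space \<Rightarrow> complex" and p :: "nat \<Rightarrow> real \<times> 'a"
  assumes f: "sq_integrable lborel f" and p: "p \<longlonglongrightarrow> p0" "\<And>n. fst (p n) > 0" "fst p0 > 0"
  shows "(\<lambda>n. nrm lborel (\<lambda>x. wavelet f (p n) x - wavelet f p0 x)) \<longlonglongrightarrow> 0"
proof (rule LIMSEQ_I)
  fix e :: real assume e: "e > 0"
  obtain g R where gc: "continuous_on UNIV g" and gs: "\<And>x. norm x > R \<Longrightarrow> g x = 0"
    and g: "sq_integrable lborel g" and fg: "nrm lborel (\<lambda>x. f x - g x) < e/3"
    using continuous_compact_support_dense[OF f, of "e/3"] e by auto
  have [measurable]: "g \<in> borel_measurable borel" by (rule borel_measurable_continuous_onI[OF gc])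
  have "compact (g ` cball 0 R)"
    by (intro compact_continuous_image continuous_on_subset[OF gc]) auto
  then have "\<exists>B0. \<forall>y\<in>g ` cball 0 R. cmod y \<le> B0"
    using compact_imp_bounded[of "g ` cball 0 R"] by (simp add: bounded_iff)
  then obtain B0 where "\<forall>y\<in>g ` cball 0 R. cmod y \<le> B0" ..
  then have B0: "\<And>x. x \<in> cball 0 R \<Longrightarrow> cmod (g x) \<le> B0" by blast
  define B where "B = max B0 0"
  have B: "cmod (g x) \<le> B" for x
    using B0[of x] gs[of x] by (cases "norm x > R") (auto simp: B_def)
  define a b where "a n = fst (p n)" and "b n = snd (p n)" for n
  define a0 b0 where "a0 = fst p0" and "b0 = snd p0"
  have la: "a \<longlonglongrightarrow> a0" and lb: "b \<longlonglongrightarrow> b0"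
    unfolding a_def a0_def b_def b0_def using p by (auto intro!: tendsto_fst tendsto_snd)
  have a0: "a0 > 0" using p by (simp add: a0_def)
  have an: "a n > 0" for n using p by (simp add: a_def)
  have "Bseq a" using la convergent_def convergent_imp_Bseq by blast
  then obtain A where A: "\<And>n. a n \<le> A" by (auto simp: Bseq_def) (metis abs_le_D1)
  have "Bseq b" using lb convergent_def convergent_imp_Bseq by blast
  then obtain C where C: "\<And>n. norm (b n) \<le> C" by (auto simp: Bseq_def)
  have lpow: "(\<lambda>n. a n powr (- real DIM('a) / 2)) \<longlonglongrightarrow> a0 powr (- real DIM('a) / 2)"
    using la a0 by (intro tendsto_powr) auto
  then have "Bseq (\<lambda>n. a n powr (- real DIM('a) / 2))" using convergent_def convergent_imp_Bseq by blast
  then obtain D where D: "\<And>n. a n powr (- real DIM('a) / 2) \<le> D" by (auto simp: Bseq_def)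
  have A0: "a0 \<le> A" by (rule LIMSEQ_le_const2[OF la]) (use A in auto)
  have C0: "norm b0 \<le> C" by (rule LIMSEQ_le_const2[OF tendsto_norm[OF lb]]) (use C in auto)
  have D0: "a0 powr (- real DIM('a) / 2) \<le> D" by (rule LIMSEQ_le_const2[OF lpow]) (use D in auto)
  \<comment> \<open>A common support for all group elements of the sequence and its limit: if the
    scale is at most A and the shift at most C, then beyond A (R + C) the argument of g has norm
    above R.\<close>
  have supp: "wavelet g q x = 0" if "0 < fst q" "fst q \<le> A" "norm (snd q) \<le> C" "norm x > A * (R + C)" for q x
  proof -
    have "norm (inverse (fst q) *\<^sub>R x - snd q) \<ge> norm x / fst q - C"
    proof -
      have "norm (inverse (fst q) *\<^sub>R x) = norm x / fst q" using that by (simp add: divide_inverse)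
      then show ?thesis
        using norm_triangle_ineq2[of "inverse (fst q) *\<^sub>R x" "snd q"] that by linarith
    qed
    moreover have "norm x / fst q > R + C"
    proof (cases "R + C \<ge> 0")
      case True
      then have "(R + C) * fst q \<le> (R + C) * A" using that by (intro mult_left_mono) auto
      then show ?thesis using that by (simp add: field_simps)
    next
      case False then show ?thesis using that by (smt (verit) divide_nonneg_pos norm_ge_zero)
    qed
    ultimately show ?thesis by (simp add: wavelet_alt gs)
  qed
  have bdd: "cmod (wavelet g q x) \<le> D * B" if "fst q powr (- real DIM('a) / 2) \<le> D" for q x
    unfolding wavelet_alt norm_mult using that B by (intro mult_mono) (auto intro: order_trans[OF norm_ge_zero] order_trans[OF powr_ge_zero])
  have "(\<lambda>n. nrm lborel (\<lambda>x. wavelet g (p n) x - wavelet g p0 x)) \<longlonglongrightarrow> 0"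
  proof (rule nrm_tendsto_zero_dominated)
    show "integrable lborel (\<lambda>x::'a. (2 * (D * B))\<^sup>2 * indicat_real (cball 0 (A * (R + C))) x)" by simp
    have "(\<lambda>n. wavelet g (p n) x - wavelet g p0 x) \<longlonglongrightarrow> 0" for x
    proof -
      have "(\<lambda>n. g (inverse (a n) *\<^sub>R x - b n)) \<longlonglongrightarrow> g (inverse a0 *\<^sub>R x - b0)"
      proof (rule isCont_tendsto_compose[of _ g])
        show "isCont g (inverse a0 *\<^sub>R x - b0)" using gc by (simp add: continuous_on_eq_continuous_at)
        show "(\<lambda>n. inverse (a n) *\<^sub>R x - b n) \<longlonglongrightarrow> inverse a0 *\<^sub>R x - b0"
          using a0 by (intro tendsto_intros la lb) auto
      qed
      then have "(\<lambda>n. wavelet g (p n) x) \<longlonglongrightarrow> wavelet g p0 x"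
        unfolding wavelet_alt a_def[symmetric] b_def[symmetric] a0_def[symmetric] b0_def[symmetric]
        by (intro tendsto_mult tendsto_of_real lpow)
      then show ?thesis by (rule LIM_zero)
    qed
    then show "AE x in lborel. (\<lambda>n. wavelet g (p n) x - wavelet g p0 x) \<longlonglongrightarrow> 0" by simp
    fix n
    have "(cmod (wavelet g (p n) x - wavelet g p0 x))\<^sup>2 \<le> (2 * (D * B))\<^sup>2 * indicat_real (cball 0 (A * (R + C))) x" for x
    proof (cases "norm x > A * (R + C)")
      case True
      then show ?thesis using supp[of "p n" x] supp[of p0 x] p A C A0 C0 by (auto simp: a_def b_def a0_def b0_def)
    next
      case False
      have "cmod (wavelet g (p n) x - wavelet g p0 x) \<le> 2 * (D * B)"
        using norm_triangle_ineq4[of "wavelet g (p n) x" "wavelet g p0 x"] bdd[of "p n" x] bdd[of p0 x] D[of n] D0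
        unfolding a_def a0_def by linarith
      then have "(cmod (wavelet g (p n) x - wavelet g p0 x))\<^sup>2 \<le> (2 * (D * B))\<^sup>2" by (intro power_mono) auto
      with False show ?thesis by simp
    qed
    then show "AE x in lborel. (cmod (wavelet g (p n) x - wavelet g p0 x))\<^sup>2 \<le> (2 * (D * B))\<^sup>2 * indicat_real (cball 0 (A * (R + C))) x"
      by simp
  qed measurable
  from LIMSEQ_D[OF this, of "e/3"] e
  obtain N where "\<forall>n\<ge>N. nrm lborel (\<lambda>x. wavelet g (p n) x - wavelet g p0 x) < e/3" by auto
  then have N: "nrm lborel (\<lambda>x. wavelet g (p n) x - wavelet g p0 x) < e/3" if "n \<ge> N" for n
    using that by blast
  have "nrm lborel (\<lambda>x. wavelet f (p n) x - wavelet f p0 x) < e" if "n \<ge> N" for n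
  proof -
    note sw = sq_integrable_wavelet(1)
    have "nrm lborel (\<lambda>x. wavelet f (p n) x - wavelet f p0 x)
      \<le> nrm lborel (\<lambda>x. wavelet f (p n) x - wavelet g (p n) x) + nrm lborel (\<lambda>x. wavelet g (p n) x - wavelet f p0 x)"
      by (intro nrm_triangle_diff sw f g p)
    also have "nrm lborel (\<lambda>x. wavelet g (p n) x - wavelet f p0 x)
      \<le> nrm lborel (\<lambda>x. wavelet g (p n) x - wavelet g p0 x) + nrm lborel (\<lambda>x. wavelet g p0 x - wavelet f p0 x)"
      by (intro nrm_triangle_diff sw f g p)
    also have "nrm lborel (\<lambda>x. wavelet g p0 x - wavelet f p0 x) = nrm lborel (\<lambda>x. f x - g x)"
      unfolding nrm_minus_commute[of lborel f g] wavelet_diff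
      by (rule sq_integrable_wavelet(2)) (use f g p sq_integrable_diff in auto)
    also have "nrm lborel (\<lambda>x. wavelet f (p n) x - wavelet g (p n) x) = nrm lborel (\<lambda>x. f x - g x)"
      unfolding wavelet_diff
      by (rule sq_integrable_wavelet(2)) (use f g p sq_integrable_diff in auto)
    finally show ?thesis using N[OF that] fg by simp
  qed
  then show "\<exists>no. \<forall>n\<ge>no. norm (nrm lborel (\<lambda>x. wavelet f (p n) x - wavelet f p0 x) - 0) < e" by auto
qed

section \<open>The Plancherel theorem\<close>

definition ft :: "('a::euclidean_space \<Rightarrow> complex) \<Rightarrow> 'a \<Rightarrow> complex" where
  "ft f \<xi> = (\<integral>x. f x * cis (- 2 * pi * (x \<bullet> \<xi>)) \<partial>lborel)"

lemma fourier_integral_eq_ft: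
  assumes [measurable]: "f \<in> borel_measurable borel"
  shows "fourier_integral f \<xi> = ft f \<xi>"
  unfolding fourier_integral_def ft_def
  by (rule integral_completion) (simp add: cis_conv_exp)

lemma borel_measurable_cis [measurable (raw)]:
  "f \<in> borel_measurable M \<Longrightarrow> (\<lambda>x. cis (f x)) \<in> borel_measurable M"
  by (rule measurable_compose[OF _ borel_measurable_continuous_onI]) (auto intro: continuous_intros)

lemma ft_measurable [measurable]:
  fixes f :: "'a::euclidean_space \<Rightarrow> complex"
  assumes [measurable]: "f \<in> borel_measurable borel"
  shows "ft f \<in> borel_measurable borel"
  unfolding ft_def by measurable

lemma integrable_mult_unimodular:
  fixes f :: "'a \<Rightarrow> complex"
  assumes "integrable M f" "c \<in> borel_measurable M" "\<And>x. cmod (c x) = 1"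
  shows "integrable M (\<lambda>x. f x * c x)"
  by (rule Bochner_Integration.integrable_bound[OF assms(1)])
     (use assms in \<open>auto simp: norm_mult\<close>)

lemma norm_ft_le: "cmod (ft f \<xi>) \<le> (\<integral>x. cmod (f x) \<partial>lborel)"
  unfolding ft_def by (rule order_trans[OF integral_norm_bound]) (simp add: norm_mult)

lemma integrable_ft_integrand:
  fixes f :: "'a::euclidean_space \<Rightarrow> complex"
  assumes "integrable lborel f"
  shows "integrable lborel (\<lambda>x. f x * cis (- 2 * pi * (x \<bullet> \<xi>)))"
  by (rule integrable_mult_unimodular[OF assms]) auto

lemma ft_diff:
  assumes "integrable lborel f" "integrable lborel g"
  shows "ft (\<lambda>x. f x - g x) \<xi> = ft f \<xi> - ft g \<xi>"
  unfolding ft_def left_diff_distrib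
  by (intro Bochner_Integration.integral_diff integrable_ft_integrand assms)

text \<open>The multiplication formula: Fubini for f(x) g(xi) times the character, whose phase is
  symmetric in x and xi.\<close>

lemma integral_ft_mult:
  fixes f g :: "'a::euclidean_space \<Rightarrow> complex"
  assumes f: "integrable lborel f" and g: "integrable lborel g"
  shows "(\<integral>\<xi>. ft f \<xi> * g \<xi> \<partial>lborel) = (\<integral>x. f x * ft g x \<partial>lborel)"
proof -
  have [measurable]: "f \<in> borel_measurable borel" "g \<in> borel_measurable borel"
    using borel_measurable_integrable[OF f] borel_measurable_integrable[OF g] by auto
  define H where "H x \<xi> = f x * cis (- 2 * pi * (x \<bullet> \<xi>)) * g \<xi>" for x \<xi>
  have "integrable (lborel \<Otimes>\<^sub>M lborel) (\<lambda>(x, \<xi>). H x \<xi>)"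
  proof (rule lborel_pair.Fubini_integrable)
    show "(\<lambda>(x, \<xi>). H x \<xi>) \<in> borel_measurable (lborel \<Otimes>\<^sub>M lborel)"
      unfolding H_def by measurable
    show "integrable lborel (\<lambda>x. \<integral>y. norm (case (x, y) of (x, \<xi>) \<Rightarrow> H x \<xi>) \<partial>lborel)"
      using f g by (simp add: H_def norm_mult)
    show "AE x in lborel. integrable lborel (\<lambda>y. case (x, y) of (x, \<xi>) \<Rightarrow> H x \<xi>)"
      unfolding H_def using integrable_mult_unimodular[OF g]
      by (auto simp: mult.assoc mult.commute[of "cis _"])
  qed
  from lborel_pair.Fubini_integral[OF this]
  have "(\<integral>\<xi>. (\<integral>x. H x \<xi> \<partial>lborel) \<partial>lborel) = (\<integral>x. (\<integral>\<xi>. H x \<xi> \<partial>lborel) \<partial>lborel)" .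
  moreover have "(\<integral>x. H x \<xi> \<partial>lborel) = ft f \<xi> * g \<xi>" for \<xi>
    unfolding H_def ft_def by simp
  moreover have "(\<integral>\<xi>. H x \<xi> \<partial>lborel) = f x * ft g x" for x
  proof -
    have "H x = (\<lambda>\<xi>. f x * (g \<xi> * cis (- 2 * pi * (\<xi> \<bullet> x))))"
      by (simp add: H_def fun_eq_iff inner_commute mult_ac)
    then show ?thesis by (simp add: ft_def)
  qed
  ultimately show ?thesis by simp
qed

text \<open>This is the convolution of f with the reflected conjugate of g. It serves twice: the
  transform of \<open>corr f f\<close> is the nonnegative function |ft f|^2, which drives
  Plancherel, and at a fixed scale the wavelet transform is a rescaled correlation.\<close>

definition corr :: "('a::euclidean_space \<Rightarrow> complex) \<Rightarrow> ('a \<Rightarrow> complex) \<Rightarrow> 'a \<Rightarrow> complex" where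
  "corr f g y = ip lborel f (\<lambda>x. g (x - y))"

lemma
  fixes f g :: "'a::euclidean_space \<Rightarrow> complex"
  assumes f: "integrable lborel f" and g: "integrable lborel g"
  shows integrable_corr: "integrable lborel (corr f g)"
    and ft_corr: "ft (corr f g) \<xi> = ft f \<xi> * cnj (ft g \<xi>)"
proof -
  have [measurable]: "f \<in> borel_measurable borel" "g \<in> borel_measurable borel"
    using borel_measurable_integrable[OF f] borel_measurable_integrable[OF g] by auto
  have shift: "(\<integral>y. h (x - y) \<partial>lborel) = (\<integral>y. h y \<partial>lborel)" if "h \<in> borel_measurable borel"
    for h :: "'a \<Rightarrow> complex" and x
    using integral_lborel_affine[OF that, of "-1" x] by simp
  have ishift: "integrable lborel (\<lambda>y. g (x - y))" for x
    using integrable_lborel_affine[of g "-1" x] g by simp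
  have nshift: "(\<integral>y. cmod (g (x - y)) \<partial>lborel) = (\<integral>y. cmod (g y) \<partial>lborel)" for x
  proof -
    have "complex_of_real (\<integral>y. cmod (g (x - y)) \<partial>lborel) = (\<integral>y. complex_of_real (cmod (g (x - y))) \<partial>lborel)"
      by simp
    also have "\<dots> = (\<integral>y. complex_of_real (cmod (g y)) \<partial>lborel)"
      by (rule shift) measurable
    also have "\<dots> = complex_of_real (\<integral>y. cmod (g y) \<partial>lborel)" by simp
    finally show ?thesis by (simp only: of_real_eq_iff)
  qed
  define H where "H x y = f x * cnj (g (x - y))" for x y
  have H: "integrable (lborel \<Otimes>\<^sub>M lborel) (\<lambda>(x, y). H x y)"
  proof (rule lborel_pair.Fubini_integrable)
    show "(\<lambda>(x, \<xi>). H x \<xi>) \<in> borel_measurable (lborel \<Otimes>\<^sub>M lborel)"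
      unfolding H_def by measurable
    show "integrable lborel (\<lambda>x. \<integral>y. norm (case (x, y) of (x, \<xi>) \<Rightarrow> H x \<xi>) \<partial>lborel)"
      using f by (simp add: H_def norm_mult nshift)
    show "AE x in lborel. integrable lborel (\<lambda>y. case (x, y) of (x, \<xi>) \<Rightarrow> H x \<xi>)"
      unfolding H_def using ishift by simp
  qed
  show "integrable lborel (corr f g)"
    using lborel_pair.integrable_snd[OF H] unfolding H_def corr_def ip_def by simp
  define K where "K x y = H x y * cis (- 2 * pi * (y \<bullet> \<xi>))" for x y
  have K: "integrable (lborel \<Otimes>\<^sub>M lborel) (\<lambda>(x, y). K x y)"
    using integrable_mult_unimodular[OF H, of "\<lambda>(x, y). cis (- 2 * pi * (y \<bullet> \<xi>))"]
    by (simp add: K_def split_def)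
  from lborel_pair.Fubini_integral[OF this]
  have "(\<integral>y. (\<integral>x. K x y \<partial>lborel) \<partial>lborel) = (\<integral>x. (\<integral>y. K x y \<partial>lborel) \<partial>lborel)" .
  moreover have "(\<integral>x. K x y \<partial>lborel) = corr f g y * cis (- 2 * pi * (y \<bullet> \<xi>))" for y
    unfolding K_def H_def corr_def ip_def by simp
  moreover have "(\<integral>y. K x y \<partial>lborel) = f x * cis (- 2 * pi * (x \<bullet> \<xi>)) * cnj (ft g \<xi>)" for x
  proof -
    \<comment> \<open>The phase splits through y = x - (x - y): one factor completes
      \<open>ft f\<close>, the conjugate of the other completes \<open>ft g\<close> after
      translating the integration variable.\<close>
    have "K x = (\<lambda>y. f x * cis (- 2 * pi * (x \<bullet> \<xi>)) * cnj (g (x - y) * cis (- 2 * pi * ((x - y) \<bullet> \<xi>))))"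
      by (auto simp: K_def H_def fun_eq_iff cis_cnj cis_mult inner_diff_left algebra_simps)
    then have "(\<integral>y. K x y \<partial>lborel) = f x * cis (- 2 * pi * (x \<bullet> \<xi>)) *
       cnj (\<integral>y. g (x - y) * cis (- 2 * pi * ((x - y) \<bullet> \<xi>)) \<partial>lborel)"
      by (simp flip: Bochner_Integration.integral_cnj)
    also have "(\<integral>y. g (x - y) * cis (- 2 * pi * ((x - y) \<bullet> \<xi>)) \<partial>lborel) = ft g \<xi>"
      unfolding ft_def by (rule shift) measurable
    finally show ?thesis .
  qed
  ultimately show "ft (corr f g) \<xi> = ft f \<xi> * cnj (ft g \<xi>)"
    by (simp add: ft_def)
qed

section \<open>The Gaussian that is its own Fourier transform\<close>

lemma integral_lborel_prod:
  fixes h :: "'a::euclidean_space \<Rightarrow> real \<Rightarrow> complex"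
  assumes "\<And>b. b \<in> Basis \<Longrightarrow> integrable lborel (h b)"
  shows "(\<integral>x. (\<Prod>b\<in>Basis. h b (x \<bullet> b)) \<partial>lborel) = (\<Prod>b\<in>Basis. (\<integral>x. h b x \<partial>lborel))"
    and "integrable lborel (\<lambda>x::'a. (\<Prod>b\<in>Basis. h b (x \<bullet> b)))"
proof -
  interpret product_sigma_finite "\<lambda>_::'a. lborel :: real measure" ..
  have [measurable]: "b \<in> Basis \<Longrightarrow> h b \<in> borel_measurable borel" for b
    using borel_measurable_integrable[OF assms] by simp
  have inn: "(\<Sum>b\<in>Basis. f b *\<^sub>R b) \<bullet> b' = f b'" if "b' \<in> Basis" for f and b' :: 'a
    using that by simp
  have s: "(\<lambda>f. \<Sum>b\<in>Basis. f b *\<^sub>R b) \<in> (\<Pi>\<^sub>M b\<in>(Basis::'a set). lborel) \<rightarrow>\<^sub>M borel" by measurable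
  show "(\<integral>x. (\<Prod>b\<in>Basis. h b (x \<bullet> b)) \<partial>lborel) = (\<Prod>b\<in>Basis. (\<integral>x. h b x \<partial>lborel))"
    by (subst lborel_eq, subst integral_distr[OF s]) (use product_integral_prod[OF finite_Basis assms] in \<open>auto simp: inn\<close>)
  show "integrable lborel (\<lambda>x::'a. (\<Prod>b\<in>Basis. h b (x \<bullet> b)))"
    by (subst lborel_eq, subst integrable_distr_eq[OF s]) (use product_integrable_prod[OF finite_Basis assms] in \<open>auto simp: inn\<close>)
qed

text \<open>Rescaling by sqrt (2 pi) makes the Gaussian a multiple of the standard normal density,
  whose characteristic function is known; it is read at t = - sqrt (2 pi) s.\<close>

lemma gaussian_1d:
  fixes s :: real
  shows "integrable lborel (\<lambda>x::real. complex_of_real (exp (- pi * x\<^sup>2)) * cis (- 2 * pi * (x * s)))"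
    and "(\<integral>x. complex_of_real (exp (- pi * x\<^sup>2)) * cis (- 2 * pi * (x * s)) \<partial>lborel) = exp (- pi * s\<^sup>2)"
proof -
  define t where "t = - sqrt (2 * pi) * s"
  define h where "h x = complex_of_real (std_normal_density x) * iexp (t * x)" for x
  have [measurable]: "h \<in> borel_measurable borel" unfolding h_def by measurable
  have c: "sqrt (2 * pi) \<noteq> 0" by simp
  have hx: "h (sqrt (2 * pi) * x) = complex_of_real (1 / sqrt (2 * pi)) *
      (complex_of_real (exp (- pi * x\<^sup>2)) * cis (- 2 * pi * (x * s)))" for x
    by (auto simp: h_def t_def std_normal_density_def power_mult_distrib cis_conv_exp mult_ac
       simp flip: real_sqrt_mult)
  have G: "complex_of_real (exp (- pi * x\<^sup>2)) * cis (- 2 * pi * (x * s))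
      = complex_of_real (sqrt (2 * pi)) * h (sqrt (2 * pi) * x)" for x
    unfolding hx using c by (simp add: field_simps flip: of_real_mult)
  have hi: "integrable lborel h"
    unfolding h_def by (rule integrable_mult_unimodular) (auto simp: complex_of_real_integrable_eq)
  then have "integrable lborel (\<lambda>x. h (0 + sqrt (2 * pi) *\<^sub>R x))"
    by (subst integrable_lborel_affine) auto
  then show "integrable lborel (\<lambda>x::real. complex_of_real (exp (- pi * x\<^sup>2)) * cis (- 2 * pi * (x * s)))"
    using integrable_mult_right[of "complex_of_real (sqrt (2 * pi))" lborel "\<lambda>x. h (sqrt (2 * pi) * x)"]
    unfolding G by simp
  have "char std_normal_distribution t = (\<integral>x. h x \<partial>lborel)"
    unfolding char_def h_def
    by (subst integral_density) (auto simp: scaleR_conv_of_real)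
  then have "(\<integral>x. h x \<partial>lborel) = exp (- (t\<^sup>2) / 2)"
    by (simp add: char_std_normal_distribution)
  moreover have "(\<integral>x. h x \<partial>lborel) = of_real (sqrt (2 * pi)) * (\<integral>x. h (sqrt (2 * pi) * x) \<partial>lborel)"
    using integral_lborel_affine[of h "sqrt (2 * pi)" 0] by simp
  moreover have "- (t\<^sup>2) / 2 = - pi * s\<^sup>2" by (simp add: t_def power_mult_distrib)
  ultimately show "(\<integral>x. complex_of_real (exp (- pi * x\<^sup>2)) * cis (- 2 * pi * (x * s)) \<partial>lborel) = exp (- pi * s\<^sup>2)"
    unfolding G by simp
qed

definition gauss :: "'a::euclidean_space \<Rightarrow> complex" where
  "gauss x = of_real (exp (- pi * (norm x)\<^sup>2))"

lemma gauss_measurable [measurable]: "gauss \<in> borel_measurable borel"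
  unfolding gauss_def by measurable

lemma gauss_prod: "gauss x * cis (- 2 * pi * (x \<bullet> \<xi>)) =
  (\<Prod>b\<in>Basis. complex_of_real (exp (- pi * (x \<bullet> b)\<^sup>2)) * cis (- 2 * pi * (x \<bullet> b * (\<xi> \<bullet> b))))"
proof -
  have "(norm x)\<^sup>2 = (\<Sum>b\<in>Basis. (x \<bullet> b)\<^sup>2)"
    unfolding power2_norm_eq_inner by (subst euclidean_inner) (simp add: power2_eq_square)
  then have "exp (- pi * (norm x)\<^sup>2) = (\<Prod>b\<in>Basis. exp (- pi * (x \<bullet> b)\<^sup>2))"
    by (simp add: sum_distrib_left exp_sum sum_negf[symmetric])
  moreover have "cis (- 2 * pi * (x \<bullet> \<xi>)) = (\<Prod>b\<in>Basis. cis (- 2 * pi * (x \<bullet> b * (\<xi> \<bullet> b))))"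
    by (subst euclidean_inner) (simp add: cis_conv_exp sum_distrib_left exp_sum sum_negf[symmetric])
  ultimately show ?thesis by (simp add: gauss_def prod.distrib)
qed

lemma gauss_integrable: "integrable lborel (gauss :: 'a::euclidean_space \<Rightarrow> complex)"
  and ft_gauss: "ft gauss = (gauss :: 'a \<Rightarrow> complex)"
proof -
  have "integrable lborel (\<lambda>x::'a. gauss x * cis (- 2 * pi * (x \<bullet> 0)))"
    unfolding gauss_prod by (rule integral_lborel_prod(2)) (rule gaussian_1d)
  then show "integrable lborel (gauss :: 'a \<Rightarrow> complex)" by simp
  have "ft gauss \<xi> = gauss \<xi>" for \<xi> :: 'a
  proof -
    have "ft gauss \<xi> = (\<Prod>b\<in>Basis. (\<integral>x. complex_of_real (exp (- pi * x\<^sup>2)) * cis (- 2 * pi * (x * (\<xi> \<bullet> b))) \<partial>lborel))"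
      unfolding ft_def gauss_prod by (rule integral_lborel_prod(1)) (rule gaussian_1d)
    \<comment> \<open>The trivial character at 0 is inserted so that the factorization
      \<open>gauss_prod\<close> also applies to the right-hand side.\<close>
    also have "\<dots> = gauss \<xi> * cis (- 2 * pi * (\<xi> \<bullet> 0))"
      unfolding gauss_prod gaussian_1d by simp
    finally show ?thesis by simp
  qed
  then show "ft gauss = (gauss :: 'a \<Rightarrow> complex)" ..
qed

lemma wavelet_one: "wavelet f (1, y) = (\<lambda>x. f (x - y))"
  by (simp add: fun_eq_iff)

lemma sq_integrable_translate:
  fixes f :: "'a::euclidean_space \<Rightarrow> complex"
  assumes "sq_integrable lborel f"
  shows "sq_integrable lborel (\<lambda>x. f (x - y))" and "nrm lborel (\<lambda>x. f (x - y)) = nrm lborel f"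
  using sq_integrable_wavelet[OF assms, of "(1, y)"] by (simp_all add: wavelet_one)

lemma corr_bounded:
  assumes "sq_integrable lborel f" "sq_integrable lborel g"
  shows "cmod (corr f g y) \<le> nrm lborel f * nrm lborel g"
  unfolding corr_def
  using Cauchy_Schwarz_ip(2)[OF assms(1) sq_integrable_translate(1)[OF assms(2)], of y]
  by (simp add: sq_integrable_translate(2)[OF assms(2)])

lemma corr_tendsto:
  fixes f g :: "'a::euclidean_space \<Rightarrow> complex"
  assumes f: "sq_integrable lborel f" and g: "sq_integrable lborel g" and y: "y \<longlonglongrightarrow> y0"
  shows "(\<lambda>n. corr f g (y n)) \<longlonglongrightarrow> corr f g y0"
proof -
  have "(\<lambda>n. nrm lborel (\<lambda>x. wavelet g (1, y n) x - wavelet g (1, y0) x)) \<longlonglongrightarrow> 0"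
    by (rule wavelet_continuous[OF g]) (auto intro!: tendsto_Pair y)
  then have l: "(\<lambda>n. nrm lborel f * nrm lborel (\<lambda>x. g (x - y n) - g (x - y0))) \<longlonglongrightarrow> 0"
    by (intro tendsto_mult_right_zero) (simp add: wavelet_one)
  have "cmod (corr f g (y n) - corr f g y0) \<le> nrm lborel f * nrm lborel (\<lambda>x. g (x - y n) - g (x - y0))" for n
    unfolding corr_def
    by (subst ip_diff_right[symmetric])
       (intro Cauchy_Schwarz_ip sq_integrable_diff sq_integrable_translate f g)+
  then show ?thesis
    by (intro LIM_zero_cancel[OF Lim_null_comparison[OF _ l]]) auto
qed

text \<open>The multiplication formula for the dilate v(z) = u (s z) and the self-dual Gaussian. As
  s tends to 0 the weight on the left tends to 1, while for bounded continuous u the right side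
  tends to u 0: a regularized Fourier inversion at the origin.\<close>

lemma integral_ft_gauss:
  fixes u :: "'a::euclidean_space \<Rightarrow> complex"
  assumes u: "integrable lborel u" and s: "s > 0"
  shows "(\<integral>\<xi>. ft u \<xi> * gauss (s *\<^sub>R \<xi>) \<partial>lborel) = (\<integral>z. u (s *\<^sub>R z) * gauss z \<partial>lborel)"
proof -
  have [measurable]: "u \<in> borel_measurable borel" using borel_measurable_integrable[OF u] by simp
  define v where "v z = u (s *\<^sub>R z)" for z
  have [measurable]: "v \<in> borel_measurable borel" unfolding v_def by measurable
  have vi: "integrable lborel v"
    unfolding v_def using integrable_lborel_affine[of u s 0] s u by simp
  have "(\<integral>\<xi>. ft u \<xi> * gauss (s *\<^sub>R \<xi>) \<partial>lborel) =
    of_real (\<bar>1/s\<bar> ^ DIM('a)) * (\<integral>\<xi>. ft u (0 + (1/s) *\<^sub>R \<xi>) * gauss (s *\<^sub>R (0 + (1/s) *\<^sub>R \<xi>)) \<partial>lborel)"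
    by (rule integral_lborel_affine) (use s in auto)
  also have "\<dots> = (\<integral>\<xi>. (of_real (\<bar>1/s\<bar> ^ DIM('a)) * ft u ((1/s) *\<^sub>R \<xi>)) * gauss \<xi> \<partial>lborel)"
    using s by (simp add: mult.assoc)
  also have "\<dots> = (\<integral>\<xi>. ft v \<xi> * gauss \<xi> \<partial>lborel)"
  proof -
    have "ft v \<xi> = of_real (\<bar>1/s\<bar> ^ DIM('a)) * ft u ((1/s) *\<^sub>R \<xi>)" for \<xi>
      unfolding ft_def
      by (subst integral_lborel_affine[of _ "1/s" 0]) (use s in \<open>auto simp: v_def\<close>)
    then show ?thesis by simp
  qed
  also have "\<dots> = (\<integral>z. v z * ft gauss z \<partial>lborel)"
    by (rule integral_ft_mult[OF vi gauss_integrable])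
  finally show ?thesis by (simp add: ft_gauss v_def)
qed

lemma integral_gauss: "(\<integral>x. gauss x \<partial>(lborel :: 'a::euclidean_space measure)) = 1"
proof -
  have "ft gauss (0::'a) = 1" unfolding ft_gauss by (simp add: gauss_def)
  then show ?thesis by (simp add: ft_def)
qed

text \<open>Fourier inversion at 0 for \<open>corr f f\<close>, which is continuous, has the value
  |f|^2 (squared norm) at 0 and the transform |ft f|^2. Dominated convergence removes the Gaussian
  on the space side. On the frequency side the integrand is nonnegative, so monotone convergence
  yields square integrability and the value of the norm at once.\<close>

theorem Plancherel:
  fixes f :: "'a::euclidean_space \<Rightarrow> complex"
  assumes f1: "integrable lborel f" and f: "sq_integrable lborel f"
  shows "sq_integrable lborel (ft f)" and "nrm lborel (ft f) = nrm lborel f"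
proof -
  have [measurable]: "f \<in> borel_measurable borel" using borel_measurable_integrable[OF f1] by simp
  define u where "u = corr f f"
  have u: "integrable lborel u" unfolding u_def by (rule integrable_corr[OF f1 f1])
  have [measurable]: "u \<in> borel_measurable borel" using borel_measurable_integrable[OF u] by simp
  have u0: "u 0 = of_real ((nrm lborel f)\<^sup>2)" by (simp add: u_def corr_def ip_self)
  have ub: "cmod (u y) \<le> nrm lborel f * nrm lborel f" for y
    unfolding u_def by (rule corr_bounded[OF f f])
  have ftu: "ft u \<xi> = of_real ((cmod (ft f \<xi>))\<^sup>2)" for \<xi>
    unfolding u_def ft_corr[OF f1 f1] by (simp add: complex_norm_square[symmetric])
  \<comment> \<open>The parameters decrease, so the Gaussian factors increase with n, as monotone
    convergence requires.\<close>
  define s where "s n = 1 / real (Suc n)" for n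
  have s: "s n > 0" for n by (simp add: s_def)
  have s0: "s \<longlonglongrightarrow> 0" unfolding s_def by (rule LIMSEQ_Suc[OF lim_1_over_n])
  have "(\<lambda>n. \<integral>z. u (s n *\<^sub>R z) * gauss z \<partial>lborel) \<longlonglongrightarrow> (\<integral>z. u 0 * gauss (z::'a) \<partial>lborel)"
  proof (rule integral_dominated_convergence[where w="\<lambda>z. nrm lborel f * nrm lborel f * cmod (gauss z)"])
    show "integrable lborel (\<lambda>z::'a. nrm lborel f * nrm lborel f * cmod (gauss z))"
      by (intro integrable_mult_right integrable_norm gauss_integrable)
    have "(\<lambda>n. u (s n *\<^sub>R z)) \<longlonglongrightarrow> u 0" for z
      unfolding u_def using tendsto_scaleR[OF s0 tendsto_const[of z]]
      by (intro corr_tendsto f) simp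
    then show "AE z in lborel. (\<lambda>n. u (s n *\<^sub>R z) * gauss z) \<longlonglongrightarrow> u 0 * gauss z"
      by (intro AE_I2 tendsto_mult_right)
    show "AE z in lborel. norm (u (s n *\<^sub>R z) * gauss z) \<le> nrm lborel f * nrm lborel f * cmod (gauss z)" for n
      by (auto simp: norm_mult intro!: mult_right_mono ub)
  qed measurable
  then have lim: "(\<lambda>n. \<integral>z. u (s n *\<^sub>R z) * gauss z \<partial>lborel) \<longlonglongrightarrow> of_real ((nrm lborel f)\<^sup>2)"
    by (simp add: integral_gauss u0)
  define F where "F n \<xi> = (cmod (ft f \<xi>))\<^sup>2 * exp (- pi * (s n)\<^sup>2 * (norm \<xi>)\<^sup>2)" for n \<xi>
  have Fg: "complex_of_real (F n \<xi>) = ft u \<xi> * gauss (s n *\<^sub>R \<xi>)" for n \<xi>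
    by (simp add: F_def ftu gauss_def power_mult_distrib)
  have Fi: "integrable lborel (F n)" for n
  proof -
    have "integrable lborel (\<lambda>\<xi>::'a. gauss (0 + s n *\<^sub>R \<xi>))"
      by (subst integrable_lborel_affine) (use s[of n] gauss_integrable in auto)
    then have "integrable lborel (\<lambda>\<xi>::'a. (nrm lborel f * nrm lborel f + (\<integral>x. cmod (u x) \<partial>lborel)) * cmod (gauss (s n *\<^sub>R \<xi>)))"
      by simp
    then have "integrable lborel (\<lambda>\<xi>. complex_of_real (F n \<xi>))"
      unfolding Fg
      by (rule Bochner_Integration.integrable_bound)
         (auto simp: norm_mult intro!: mult_right_mono order_trans[OF norm_ft_le])
    then show ?thesis by (simp add: complex_of_real_integrable_eq)
  qed
  have Feq: "complex_of_real (\<integral>\<xi>. F n \<xi> \<partial>lborel) = (\<integral>z. u (s n *\<^sub>R z) * gauss z \<partial>lborel)" for n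
    unfolding integral_complex_of_real[symmetric] Fg by (rule integral_ft_gauss[OF u s])
  have "(\<lambda>n. \<integral>\<xi>. F n \<xi> \<partial>lborel) \<longlonglongrightarrow> (nrm lborel f)\<^sup>2"
    using lim unfolding Feq[symmetric] by (simp only: tendsto_of_real_iff)
  then have "(\<lambda>n. ennreal (\<integral>\<xi>. F n \<xi> \<partial>lborel)) \<longlonglongrightarrow> ennreal ((nrm lborel f)\<^sup>2)"
    by (rule tendsto_ennrealI)
  moreover have "ennreal (\<integral>\<xi>. F n \<xi> \<partial>lborel) = (\<integral>\<^sup>+\<xi>. ennreal (F n \<xi>) \<partial>lborel)" for n
    by (intro nn_integral_eq_integral[symmetric] Fi) (simp add: F_def)
  ultimately have l1: "(\<lambda>n. \<integral>\<^sup>+\<xi>. ennreal (F n \<xi>) \<partial>lborel) \<longlonglongrightarrow> ennreal ((nrm lborel f)\<^sup>2)"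
    by simp
  have l2: "(\<lambda>n. \<integral>\<^sup>+\<xi>. ennreal (F n \<xi>) \<partial>lborel) \<longlonglongrightarrow> (\<integral>\<^sup>+\<xi>. ennreal ((cmod (ft f \<xi>))\<^sup>2) \<partial>lborel)"
  proof (rule nn_integral_LIMSEQ)
    have "s (Suc n) \<le> s n" for n by (simp add: s_def field_simps)
    then have "(s (Suc n))\<^sup>2 \<le> (s n)\<^sup>2" for n using s[of "Suc n"] by (intro power_mono) (auto simp: less_imp_le)
    then show "incseq (\<lambda>n \<xi>. ennreal (F n \<xi>))"
      by (intro incseq_SucI le_funI ennreal_leI) (auto simp: F_def intro!: mult_left_mono mult_right_mono)
    show "(\<lambda>\<xi>. ennreal (F i \<xi>)) \<in> borel_measurable lborel" for i
      unfolding F_def by measurable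
    have "(\<lambda>n. F n \<xi>) \<longlonglongrightarrow> (cmod (ft f \<xi>))\<^sup>2 * exp (- pi * 0\<^sup>2 * (norm \<xi>)\<^sup>2)" for \<xi>
      unfolding F_def by (intro tendsto_intros s0)
    then show "(\<lambda>n. ennreal (F n \<xi>)) \<longlonglongrightarrow> ennreal ((cmod (ft f \<xi>))\<^sup>2)" for \<xi>
      by (intro tendsto_ennrealI) simp
  qed
  from LIMSEQ_unique[OF l1 l2]
  have eq: "(\<integral>\<^sup>+\<xi>. ennreal ((cmod (ft f \<xi>))\<^sup>2) \<partial>lborel) = ennreal ((nrm lborel f)\<^sup>2)" by simp
  then show s: "sq_integrable lborel (ft f)"
    by (simp add: sq_integrable_iff_nn_integral)
  have "(nrm lborel (ft f))\<^sup>2 = (nrm lborel f)\<^sup>2"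
    using eq unfolding nn_integral_square_eq_nrm[OF s] by simp
  then show "nrm lborel (ft f) = nrm lborel f" by simp
qed

section \<open>The Fourier transform of a square integrable function as a limit over
  truncations\<close>

definition trunc :: "real \<Rightarrow> ('a::euclidean_space \<Rightarrow> complex) \<Rightarrow> 'a \<Rightarrow> complex" where
  "trunc R f x = indicator (cball 0 R) x * f x"

lemma trunc_measurable [measurable]:
  fixes f :: "'a::euclidean_space \<Rightarrow> complex"
  assumes [measurable]: "f \<in> borel_measurable borel"
  shows "trunc R f \<in> borel_measurable borel"
proof -
  have [measurable]: "cball (0::'a) R \<in> sets borel" by simp
  show ?thesis unfolding trunc_def[abs_def] by measurable
qed

lemma fourier_integral_trunc:
  fixes f :: "'a::euclidean_space \<Rightarrow> complex"
  assumes [measurable]: "f \<in> borel_measurable borel"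
  shows "fourier_integral (\<lambda>x. indicator (cball 0 R) x * f x) \<xi> = ft (trunc R f) \<xi>"
  using fourier_integral_eq_ft[OF trunc_measurable[OF assms], of R \<xi>] by (simp add: trunc_def[abs_def])

text \<open>The indicator of a ball is square integrable, so the truncations are integrable by
  Cauchy--Schwarz and their Fourier integrals make sense. Monotonicity of the error in R is recorded
  because limits are taken both along integers and along all real radii.\<close>

lemma
  fixes f :: "'a::euclidean_space \<Rightarrow> complex"
  assumes f: "sq_integrable lborel f"
  shows sq_integrable_trunc: "sq_integrable lborel (trunc R f)"
    and integrable_trunc: "integrable lborel (trunc R f)"
    and nrm_trunc_antimono: "R \<le> R' \<Longrightarrow> nrm lborel (\<lambda>x. trunc R' f x - f x) \<le> nrm lborel (\<lambda>x. trunc R f x - f x)"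
    and trunc_tendsto: "(\<lambda>n. nrm lborel (\<lambda>x. trunc (real n) f x - f x)) \<longlonglongrightarrow> 0"
proof -
  have [measurable]: "f \<in> borel_measurable borel" using f by (simp add: sq_integrable_def)
  show st: "sq_integrable lborel (trunc R f)" for R
    unfolding sq_integrable_def
  proof (intro conjI)
    show "integrable lborel (\<lambda>x. (cmod (trunc R f x))\<^sup>2)"
      by (rule Bochner_Integration.integrable_bound[OF sq_integrable_integrable[OF f]])
         (auto simp: trunc_def indicator_def)
  qed simp
  have "sq_integrable lborel (\<lambda>x::'a. indicator (cball 0 R) x)"
    unfolding sq_integrable_def
  proof (intro conjI)
    have "(\<lambda>x::'a. (cmod (indicator (cball 0 R) x))\<^sup>2) = indicat_real (cball 0 R)"
      by (auto simp: indicator_def)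
    then show "integrable lborel (\<lambda>x::'a. (cmod (indicator (cball 0 R) x))\<^sup>2)" by simp
  qed (auto intro!: borel_measurable_indicator)
  from ip_integrable[OF f this]
  have "integrable lborel (\<lambda>x. f x * cnj (indicator (cball 0 R) x))" .
  also have "(\<lambda>x. f x * cnj (indicator (cball 0 R) x)) = trunc R f"
    by (auto simp: trunc_def indicator_def)
  finally show "integrable lborel (trunc R f)" .
  show "nrm lborel (\<lambda>x. trunc R' f x - f x) \<le> nrm lborel (\<lambda>x. trunc R f x - f x)" if "R \<le> R'"
    unfolding nrm_def
    by (intro real_sqrt_le_mono integral_mono sq_integrable_integrable sq_integrable_diff st f)
       (use that in \<open>auto simp: trunc_def indicator_def\<close>)
  show "(\<lambda>n. nrm lborel (\<lambda>x. trunc (real n) f x - f x)) \<longlonglongrightarrow> 0"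
  proof (rule nrm_tendsto_zero_dominated[OF _ sq_integrable_integrable[OF f]])
    have "(\<lambda>n. trunc (real n) f x - f x) \<longlonglongrightarrow> 0" for x
    proof (rule tendsto_eventually)
      have "\<forall>\<^sub>F n in sequentially. norm x \<le> real n"
        using filterlim_real_sequentially unfolding filterlim_at_top by blast
      then show "\<forall>\<^sub>F n in sequentially. trunc (real n) f x - f x = 0"
        by eventually_elim (auto simp: trunc_def)
    qed
    then show "AE x in lborel. (\<lambda>n. trunc (real n) f x - f x) \<longlonglongrightarrow> 0" by simp
  qed (auto simp: trunc_def indicator_def)
qed

lemma nrm_ft_trunc_diff:
  fixes f :: "'a::euclidean_space \<Rightarrow> complex"
  assumes f: "sq_integrable lborel f"
  shows "nrm lborel (\<lambda>\<xi>. ft (trunc R f) \<xi> - ft (trunc R' f) \<xi>)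
    \<le> nrm lborel (\<lambda>x. trunc R f x - f x) + nrm lborel (\<lambda>x. trunc R' f x - f x)"
proof -
  have "nrm lborel (\<lambda>\<xi>. ft (trunc R f) \<xi> - ft (trunc R' f) \<xi>) = nrm lborel (ft (\<lambda>x. trunc R f x - trunc R' f x))"
    by (intro arg_cong[where f="nrm lborel"] ext ft_diff[symmetric] integrable_trunc f)
  also have "\<dots> = nrm lborel (\<lambda>x. trunc R f x - trunc R' f x)"
    by (intro Plancherel Bochner_Integration.integrable_diff integrable_trunc sq_integrable_diff sq_integrable_trunc f)
  also have "\<dots> \<le> nrm lborel (\<lambda>x. trunc R f x - f x) + nrm lborel (\<lambda>x. f x - trunc R' f x)"
    by (intro nrm_triangle_diff sq_integrable_trunc f)
  finally show ?thesis by (simp add: nrm_minus_commute[of _ f])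
qed

text \<open>Completeness yields the limit along integer radii. The definition asks for all real
  radii; by Plancherel two truncations have transforms no farther apart than the sum of their
  truncation errors, which decrease in R, so the integers control the rest.\<close>

lemma is_fourier_L2_exists:
  fixes f :: "'a::euclidean_space \<Rightarrow> complex"
  assumes f: "sq_integrable lborel f"
  shows "\<exists>g. is_fourier_L2 f g"
proof -
  have [measurable]: "f \<in> borel_measurable borel" using f by (simp add: sq_integrable_def)
  define d where "d R = nrm lborel (\<lambda>x. trunc R f x - f x)" for R
  have sf: "sq_integrable lborel (ft (trunc R f))" for R
    by (intro Plancherel integrable_trunc sq_integrable_trunc f)
  have d: "\<exists>N. d (real N) < e" if "e > 0" for e
    using LIMSEQ_D[OF trunc_tendsto[OF f] that] by (auto simp: d_def)
  have dmono: "d R' \<le> d R" if "R \<le> R'" for R R'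
    unfolding d_def by (rule nrm_trunc_antimono[OF f that])
  have "\<exists>g. sq_integrable lborel g \<and> (\<lambda>n. nrm lborel (\<lambda>x. ft (trunc (real n) f) x - g x)) \<longlonglongrightarrow> 0"
  proof (rule sq_integrable_complete[OF sf])
    fix e :: real assume "e > 0"
    then obtain N where N: "d (real N) < e/2" using d[of "e/2"] by auto
    have "nrm lborel (\<lambda>x. ft (trunc (real m) f) x - ft (trunc (real n) f) x) \<le> e" if "m \<ge> N" "n \<ge> N" for m n
      using nrm_ft_trunc_diff[OF f, of "real m" "real n"] dmono[of "real N" "real m"] dmono[of "real N" "real n"] that N
      by (simp add: d_def)
    then show "\<exists>N. \<forall>m\<ge>N. \<forall>n\<ge>N. nrm lborel (\<lambda>x. ft (trunc (real m) f) x - ft (trunc (real n) f) x) \<le> e"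
      by blast
  qed
  then obtain g where g: "sq_integrable lborel g"
    and lim: "(\<lambda>n. nrm lborel (\<lambda>x. ft (trunc (real n) f) x - g x)) \<longlonglongrightarrow> 0" by blast
  have [measurable]: "g \<in> borel_measurable borel" using g by (simp add: sq_integrable_def)
  have "g \<in> L2"
    unfolding L2_def mem_Collect_eq
  proof
    show "g \<in> borel_measurable lebesgue" by (rule measurable_completion) simp
    show "integrable lebesgue (\<lambda>x. (cmod (g x))\<^sup>2)"
      by (subst integrable_completion) (use sq_integrable_integrable[OF g] in simp_all)
  qed
  moreover have "((\<lambda>R. nrm lborel (\<lambda>x. ft (trunc R f) x - g x)) \<longlongrightarrow> 0) at_top"
  proof (rule tendstoI)
    fix e :: real assume e: "e > 0"
    from d[of "e/3"] e obtain N where N: "d (real N) < e/3" by auto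
    from LIMSEQ_D[OF lim, of "e/3"] e obtain N'
      where N': "\<forall>n\<ge>N'. nrm lborel (\<lambda>x. ft (trunc (real n) f) x - g x) < e/3" by auto
    define M where "M = max N N'"
    show "\<forall>\<^sub>F R in at_top. dist (nrm lborel (\<lambda>x. ft (trunc R f) x - g x)) 0 < e"
      using eventually_ge_at_top[of "real M"]
    proof eventually_elim
      case (elim R)
      have "nrm lborel (\<lambda>x. ft (trunc R f) x - g x)
        \<le> nrm lborel (\<lambda>x. ft (trunc R f) x - ft (trunc (real M) f) x) + nrm lborel (\<lambda>x. ft (trunc (real M) f) x - g x)"
        by (intro nrm_triangle_diff sf g)
      also have "\<dots> < e"
      proof -
        have "M \<ge> N" "M \<ge> N'" by (auto simp: M_def)
        then have "d (real M) \<le> d (real N)" "nrm lborel (\<lambda>x. ft (trunc (real M) f) x - g x) < e/3"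
          using N' by (auto intro: dmono)
        moreover have "nrm lborel (\<lambda>x. ft (trunc R f) x - ft (trunc (real M) f) x) \<le> d R + d (real M)"
          unfolding d_def by (rule nrm_ft_trunc_diff[OF f])
        ultimately show ?thesis using N dmono[OF elim] by linarith
      qed
      finally show ?case by simp
    qed
  qed
  then have "((\<lambda>R. ennreal ((nrm lborel (\<lambda>x. ft (trunc R f) x - g x))\<^sup>2)) \<longlongrightarrow> ennreal (0\<^sup>2)) at_top"
    by (intro tendsto_ennrealI tendsto_power)
  then have "((\<lambda>R. \<integral>\<^sup>+\<xi>. ennreal ((cmod (fourier_integral (\<lambda>x. indicator (cball 0 R) x * f x) \<xi> - g \<xi>))\<^sup>2)
        \<partial>lebesgue) \<longlongrightarrow> 0) at_top"
    by (simp add: nn_integral_completion nn_integral_square_eq_nrm[symmetric] sq_integrable_diff sf g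
        fourier_integral_trunc)
  ultimately show ?thesis unfolding is_fourier_L2_def by blast
qed

lemma borel_representative:
  fixes f :: "'a::euclidean_space \<Rightarrow> complex"
  assumes "f \<in> borel_measurable lebesgue"
  obtains f' where "f' \<in> borel_measurable borel" "AE x in lborel. f x = f' x"
proof -
  have "\<exists>u'\<in>borel_measurable lborel. AE x in lborel. u x = u' x" if "u \<in> borel_measurable lebesgue" for u :: "'a \<Rightarrow> real"
    using completion_ex_borel_measurable_real[OF that] by blast
  from this[of "\<lambda>x. Re (f x)"] this[of "\<lambda>x. Im (f x)"] assms
  obtain u v where [measurable]: "u \<in> borel_measurable lborel" "v \<in> borel_measurable lborel"
    and ae: "AE x in lborel. Re (f x) = u x" "AE x in lborel. Im (f x) = v x"
    by auto
  show thesis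
  proof (rule that)
    show "(\<lambda>x. Complex (u x) (v x)) \<in> borel_measurable borel"
      unfolding Complex_eq by measurable
    show "AE x in lborel. f x = Complex (u x) (v x)"
      using ae by eventually_elim (simp add: complex_eq_iff)
  qed
qed

text \<open>The function g is arbitrary, hence may be the one that the choice operator picks in
  \<open>fourier_L2\<close>. It is replaced by a Borel function, and the limit is kept along
  integers only, the form in which sequences of transforms are handled later.\<close>

lemma is_fourier_L2_representative:
  fixes f :: "'a::euclidean_space \<Rightarrow> complex"
  assumes f: "sq_integrable lborel f" and g: "is_fourier_L2 f g"
  obtains g' where "sq_integrable lborel g'" "AE x in lborel. g x = g' x"
    "(\<lambda>n. nrm lborel (\<lambda>x. ft (trunc (real n) f) x - g' x)) \<longlonglongrightarrow> 0"
proof -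
  have [measurable]: "f \<in> borel_measurable borel" using f by (simp add: sq_integrable_def)
  have sf: "sq_integrable lborel (ft (trunc R f))" for R
    by (intro Plancherel integrable_trunc sq_integrable_trunc f)
  from g have gm: "g \<in> borel_measurable lebesgue" and gi: "integrable lebesgue (\<lambda>x. (cmod (g x))\<^sup>2)"
    by (auto simp: is_fourier_L2_def L2_def)
  obtain g' where [measurable]: "g' \<in> borel_measurable borel" and ae: "AE x in lborel. g x = g' x"
    by (rule borel_representative[OF gm])
  have "(\<integral>\<^sup>+x. ennreal ((cmod (g' x))\<^sup>2) \<partial>lborel) = (\<integral>\<^sup>+x. ennreal ((cmod (g x))\<^sup>2) \<partial>lborel)"
    by (rule nn_integral_cong_AE) (use ae in eventually_elim, simp)
  also have "\<dots> < \<infinity>" using gi by (simp add: integrable_iff_bounded nn_integral_completion)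
  finally have sg: "sq_integrable lborel g'" by (simp add: sq_integrable_iff_nn_integral)
  have eq: "(\<integral>\<^sup>+\<xi>. ennreal ((cmod (fourier_integral (\<lambda>x. indicator (cball 0 R) x * f x) \<xi> - g \<xi>))\<^sup>2) \<partial>lebesgue)
     = ennreal ((nrm lborel (\<lambda>x. ft (trunc R f) x - g' x))\<^sup>2)" for R
  proof -
    have "(\<integral>\<^sup>+\<xi>. ennreal ((cmod (fourier_integral (\<lambda>x. indicator (cball 0 R) x * f x) \<xi> - g \<xi>))\<^sup>2) \<partial>lebesgue)
      = (\<integral>\<^sup>+\<xi>. ennreal ((cmod (ft (trunc R f) \<xi> - g' \<xi>))\<^sup>2) \<partial>lborel)"
      unfolding nn_integral_completion
      by (rule nn_integral_cong_AE) (use ae in eventually_elim, simp add: fourier_integral_trunc)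
    also have "\<dots> = ennreal ((nrm lborel (\<lambda>x. ft (trunc R f) x - g' x))\<^sup>2)"
      by (intro nn_integral_square_eq_nrm sq_integrable_diff sf sg)
    finally show ?thesis .
  qed
  have "((\<lambda>R. ennreal ((nrm lborel (\<lambda>x. ft (trunc R f) x - g' x))\<^sup>2)) \<longlongrightarrow> 0) at_top"
    using g unfolding is_fourier_L2_def eq by blast
  then have "(\<lambda>n. ennreal ((nrm lborel (\<lambda>x. ft (trunc (real n) f) x - g' x))\<^sup>2)) \<longlonglongrightarrow> 0"
    by (rule filterlim_compose[OF _ filterlim_real_sequentially])
  then have "(\<lambda>n. (nrm lborel (\<lambda>x. ft (trunc (real n) f) x - g' x))\<^sup>2) \<longlonglongrightarrow> 0"
    by (subst (asm) ennreal_tendsto_0_iff) auto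
  from tendsto_real_sqrt[OF this]
  have "(\<lambda>n. nrm lborel (\<lambda>x. ft (trunc (real n) f) x - g' x)) \<longlonglongrightarrow> 0" by simp
  with sg ae show thesis by (rule that)
qed

section \<open>The wavelet transform is an isometry\<close>

lemma nrm_tendsto_zero_imp_Cauchy:
  fixes F :: "nat \<Rightarrow> 'a \<Rightarrow> complex"
  assumes F: "\<And>n. sq_integrable M (F n)" and G: "sq_integrable M G"
    and lim: "(\<lambda>n. nrm M (\<lambda>x. F n x - G x)) \<longlonglongrightarrow> 0" and "e > 0"
  shows "\<exists>N. \<forall>m\<ge>N. \<forall>n\<ge>N. nrm M (\<lambda>x. F m x - F n x) \<le> e"
proof -
  from LIMSEQ_D[OF lim, of "e/2"] \<open>e > 0\<close>
  obtain N where N: "\<forall>n\<ge>N. nrm M (\<lambda>x. F n x - G x) < e/2" by auto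
  have "nrm M (\<lambda>x. F m x - F n x) \<le> e" if "m \<ge> N" "n \<ge> N" for m n
  proof -
    have "nrm M (\<lambda>x. F m x - F n x) \<le> nrm M (\<lambda>x. F m x - G x) + nrm M (\<lambda>x. G x - F n x)"
      by (intro nrm_triangle_diff F G)
    also have "nrm M (\<lambda>x. G x - F n x) = nrm M (\<lambda>x. F n x - G x)" by (rule nrm_minus_commute)
    finally show ?thesis using N[rule_format, of m] N[rule_format, of n] that by linarith
  qed
  then show ?thesis by blast
qed

definition wt :: "('a::euclidean_space \<Rightarrow> complex) \<Rightarrow> ('a \<Rightarrow> complex) \<Rightarrow> real \<times> 'a \<Rightarrow> complex" where
  "wt \<phi> f p = ip lborel f (wavelet \<phi> p)"

lemma wt_measurable_compose [measurable (raw)]: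
  fixes \<phi> f :: "'a::euclidean_space \<Rightarrow> complex"
  assumes [measurable]: "\<phi> \<in> borel_measurable borel" "f \<in> borel_measurable borel" "u \<in> borel_measurable M"
  shows "(\<lambda>x. wt \<phi> f (u x)) \<in> borel_measurable M"
  unfolding wt_def ip_def by measurable

lemma wt_measurable [measurable]:
  fixes \<phi> f :: "'a::euclidean_space \<Rightarrow> complex"
  assumes [measurable]: "\<phi> \<in> borel_measurable borel" "f \<in> borel_measurable borel"
  shows "wt \<phi> f \<in> borel_measurable borel"
  using wt_measurable_compose[OF assms measurable_ident_sets[OF refl]] by simp

text \<open>Plancherel in the variable b for the correlation of f with the dilated wavelet. The
  powers of a cancel: a^-d from the squared normalization, a^-d from substituting y = a b, and
  a^(2d) from the squared transform of the dilate.\<close>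

lemma nn_integral_wt_slice_L1:
  fixes f \<psi> :: "'a::euclidean_space \<Rightarrow> complex"
  assumes f1: "integrable lborel f" and f: "sq_integrable lborel f"
    and \<psi>1: "integrable lborel \<psi>" and \<psi>: "sq_integrable lborel \<psi>" and a: "a > 0"
  shows "(\<integral>\<^sup>+b. ennreal ((cmod (wt \<psi> f (a, b)))\<^sup>2) \<partial>lborel)
    = (\<integral>\<^sup>+\<xi>. ennreal ((cmod (ft f \<xi> * ft \<psi> (a *\<^sub>R \<xi>)))\<^sup>2) \<partial>lborel)"
proof -
  have [measurable]: "f \<in> borel_measurable borel" "\<psi> \<in> borel_measurable borel"
    using f \<psi> by (auto simp: sq_integrable_def)
  define \<psi>a where "\<psi>a x = \<psi> (inverse a *\<^sub>R x)" for x
  define c where "c = complex_of_real (a powr (- real DIM('a) / 2))"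
  have c2: "(cmod c)\<^sup>2 = inverse (a ^ DIM('a))"
    using a by (simp add: c_def powr_realpow[symmetric] powr_minus[symmetric] powr_powr flip: powr_numeral)
  have [measurable]: "\<psi>a \<in> borel_measurable borel" unfolding \<psi>a_def by measurable
  have \<psi>a1: "integrable lborel \<psi>a"
    unfolding \<psi>a_def using integrable_lborel_affine[of \<psi> "inverse a" 0] a \<psi>1 by simp
  have w0: "wavelet \<psi> (a, 0) = (\<lambda>x. c * \<psi>a x)" by (simp add: \<psi>a_def c_def fun_eq_iff)
  have "sq_integrable lborel (\<lambda>x. inverse c * wavelet \<psi> (a, 0) x)"
    by (intro sq_integrable_cmult sq_integrable_wavelet(1) \<psi>) (use a in auto)
  moreover have "c \<noteq> 0" using a by (simp add: c_def)
  ultimately have \<psi>a: "sq_integrable lborel \<psi>a" unfolding w0 by (simp add: mult.assoc[symmetric])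
  have wtc: "wt \<psi> f (a, b) = cnj c * corr f \<psi>a (a *\<^sub>R b)" for b
  proof -
    have "wavelet \<psi> (a, b) = (\<lambda>x. c * \<psi>a (x - a *\<^sub>R b))"
      using a by (simp add: \<psi>a_def c_def fun_eq_iff scaleR_diff_right)
    then show ?thesis by (simp add: wt_def corr_def ip_cmult_right)
  qed
  have ci: "integrable lborel (corr f \<psi>a)" by (rule integrable_corr[OF f1 \<psi>a1])
  then have [measurable]: "corr f \<psi>a \<in> borel_measurable borel" using borel_measurable_integrable by force
  have cs: "sq_integrable lborel (corr f \<psi>a)"
    unfolding sq_integrable_def
  proof (intro conjI)
    define B where "B = nrm lborel f * nrm lborel \<psi>a"
    have B: "cmod (corr f \<psi>a y) \<le> B" for y unfolding B_def by (rule corr_bounded[OF f \<psi>a])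
    have B0: "B \<ge> 0" by (simp add: B_def)
    show "integrable lborel (\<lambda>x. (cmod (corr f \<psi>a x))\<^sup>2)"
      by (rule Bochner_Integration.integrable_bound[of _ "\<lambda>x. B * cmod (corr f \<psi>a x)"])
         (use ci in \<open>auto simp: power2_eq_square B0 intro!: mult_right_mono B\<close>)
  qed simp
  have ft\<psi>a: "ft \<psi>a \<xi> = of_real (a ^ DIM('a)) * ft \<psi> (a *\<^sub>R \<xi>)" for \<xi>
    unfolding ft_def by (subst integral_lborel_affine[of _ a 0]) (use a in \<open>auto simp: \<psi>a_def\<close>)
  have "(\<integral>\<^sup>+b. ennreal ((cmod (wt \<psi> f (a, b)))\<^sup>2) \<partial>lborel)
     = (\<integral>\<^sup>+b. ennreal (inverse (a ^ DIM('a))) * ennreal ((cmod (corr f \<psi>a (0 + a *\<^sub>R b)))\<^sup>2) \<partial>lborel)"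
    using a by (intro nn_integral_cong) (simp add: wtc norm_mult power_mult_distrib c2 ennreal_mult)
  also have "\<dots> = ennreal (inverse (a ^ DIM('a))) * (\<integral>\<^sup>+b. ennreal ((cmod (corr f \<psi>a (0 + a *\<^sub>R b)))\<^sup>2) \<partial>lborel)"
    by (rule nn_integral_cmult) measurable
  also have "(\<integral>\<^sup>+b. ennreal ((cmod (corr f \<psi>a (0 + a *\<^sub>R b)))\<^sup>2) \<partial>lborel)
     = ennreal (inverse (a ^ DIM('a))) * (ennreal (a ^ DIM('a)) * (\<integral>\<^sup>+b. ennreal ((cmod (corr f \<psi>a (0 + a *\<^sub>R b)))\<^sup>2) \<partial>lborel))"
    using a by (simp add: mult.assoc[symmetric] flip: ennreal_mult')
  also have "ennreal (a ^ DIM('a)) * (\<integral>\<^sup>+b. ennreal ((cmod (corr f \<psi>a (0 + a *\<^sub>R b)))\<^sup>2) \<partial>lborel)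
     = (\<integral>\<^sup>+y. ennreal ((cmod (corr f \<psi>a y))\<^sup>2) \<partial>lborel)"
    using nn_integral_lborel_affine[of "\<lambda>y. ennreal ((cmod (corr f \<psi>a y))\<^sup>2)" a 0] a by simp
  also have "\<dots> = (\<integral>\<^sup>+\<xi>. ennreal ((cmod (ft (corr f \<psi>a) \<xi>))\<^sup>2) \<partial>lborel)"
    using nn_integral_square_eq_nrm[OF cs] nn_integral_square_eq_nrm[OF Plancherel(1)[OF ci cs]] Plancherel(2)[OF ci cs]
    by simp
  also have "\<dots> = (\<integral>\<^sup>+\<xi>. (ennreal (a ^ DIM('a)) * ennreal (a ^ DIM('a))) * ennreal ((cmod (ft f \<xi> * ft \<psi> (a *\<^sub>R \<xi>)))\<^sup>2) \<partial>lborel)"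
    using a unfolding ft_corr[OF f1 \<psi>a1] ft\<psi>a
    by (intro nn_integral_cong) (simp add: norm_mult power_mult_distrib power2_eq_square mult_ac norm_power flip: ennreal_mult)
  also have "\<dots> = (ennreal (a ^ DIM('a)) * ennreal (a ^ DIM('a))) * (\<integral>\<^sup>+\<xi>. ennreal ((cmod (ft f \<xi> * ft \<psi> (a *\<^sub>R \<xi>)))\<^sup>2) \<partial>lborel)"
    by (rule nn_integral_cmult) measurable
  also have "ennreal (inverse (a ^ DIM('a))) * (ennreal (inverse (a ^ DIM('a))) * \<dots>)
    = ennreal (inverse (a ^ DIM('a)) * (inverse (a ^ DIM('a)) * (a ^ DIM('a) * a ^ DIM('a)))) * (\<integral>\<^sup>+\<xi>. ennreal ((cmod (ft f \<xi> * ft \<psi> (a *\<^sub>R \<xi>)))\<^sup>2) \<partial>lborel)"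
    using a by (simp add: ennreal_mult mult.assoc)
  also have "inverse (a ^ DIM('a)) * (inverse (a ^ DIM('a)) * (a ^ DIM('a) * a ^ DIM('a))) = 1"
    using a by (simp add: field_simps)
  finally show ?thesis by simp
qed

text \<open>Since f is integrable, \<open>ft f\<close> is bounded and multiplication by it is
  continuous in norm; hence the right sides for the truncations of the wavelet converge. The left
  sides have the same mutual distances, so they are Cauchy too, and their limit is identified
  pointwise.\<close>

lemma nn_integral_wt_slice:
  fixes f \<psi> g :: "'a::euclidean_space \<Rightarrow> complex"
  assumes f1: "integrable lborel f" and f: "sq_integrable lborel f"
    and \<psi>: "sq_integrable lborel \<psi>" and g: "sq_integrable lborel g"
    and lim: "(\<lambda>n. nrm lborel (\<lambda>x. ft (trunc (real n) \<psi>) x - g x)) \<longlonglongrightarrow> 0" and a: "a > 0"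
  shows "(\<integral>\<^sup>+b. ennreal ((cmod (wt \<psi> f (a, b)))\<^sup>2) \<partial>lborel)
    = (\<integral>\<^sup>+\<xi>. ennreal ((cmod (ft f \<xi> * g (a *\<^sub>R \<xi>)))\<^sup>2) \<partial>lborel)"
proof -
  have [measurable]: "f \<in> borel_measurable borel" "\<psi> \<in> borel_measurable borel" "g \<in> borel_measurable borel"
    using f \<psi> g by (auto simp: sq_integrable_def)
  define \<psi>n where "\<psi>n n = trunc (real n) \<psi>" for n
  have sq\<psi>n: "sq_integrable lborel (\<psi>n n)" and \<psi>n1: "integrable lborel (\<psi>n n)" for n
    unfolding \<psi>n_def by (intro sq_integrable_trunc integrable_trunc \<psi>)+
  have [measurable]: "\<psi>n n \<in> borel_measurable borel" for n using sq\<psi>n by (simp add: sq_integrable_def)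
  define F where "F n b = wt (\<psi>n n) f (a, b)" for n b
  define G where "G n \<xi> = ft f \<xi> * ft (\<psi>n n) (a *\<^sub>R \<xi>)" for n \<xi>
  define F' where "F' b = wt \<psi> f (a, b)" for b
  define G' where "G' \<xi> = ft f \<xi> * g (a *\<^sub>R \<xi>)" for \<xi>
  have [measurable]: "F n \<in> borel_measurable borel" "G n \<in> borel_measurable borel"
    "F' \<in> borel_measurable borel" "G' \<in> borel_measurable borel" for n
    unfolding F_def F'_def G_def G'_def by measurable
  define L where "L = (\<integral>x. cmod (f x) \<partial>lborel)"
  have L0: "L \<ge> 0" by (simp add: L_def)
  have mult_bound: "sq_integrable lborel (\<lambda>\<xi>. ft f \<xi> * h (a *\<^sub>R \<xi>)) \<and>
      nrm lborel (\<lambda>\<xi>. ft f \<xi> * h (a *\<^sub>R \<xi>)) \<le> L * a powr (- real DIM('a) / 2) * nrm lborel h"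
    if h: "sq_integrable lborel h" for h
  proof -
    have [measurable]: "h \<in> borel_measurable borel" using h by (simp add: sq_integrable_def)
    \<comment> \<open>The dilate of h is expressed through the unitary action at scale 1/a, which
      gives its norm without a new change of variables.\<close>
    have wh: "wavelet h (inverse a, 0) \<xi> = of_real (a powr (real DIM('a) / 2)) * h (a *\<^sub>R \<xi>)" for \<xi>
      using a by (simp add: inverse_powr powr_minus)
    have sw: "sq_integrable lborel (wavelet h (inverse a, 0))" "nrm lborel (wavelet h (inverse a, 0)) = nrm lborel h"
      by (intro sq_integrable_wavelet h; use a in simp)+
    define k where "k \<xi> = of_real (L * a powr (- real DIM('a) / 2)) * wavelet h (inverse a, 0) \<xi>" for \<xi>
    have k: "sq_integrable lborel k" unfolding k_def by (intro sq_integrable_cmult sw)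
    have nk: "nrm lborel k = L * a powr (- real DIM('a) / 2) * nrm lborel h"
      unfolding k_def nrm_cmult sw(2) using L0 by (simp add: norm_mult)
    have kb: "cmod (ft f \<xi> * h (a *\<^sub>R \<xi>)) \<le> cmod (k \<xi>)" for \<xi>
    proof -
      have "cmod (k \<xi>) = L * cmod (h (a *\<^sub>R \<xi>))"
        unfolding k_def wh using a L0 by (simp add: norm_mult norm_inverse powr_minus)
      then show ?thesis using norm_ft_le[of f \<xi>] by (simp add: norm_mult L_def mult_right_mono)
    qed
    have s: "sq_integrable lborel (\<lambda>\<xi>. ft f \<xi> * h (a *\<^sub>R \<xi>))"
      unfolding sq_integrable_def
    proof (intro conjI)
      show "integrable lborel (\<lambda>\<xi>. (cmod (ft f \<xi> * h (a *\<^sub>R \<xi>)))\<^sup>2)"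
        by (rule Bochner_Integration.integrable_bound[OF sq_integrable_integrable[OF k]])
           (use kb in \<open>auto intro!: power_mono\<close>)
    qed measurable
    moreover have "nrm lborel (\<lambda>\<xi>. ft f \<xi> * h (a *\<^sub>R \<xi>)) \<le> nrm lborel k"
      unfolding nrm_def by (intro real_sqrt_le_mono integral_mono sq_integrable_integrable s k power_mono kb) auto
    ultimately show ?thesis unfolding nk by simp
  qed
  have sft: "sq_integrable lborel (ft (\<psi>n n))" for n by (intro Plancherel \<psi>n1 sq\<psi>n)
  have sG: "sq_integrable lborel (G n)" for n unfolding G_def using mult_bound[OF sft] by blast
  have sG': "sq_integrable lborel G'" unfolding G'_def using mult_bound[OF g] by blast
  have Glim: "(\<lambda>n. nrm lborel (\<lambda>x. G n x - G' x)) \<longlonglongrightarrow> 0"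
  proof (rule Lim_null_comparison)
    show "(\<lambda>n. L * a powr (- real DIM('a) / 2) * nrm lborel (\<lambda>x. ft (\<psi>n n) x - g x)) \<longlonglongrightarrow> 0"
      using lim unfolding \<psi>n_def by (rule tendsto_mult_right_zero)
    have "(\<lambda>x. G n x - G' x) = (\<lambda>\<xi>. ft f \<xi> * (ft (\<psi>n n) (a *\<^sub>R \<xi>) - g (a *\<^sub>R \<xi>)))" for n
      by (simp add: G_def G'_def right_diff_distrib)
    then show "\<forall>\<^sub>F n in sequentially. norm (nrm lborel (\<lambda>x. G n x - G' x)) \<le> L * a powr (- real DIM('a) / 2) * nrm lborel (\<lambda>x. ft (\<psi>n n) x - g x)"
      using mult_bound[OF sq_integrable_diff[OF sft g]] by (intro always_eventually) simp
  qed
  have eqFG: "(\<integral>\<^sup>+b. ennreal ((cmod (F n b))\<^sup>2) \<partial>lborel) = (\<integral>\<^sup>+\<xi>. ennreal ((cmod (G n \<xi>))\<^sup>2) \<partial>lborel)" for n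
    unfolding F_def G_def by (rule nn_integral_wt_slice_L1[OF f1 f \<psi>n1 sq\<psi>n a])
  have sF: "sq_integrable lborel (F n)" for n
    using sG[of n] eqFG[of n] by (simp add: sq_integrable_iff_nn_integral)
  have nFG: "nrm lborel (F n) = nrm lborel (G n)" for n
    using eqFG[of n] by (simp add: nn_integral_square_eq_nrm sF sG)
  \<comment> \<open>Both sides depend linearly on the wavelet, so the slice identity applied to the
    difference of two truncations transfers the Cauchy property from \<open>G\<close> to
    \<open>F\<close>.\<close>
  have dFG: "nrm lborel (\<lambda>x. F m x - F n x) = nrm lborel (\<lambda>x. G m x - G n x)" for m n
  proof -
    define \<delta> where "\<delta> x = \<psi>n m x - \<psi>n n x" for x
    have \<delta>: "integrable lborel \<delta>" "sq_integrable lborel \<delta>"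
      unfolding \<delta>_def by (intro Bochner_Integration.integrable_diff sq_integrable_diff \<psi>n1 sq\<psi>n)+
    have e1: "F m b - F n b = wt \<delta> f (a, b)" for b
      unfolding F_def wt_def \<delta>_def wavelet_diff[symmetric]
      by (rule ip_diff_right[symmetric]) (intro sq_integrable_wavelet(1) sq\<psi>n f; use a in simp)+
    have e2: "G m \<xi> - G n \<xi> = ft f \<xi> * ft \<delta> (a *\<^sub>R \<xi>)" for \<xi>
      unfolding G_def \<delta>_def ft_diff[OF \<psi>n1 \<psi>n1] by (simp add: right_diff_distrib)
    have "(\<integral>\<^sup>+b. ennreal ((cmod (F m b - F n b))\<^sup>2) \<partial>lborel) = (\<integral>\<^sup>+\<xi>. ennreal ((cmod (G m \<xi> - G n \<xi>))\<^sup>2) \<partial>lborel)"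
      unfolding e1 e2 by (rule nn_integral_wt_slice_L1[OF f1 f \<delta> a])
    then show ?thesis by (simp add: nn_integral_square_eq_nrm sq_integrable_diff sF sG)
  qed
  have Flim: "(\<lambda>n. F n b) \<longlonglongrightarrow> F' b" for b
  proof -
    have l: "(\<lambda>n. nrm lborel f * nrm lborel (\<lambda>x. \<psi>n n x - \<psi> x)) \<longlonglongrightarrow> 0"
      unfolding \<psi>n_def by (rule tendsto_mult_right_zero[OF trunc_tendsto[OF \<psi>]])
    have "cmod (F n b - F' b) \<le> nrm lborel f * nrm lborel (\<lambda>x. \<psi>n n x - \<psi> x)" for n
    proof -
      have "F n b - F' b = ip lborel f (wavelet (\<lambda>x. \<psi>n n x - \<psi> x) (a, b))"
        unfolding F_def F'_def wt_def wavelet_diff[symmetric]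
        by (rule ip_diff_right[symmetric]) (intro sq_integrable_wavelet(1) sq\<psi>n f \<psi>; use a in simp)+
      moreover have "sq_integrable lborel (wavelet (\<lambda>x. \<psi>n n x - \<psi> x) (a, b))"
        "nrm lborel (wavelet (\<lambda>x. \<psi>n n x - \<psi> x) (a, b)) = nrm lborel (\<lambda>x. \<psi>n n x - \<psi> x)"
        by (intro sq_integrable_wavelet sq_integrable_diff sq\<psi>n \<psi>; use a in simp)+
      ultimately show ?thesis using Cauchy_Schwarz_ip(2)[OF f] by metis
    qed
    then show ?thesis by (intro LIM_zero_cancel[OF Lim_null_comparison[OF _ l]]) auto
  qed
  have CF: "\<exists>N. \<forall>m\<ge>N. \<forall>n\<ge>N. nrm lborel (\<lambda>x. F m x - F n x) \<le> e" if "e > 0" for e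
    unfolding dFG by (rule nrm_tendsto_zero_imp_Cauchy[OF sG sG' Glim that])
  have sF': "sq_integrable lborel F'" and F'lim: "(\<lambda>n. nrm lborel (\<lambda>x. F n x - F' x)) \<longlonglongrightarrow> 0"
    by (rule sq_integrable_pointwise_limit[OF sF _ _ CF]; use Flim in simp)+
  have "(\<lambda>n. nrm lborel (G n)) \<longlonglongrightarrow> nrm lborel F'"
    using nrm_tendsto[OF sF sF' F'lim] unfolding nFG .
  moreover have "(\<lambda>n. nrm lborel (G n)) \<longlonglongrightarrow> nrm lborel G'" by (rule nrm_tendsto[OF sG sG' Glim])
  ultimately have "nrm lborel F' = nrm lborel G'" by (rule LIMSEQ_unique)
  then show ?thesis
    using nn_integral_square_eq_nrm[OF sF'] nn_integral_square_eq_nrm[OF sG'] by (simp add: F'_def G'_def)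
qed

text \<open>The Borel counterpart of \<open>haar\<close>, on the whole of \<open>real \<times> 'a\<close>, so that Tonelli's theorem applies.\<close>

definition hm :: "(real \<times> 'a::euclidean_space) measure" where
  "hm = density lborel (\<lambda>p. ennreal (indicator {0<..} (fst p) / fst p))"

lemma sets_hm [simp, measurable_cong]: "sets hm = sets borel"
  by (simp add: hm_def)

lemma space_hm [simp]: "space hm = UNIV"
  by (simp add: hm_def)

lemma nn_integral_hm:
  fixes u :: "real \<times> 'a::euclidean_space \<Rightarrow> ennreal"
  assumes [measurable]: "u \<in> borel_measurable borel"
  shows "(\<integral>\<^sup>+p. u p \<partial>hm) = (\<integral>\<^sup>+a. ennreal (indicator {0<..} a / a) * (\<integral>\<^sup>+b. u (a, b) \<partial>lborel) \<partial>lborel)"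
proof -
  have [measurable]: "u \<in> borel_measurable (lborel \<Otimes>\<^sub>M lborel)"
    using assms by (simp add: lborel_prod)
  have "(\<integral>\<^sup>+p. u p \<partial>hm) = (\<integral>\<^sup>+p. ennreal (indicator {0<..} (fst p) / fst p) * u p \<partial>(lborel \<Otimes>\<^sub>M lborel))"
    unfolding hm_def lborel_prod by (subst nn_integral_density) auto
  also have "\<dots> = (\<integral>\<^sup>+a. \<integral>\<^sup>+b. ennreal (indicator {0<..} (fst (a, b)) / fst (a, b)) * u (a, b) \<partial>lborel \<partial>lborel)"
    by (rule lborel.nn_integral_fst[symmetric]) measurable
  also have "\<dots> = (\<integral>\<^sup>+a. ennreal (indicator {0<..} a / a) * (\<integral>\<^sup>+b. u (a, b) \<partial>lborel) \<partial>lborel)"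
    by (intro nn_integral_cong) (simp add: nn_integral_cmult)
  finally show ?thesis .
qed

text \<open>For integrable f the slices are integrated over a; Tonelli moves the scale integral
  inside, where admissibility makes it 1, and Plancherel remains. For general f the truncations are
  used: their transforms are Cauchy by the first case applied to differences and converge pointwise
  by Cauchy--Schwarz.\<close>

lemma wt_isometry:
  fixes f \<phi> g :: "'a::euclidean_space \<Rightarrow> complex"
  assumes \<phi>: "sq_integrable lborel \<phi>" and g: "sq_integrable lborel g"
    and lim: "(\<lambda>n. nrm lborel (\<lambda>x. ft (trunc (real n) \<phi>) x - g x)) \<longlonglongrightarrow> 0"
    and adm: "AE \<xi> in lborel. (\<integral>\<^sup>+a. ennreal (indicator {0<..} a / a) * ennreal ((cmod (g (a *\<^sub>R \<xi>)))\<^sup>2) \<partial>lborel) = 1"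
    and f: "sq_integrable lborel f"
  shows "sq_integrable hm (wt \<phi> f)" and "nrm hm (wt \<phi> f) = nrm lborel f"
proof -
  have [measurable]: "\<phi> \<in> borel_measurable borel" "g \<in> borel_measurable borel"
    using \<phi> g by (auto simp: sq_integrable_def)
  have L1: "(\<integral>\<^sup>+p. ennreal ((cmod (wt \<phi> f p))\<^sup>2) \<partial>hm) = ennreal ((nrm lborel f)\<^sup>2)"
    if f1: "integrable lborel f" and f: "sq_integrable lborel f" for f
  proof -
    have [measurable]: "f \<in> borel_measurable borel" using f by (auto simp: sq_integrable_def)
    have "(\<integral>\<^sup>+p. ennreal ((cmod (wt \<phi> f p))\<^sup>2) \<partial>hm)
      = (\<integral>\<^sup>+a. ennreal (indicator {0<..} a / a) * (\<integral>\<^sup>+b. ennreal ((cmod (wt \<phi> f (a, b)))\<^sup>2) \<partial>lborel) \<partial>lborel)"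
      by (rule nn_integral_hm) measurable
    also have "\<dots> = (\<integral>\<^sup>+a. ennreal (indicator {0<..} a / a) * (\<integral>\<^sup>+\<xi>. ennreal ((cmod (ft f \<xi> * g (a *\<^sub>R \<xi>)))\<^sup>2) \<partial>lborel) \<partial>lborel)"
    proof (rule nn_integral_cong)
      fix a :: real
      show "ennreal (indicator {0<..} a / a) * (\<integral>\<^sup>+b. ennreal ((cmod (wt \<phi> f (a, b)))\<^sup>2) \<partial>lborel)
        = ennreal (indicator {0<..} a / a) * (\<integral>\<^sup>+\<xi>. ennreal ((cmod (ft f \<xi> * g (a *\<^sub>R \<xi>)))\<^sup>2) \<partial>lborel)"
        using nn_integral_wt_slice[OF f1 f \<phi> g lim, of a] by (cases "a > 0") auto
    qed
    also have "\<dots> = (\<integral>\<^sup>+a. \<integral>\<^sup>+\<xi>. ennreal (indicator {0<..} a / a) * ennreal ((cmod (ft f \<xi> * g (a *\<^sub>R \<xi>)))\<^sup>2) \<partial>lborel \<partial>lborel)"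
      by (intro nn_integral_cong nn_integral_cmult[symmetric]) measurable
    also have "\<dots> = (\<integral>\<^sup>+\<xi>. \<integral>\<^sup>+a. ennreal (indicator {0<..} a / a) * ennreal ((cmod (ft f \<xi> * g (a *\<^sub>R \<xi>)))\<^sup>2) \<partial>lborel \<partial>lborel)"
      by (rule lborel_pair.Fubini'[symmetric]) measurable
    also have "\<dots> = (\<integral>\<^sup>+\<xi>. ennreal ((cmod (ft f \<xi>))\<^sup>2) * (\<integral>\<^sup>+a. ennreal (indicator {0<..} a / a) * ennreal ((cmod (g (a *\<^sub>R \<xi>)))\<^sup>2) \<partial>lborel) \<partial>lborel)"
    proof (rule nn_integral_cong)
      fix \<xi> :: 'a
      have "(\<integral>\<^sup>+a. ennreal (indicator {0<..} a / a) * ennreal ((cmod (ft f \<xi> * g (a *\<^sub>R \<xi>)))\<^sup>2) \<partial>lborel)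
        = (\<integral>\<^sup>+a. ennreal ((cmod (ft f \<xi>))\<^sup>2) * (ennreal (indicator {0<..} a / a) * ennreal ((cmod (g (a *\<^sub>R \<xi>)))\<^sup>2)) \<partial>lborel)"
        by (intro nn_integral_cong) (simp add: norm_mult power_mult_distrib ennreal_mult mult_ac)
      also have "\<dots> = ennreal ((cmod (ft f \<xi>))\<^sup>2) * (\<integral>\<^sup>+a. ennreal (indicator {0<..} a / a) * ennreal ((cmod (g (a *\<^sub>R \<xi>)))\<^sup>2) \<partial>lborel)"
        by (rule nn_integral_cmult) measurable
      finally show "(\<integral>\<^sup>+a. ennreal (indicator {0<..} a / a) * ennreal ((cmod (ft f \<xi> * g (a *\<^sub>R \<xi>)))\<^sup>2) \<partial>lborel) = \<dots>" .
    qed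
    also have "\<dots> = (\<integral>\<^sup>+\<xi>. ennreal ((cmod (ft f \<xi>))\<^sup>2) \<partial>lborel)"
      by (rule nn_integral_cong_AE) (use adm in eventually_elim, simp)
    also have "\<dots> = ennreal ((nrm lborel f)\<^sup>2)"
      using nn_integral_square_eq_nrm[OF Plancherel(1)[OF f1 f]] Plancherel(2)[OF f1 f] by simp
    finally show ?thesis .
  qed
  have [measurable]: "f \<in> borel_measurable borel" using f by (auto simp: sq_integrable_def)
  define fn where "fn n = trunc (real n) f" for n
  have fn1: "integrable lborel (fn n)" and fn: "sq_integrable lborel (fn n)" for n
    unfolding fn_def by (intro integrable_trunc sq_integrable_trunc f)+
  have [measurable]: "fn n \<in> borel_measurable borel" for n using fn by (auto simp: sq_integrable_def)
  have L1s: "sq_integrable hm (wt \<phi> h) \<and> nrm hm (wt \<phi> h) = nrm lborel h"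
    if "integrable lborel h" "sq_integrable lborel h" for h
  proof -
    have [measurable]: "h \<in> borel_measurable borel" using that by (auto simp: sq_integrable_def)
    have s: "sq_integrable hm (wt \<phi> h)"
      unfolding sq_integrable_iff_nn_integral using L1[OF that] by simp
    show ?thesis using s L1[OF that] nn_integral_square_eq_nrm[OF s] by simp
  qed
  have sw: "sq_integrable hm (wt \<phi> (fn n))" and nw: "nrm hm (wt \<phi> (fn n)) = nrm lborel (fn n)" for n
    using L1s[OF fn1 fn] by auto
  have flim: "(\<lambda>n. nrm lborel (\<lambda>x. fn n x - f x)) \<longlonglongrightarrow> 0" unfolding fn_def by (rule trunc_tendsto[OF f])
  have wd: "wt \<phi> u p - wt \<phi> v p = wt \<phi> (\<lambda>x. u x - v x) p"
    if "sq_integrable lborel u" "sq_integrable lborel v" "fst p > 0" for u v p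
    unfolding wt_def by (rule ip_diff_left[symmetric]) (intro that sq_integrable_wavelet \<phi>)+
  have ae0: "AE p in (hm :: (real \<times> 'a) measure). fst p > 0"
    unfolding hm_def by (subst AE_density) (auto simp: indicator_def)
  have dw: "nrm hm (\<lambda>p. wt \<phi> (fn m) p - wt \<phi> (fn n) p) = nrm lborel (\<lambda>x. fn m x - fn n x)" for m n
  proof -
    have "nrm hm (\<lambda>p. wt \<phi> (fn m) p - wt \<phi> (fn n) p) = nrm hm (wt \<phi> (\<lambda>x. fn m x - fn n x))"
      unfolding nrm_def by (intro arg_cong[where f=sqrt] integral_cong_AE)
        (measurable, use ae0 in eventually_elim, simp add: wd fn)
    also have "\<dots> = nrm lborel (\<lambda>x. fn m x - fn n x)"
      by (intro L1s[THEN conjunct2] Bochner_Integration.integrable_diff sq_integrable_diff fn1 fn)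
    finally show ?thesis .
  qed
  have C: "\<exists>N. \<forall>m\<ge>N. \<forall>n\<ge>N. nrm hm (\<lambda>p. wt \<phi> (fn m) p - wt \<phi> (fn n) p) \<le> e" if "e > 0" for e
    unfolding dw by (rule nrm_tendsto_zero_imp_Cauchy[OF fn f flim that])
  have plim: "AE p in hm. (\<lambda>n. wt \<phi> (fn n) p) \<longlonglongrightarrow> wt \<phi> f p"
    using ae0
  proof eventually_elim
    case (elim p)
    have l: "(\<lambda>n. nrm lborel (\<lambda>x. fn n x - f x) * nrm lborel \<phi>) \<longlonglongrightarrow> 0"
      by (rule tendsto_mult_left_zero[OF flim])
    have "cmod (wt \<phi> (fn n) p - wt \<phi> f p) \<le> nrm lborel (\<lambda>x. fn n x - f x) * nrm lborel \<phi>" for n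
      using Cauchy_Schwarz_ip(2)[OF sq_integrable_diff[OF fn f] sq_integrable_wavelet(1)[OF \<phi> elim], of n]
      unfolding wd[OF fn f elim] by (simp add: wt_def sq_integrable_wavelet(2)[OF \<phi> elim])
    then show ?case by (intro LIM_zero_cancel[OF Lim_null_comparison[OF _ l]]) auto
  qed
  have m: "wt \<phi> f \<in> borel_measurable hm" by measurable
  note lims = sq_integrable_pointwise_limit[OF sw m plim C]
  show s: "sq_integrable hm (wt \<phi> f)" by (rule lims(1))
  have "(\<lambda>n. nrm hm (wt \<phi> (fn n))) \<longlonglongrightarrow> nrm hm (wt \<phi> f)" by (rule nrm_tendsto[OF sw s lims(2)])
  moreover have "(\<lambda>n. nrm hm (wt \<phi> (fn n))) \<longlonglongrightarrow> nrm lborel f"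
    unfolding nw by (rule nrm_tendsto[OF fn f flim])
  ultimately show "nrm hm (wt \<phi> f) = nrm lborel f" by (rule LIMSEQ_unique)
qed

section \<open>The group action\<close>

lemma grp_mult_alt: "grp_mult p q = (fst p * fst q, inverse (fst q) *\<^sub>R snd p + snd q)"
  by (cases p; cases q) simp

definition ginv :: "real \<times> 'a::euclidean_space \<Rightarrow> real \<times> 'a" where
  "ginv p = (inverse (fst p), - (fst p *\<^sub>R snd p))"

lemma fst_grp_mult [simp]: "fst (grp_mult p q) = fst p * fst q"
  by (simp add: grp_mult_alt)

lemma fst_ginv [simp]: "fst (ginv p) = inverse (fst p)"
  by (simp add: ginv_def)

lemma ginv_grp_mult: "fst p \<noteq> 0 \<Longrightarrow> fst q \<noteq> 0 \<Longrightarrow> grp_mult (ginv p) (grp_mult p q) = q"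
  by (simp add: grp_mult_alt ginv_def prod_eq_iff)

lemma grp_mult_measurable_compose [measurable (raw)]:
  fixes u v :: "'b \<Rightarrow> real \<times> 'a::euclidean_space"
  assumes [measurable]: "u \<in> borel_measurable M" "v \<in> borel_measurable M"
  shows "(\<lambda>x. grp_mult (u x) (v x)) \<in> borel_measurable M"
  unfolding grp_mult_alt by measurable

lemma ginv_measurable_compose [measurable (raw)]:
  fixes u :: "'b \<Rightarrow> real \<times> 'a::euclidean_space"
  assumes [measurable]: "u \<in> borel_measurable M"
  shows "(\<lambda>x. ginv (u x)) \<in> borel_measurable M"
  unfolding ginv_def by measurable

text \<open>This is what the group law is made for. Together with unitarity it gives the invariance
  of the reproducing kernel.\<close>

lemma wavelet_grp_mult:
  fixes \<phi> :: "'a::euclidean_space \<Rightarrow> complex"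
  assumes "fst p > 0" "fst q > 0"
  shows "wavelet \<phi> (grp_mult p q) = wavelet (wavelet \<phi> q) p"
  using assms by (auto simp: wavelet_alt grp_mult_alt fun_eq_iff powr_mult algebra_simps)

lemma AE_hm_fst: "AE p in (hm :: (real \<times> 'a::euclidean_space) measure). fst p > 0"
  unfolding hm_def by (subst AE_density) (auto simp: indicator_def)

lemma nn_integral_hm_cong:
  fixes u v :: "real \<times> 'a::euclidean_space \<Rightarrow> ennreal"
  assumes "\<And>p. fst p > 0 \<Longrightarrow> u p = v p"
  shows "(\<integral>\<^sup>+p. u p \<partial>hm) = (\<integral>\<^sup>+p. v p \<partial>hm)"
  by (rule nn_integral_cong_AE) (use AE_hm_fst in eventually_elim, simp add: assms)

lemma nn_integral_hm_mono:
  fixes u v :: "real \<times> 'a::euclidean_space \<Rightarrow> ennreal"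
  assumes "\<And>p. fst p > 0 \<Longrightarrow> u p \<le> v p"
  shows "(\<integral>\<^sup>+p. u p \<partial>hm) \<le> (\<integral>\<^sup>+p. v p \<partial>hm)"
  by (rule nn_integral_mono_AE) (use AE_hm_fst in eventually_elim, simp add: assms)

text \<open>For a fixed second scale, left multiplication translates the second coordinate by a
  vector depending on that scale only, which Lebesgue measure ignores; what is left is a dilation of
  the scale, which da / a ignores.\<close>

lemma nn_integral_hm_left_invariant:
  fixes u :: "real \<times> 'a::euclidean_space \<Rightarrow> ennreal"
  assumes [measurable]: "u \<in> borel_measurable borel" and p: "fst p > 0"
  shows "(\<integral>\<^sup>+q. u (grp_mult p q) \<partial>hm) = (\<integral>\<^sup>+q. u q \<partial>hm)"
proof -
  have [measurable]: "u \<in> borel_measurable (lborel \<Otimes>\<^sub>M lborel)"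
    using assms by (simp add: lborel_prod)
  define V where "V a = (\<integral>\<^sup>+b. u (a, b) \<partial>lborel)" for a
  have [measurable]: "V \<in> borel_measurable borel" unfolding V_def by measurable
  define a1 where "a1 = fst p"
  have a1: "a1 > 0" using p by (simp add: a1_def)
  have "(\<integral>\<^sup>+q. u (grp_mult p q) \<partial>hm)
    = (\<integral>\<^sup>+a. ennreal (indicator {0<..} a / a) * (\<integral>\<^sup>+b. u (grp_mult p (a, b)) \<partial>lborel) \<partial>lborel)"
    by (rule nn_integral_hm) measurable
  also have "\<dots> = (\<integral>\<^sup>+a. ennreal (indicator {0<..} a / a) * V (a1 * a) \<partial>lborel)"
  proof (rule nn_integral_cong)
    fix a :: real
    have "V (a1 * a) = (\<integral>\<^sup>+b. u (a1 * a, inverse a *\<^sub>R snd p + 1 *\<^sub>R b) \<partial>lborel)"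
      unfolding V_def by (subst nn_integral_lborel_affine[of _ 1 "inverse a *\<^sub>R snd p"]) auto
    then show "ennreal (indicator {0<..} a / a) * (\<integral>\<^sup>+b. u (grp_mult p (a, b)) \<partial>lborel)
      = ennreal (indicator {0<..} a / a) * V (a1 * a)"
      by (simp add: grp_mult_alt a1_def)
  qed
  also have "\<dots> = (\<integral>\<^sup>+a. ennreal a1 * (ennreal (indicator {0<..} (0 + a1 * a) / (0 + a1 * a)) * V (0 + a1 * a)) \<partial>lborel)"
  proof (rule nn_integral_cong)
    fix a :: real
    have "ennreal (indicator {0<..} a / a) = ennreal a1 * ennreal (indicator {0<..} (a1 * a) / (a1 * a))"
      using a1 by (auto simp: indicator_def zero_less_mult_iff simp flip: ennreal_mult)
    then show "ennreal (indicator {0<..} a / a) * V (a1 * a)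
      = ennreal a1 * (ennreal (indicator {0<..} (0 + a1 * a) / (0 + a1 * a)) * V (0 + a1 * a))"
      by (simp add: mult.assoc)
  qed
  also have "\<dots> = ennreal \<bar>a1\<bar> * (\<integral>\<^sup>+a. ennreal (indicator {0<..} (0 + a1 * a) / (0 + a1 * a)) * V (0 + a1 * a) \<partial>lborel)"
    using a1 by (simp add: nn_integral_cmult)
  also have "\<dots> = (\<integral>\<^sup>+a. ennreal (indicator {0<..} a / a) * V a \<partial>lborel)"
    using a1 by (intro nn_integral_real_affine[symmetric]) auto
  also have "\<dots> = (\<integral>\<^sup>+q. u q \<partial>hm)"
    unfolding V_def by (rule nn_integral_hm[symmetric]) measurable
  finally show ?thesis .
qed

lemma sigma_finite_hm: "sigma_finite_measure (hm :: (real \<times> 'a::euclidean_space) measure)"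
  unfolding hm_def by (subst sigma_finite_measure.sigma_finite_iff_density_finite[OF sigma_finite_lborel]) auto

text \<open>Explicit sets exhausting the group. They stand in for metric balls, so that the
  estimates do not involve the metric; \<open>ball_subset_box_grp\<close> makes the comparison at
  the end.\<close>

definition box_grp :: "real \<Rightarrow> (real \<times> 'a::euclidean_space) set" where
  "box_grp R = {p. inverse R \<le> fst p \<and> fst p \<le> R \<and> norm (snd p) \<le> R}"

lemma box_grp_sets [measurable]: "box_grp R \<in> sets (borel :: (real \<times> 'a::euclidean_space) measure)"
proof -
  have "box_grp R = {p \<in> space (borel :: (real \<times> 'a) measure). inverse R \<le> fst p \<and> fst p \<le> R \<and> norm (snd p) \<le> R}"
    by (auto simp: box_grp_def)
  also have "\<dots> \<in> sets borel" by measurable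
  finally show ?thesis .
qed

lemma box_grp_mono: "1 \<le> R \<Longrightarrow> R \<le> R' \<Longrightarrow> box_grp R \<subseteq> box_grp R'"
  by (auto simp: box_grp_def intro: order_trans[OF le_imp_inverse_le])

lemma box_grp_fst_pos: "p \<in> box_grp R \<Longrightarrow> 1 \<le> R \<Longrightarrow> fst p > 0"
  by (auto simp: box_grp_def intro: less_le_trans[of _ "inverse R"])

text \<open>A substitute for the triangle inequality of a left-invariant metric. The summand R m
  comes from dividing the first shift by a scale that is at least 1/m.\<close>

lemma box_grp_mult:
  fixes q r :: "real \<times> 'a::euclidean_space"
  assumes q: "q \<in> box_grp R" and r: "r \<in> box_grp m" and R: "1 \<le> R" and m: "1 \<le> m"
  shows "grp_mult q r \<in> box_grp (R * m + m)"
proof -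
  have qp: "fst q > 0" and rp: "fst r > 0" using box_grp_fst_pos q r R m by blast+
  have "inverse (R * m) \<le> fst q * fst r"
    using q r R m unfolding inverse_mult_distrib by (intro mult_mono) (auto simp: box_grp_def intro: less_imp_le[OF qp])
  moreover have "inverse (R * m + m) \<le> inverse (R * m)" using R m by (intro le_imp_inverse_le) auto
  moreover have "fst q * fst r \<le> R * m"
    using q r R m rp by (intro mult_mono) (auto simp: box_grp_def)
  moreover have "norm (inverse (fst r) *\<^sub>R snd q + snd r) \<le> R * m + m"
  proof (rule order_trans[OF norm_triangle_ineq add_mono])
    have "inverse (fst r) \<le> m" using r m rp by (auto simp: box_grp_def) (metis inverse_inverse_eq le_imp_inverse_le inverse_positive_iff_positive less_le_trans zero_less_one)
    then have "inverse (fst r) * norm (snd q) \<le> m * R"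
      using q m rp by (intro mult_mono) (auto simp: box_grp_def)
    then show "norm (inverse (fst r) *\<^sub>R snd q) \<le> R * m" using rp by (simp add: mult.commute)
    show "norm (snd r) \<le> m" using r by (simp add: box_grp_def)
  qed
  ultimately show ?thesis using m by (auto simp: box_grp_def grp_mult_alt)
qed

lemma eventually_in_box_grp:
  fixes p :: "real \<times> 'a::euclidean_space"
  assumes "fst p > 0"
  shows "\<forall>\<^sub>F n in sequentially. p \<in> box_grp (real (Suc n))"
proof -
  have "\<forall>\<^sub>F n in sequentially. max (inverse (fst p)) (max (fst p) (norm (snd p))) \<le> real n"
    using filterlim_real_sequentially unfolding filterlim_at_top by blast
  then show ?thesis
  proof eventually_elim
    case (elim n)
    then have "inverse (fst p) \<le> real (Suc n)" by simp
    then have "inverse (real (Suc n)) \<le> inverse (inverse (fst p))" using assms by (intro le_imp_inverse_le) auto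
    with elim show ?case by (simp add: box_grp_def)
  qed
qed

lemma nn_integral_hm_tail:
  fixes u :: "real \<times> 'a::euclidean_space \<Rightarrow> ennreal"
  assumes [measurable]: "u \<in> borel_measurable borel" and fin: "(\<integral>\<^sup>+p. u p \<partial>hm) < \<infinity>" and e: "e > 0"
  shows "\<exists>m\<ge>1. (\<integral>\<^sup>+p. u p * indicator (- box_grp m) p \<partial>hm) \<le> e"
proof -
  have "(\<lambda>n. \<integral>\<^sup>+p. u p * indicator (- box_grp (real (Suc n))) p \<partial>hm) \<longlonglongrightarrow> (\<integral>\<^sup>+p. 0 \<partial>(hm :: (real \<times> 'a) measure))"
  proof (rule nn_integral_dominated_convergence[where w=u])
    show "AE p in hm. (\<lambda>n. u p * indicator (- box_grp (real (Suc n))) p) \<longlonglongrightarrow> 0"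
      using AE_hm_fst
    proof eventually_elim
      case (elim p)
      show ?case
        by (rule tendsto_eventually) (use eventually_in_box_grp[OF elim] in eventually_elim, simp)
    qed
    show "AE p in hm. u p * indicator (- box_grp (real (Suc n))) p \<le> u p" for n
      by (auto simp: indicator_def)
  qed (use fin in measurable)
  then have "(\<lambda>n. \<integral>\<^sup>+p. u p * indicator (- box_grp (real (Suc n))) p \<partial>hm) \<longlonglongrightarrow> 0" by simp
  then have "\<forall>\<^sub>F n in sequentially. (\<integral>\<^sup>+p. u p * indicator (- box_grp (real (Suc n))) p \<partial>hm) < e"
    by (rule order_tendstoD) (rule e)
  then obtain n where "(\<integral>\<^sup>+p. u p * indicator (- box_grp (real (Suc n))) p \<partial>hm) < e"
    by (auto simp: eventually_sequentially)
  then show ?thesis by (intro exI[of _ "real (Suc n)"]) auto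
qed

lemma emeasure_box_grp_finite:
  assumes "R \<ge> 1"
  shows "emeasure hm (box_grp R :: (real \<times> 'a::euclidean_space) set) < \<infinity>"
proof -
  let ?B = "box_grp R :: (real \<times> 'a) set"
  have "?B \<subseteq> cball 0 R \<times> cball 0 R"
    using assms by (auto simp: box_grp_def) (smt (verit) inverse_nonnegative_iff_nonnegative)
  then have b: "bounded ?B" by (rule bounded_subset[rotated]) (intro bounded_Times bounded_cball)
  have "emeasure hm ?B = (\<integral>\<^sup>+p. ennreal (indicator {0<..} (fst p) / fst p) * indicator ?B p \<partial>lborel)"
    unfolding hm_def by (subst emeasure_density) auto
  also have "\<dots> \<le> (\<integral>\<^sup>+p. ennreal R * indicator ?B p \<partial>lborel)"
  proof (intro nn_integral_mono)
    fix p :: "real \<times> 'a"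
    have "indicator {0<..} (fst p) / fst p \<le> R" if "p \<in> ?B"
    proof -
      have "fst p > 0" using box_grp_fst_pos that assms by blast
      moreover have "inverse R \<le> fst p" using that by (simp add: box_grp_def)
      ultimately have "inverse (fst p) \<le> R"
        using assms by (metis inverse_inverse_eq le_imp_inverse_le inverse_positive_iff_positive less_le_trans zero_less_one)
      with \<open>fst p > 0\<close> show ?thesis by (simp add: divide_inverse)
    qed
    then show "ennreal (indicator {0<..} (fst p) / fst p) * indicator ?B p \<le> ennreal R * indicator ?B p"
      by (auto simp: indicator_def intro!: ennreal_leI)
  qed
  also have "\<dots> = ennreal R * emeasure lborel ?B" by (simp add: nn_integral_cmult)
  also have "\<dots> < \<infinity>" using emeasure_bounded_finite[OF b] by (simp add: ennreal_mult_less_top)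
  finally show ?thesis .
qed

lemma ennreal_square_add_le: "(a + b)\<^sup>2 \<le> 2 * a\<^sup>2 + 2 * (b :: ennreal)\<^sup>2"
proof (cases "a = top \<or> b = top")
  case True then show ?thesis by (auto simp: power2_eq_square)
next
  case False
  then obtain x y where "a = ennreal x" "b = ennreal y" "x \<ge> 0" "y \<ge> 0"
    by (metis ennreal_cases)
  moreover have "(x + y)\<^sup>2 \<le> 2 * x\<^sup>2 + 2 * y\<^sup>2"
    using sum_squares_bound[of x y] by (simp add: power2_sum)
  ultimately show ?thesis
    by (simp add: ennreal_power ennreal_mult[symmetric] ennreal_plus[symmetric] ennreal_numeral[symmetric]
        del: ennreal_plus ennreal_numeral)
qed

text \<open>The Cauchy--Schwarz step of Schur's test: the product f k is split into sqrt (k w) and f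
  sqrt (k / w).\<close>

lemma weighted_Cauchy_Schwarz:
  fixes f k w :: "'a \<Rightarrow> real"
  assumes [measurable]: "f \<in> borel_measurable M" "k \<in> borel_measurable M" "w \<in> borel_measurable M"
    and nn: "\<And>x. f x \<ge> 0" "\<And>x. k x \<ge> 0" "\<And>x. w x > 0"
  shows "(\<integral>\<^sup>+x. ennreal (f x * k x) \<partial>M)\<^sup>2
    \<le> (\<integral>\<^sup>+x. ennreal (k x * w x) \<partial>M) * (\<integral>\<^sup>+x. ennreal ((f x)\<^sup>2 * k x / w x) \<partial>M)"
proof -
  define u where "u x = ennreal (sqrt (k x * w x))" for x
  define v where "v x = ennreal (f x * sqrt (k x / w x))" for x
  have [measurable]: "u \<in> borel_measurable M" "v \<in> borel_measurable M" unfolding u_def v_def by measurable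
  have uv: "u x * v x = ennreal (f x * k x)" for x
  proof -
    have "sqrt (k x * w x) * sqrt (k x / w x) = sqrt ((k x)\<^sup>2)"
      using nn(3)[of x] by (simp add: real_sqrt_mult[symmetric] power2_eq_square)
    then have "sqrt (k x * w x) * (f x * sqrt (k x / w x)) = f x * k x"
      using nn(2)[of x] by (simp add: mult.left_commute)
    moreover have "u x * v x = ennreal (sqrt (k x * w x) * (f x * sqrt (k x / w x)))"
      unfolding u_def v_def using nn(1)[of x] nn(2)[of x] nn(3)[of x] by (subst ennreal_mult) auto
    ultimately show ?thesis by (simp only:)
  qed
  have u2: "(u x)\<^sup>2 = ennreal (k x * w x)" for x
    unfolding u_def using nn(2)[of x] nn(3)[of x] by (subst ennreal_power) auto
  have v2: "(v x)\<^sup>2 = ennreal ((f x)\<^sup>2 * k x / w x)" for x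
    unfolding v_def using nn(1)[of x] nn(2)[of x] nn(3)[of x] by (subst ennreal_power) (auto simp: power_mult_distrib)
  show ?thesis using Cauchy_Schwarz_nn_integral[of u M v] by (simp add: uv u2 v2)
qed

section \<open>The reproducing kernel and the tail estimate\<close>

text \<open>Only the modulus of the reproducing kernel is kept. The estimates are by absolute values
  anyway, and the modulus is symmetric.\<close>

definition ker :: "('a::euclidean_space \<Rightarrow> complex) \<Rightarrow> real \<times> 'a \<Rightarrow> real \<times> 'a \<Rightarrow> real" where
  "ker \<phi> p q = cmod (ip lborel (wavelet \<phi> p) (wavelet \<phi> q))"

lemma ker_nonneg [simp]: "0 \<le> ker \<phi> p q"
  by (simp add: ker_def)

lemma ker_commute: "ker \<phi> p q = ker \<phi> q p"
  unfolding ker_def by (subst ip_commute) simp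

lemma ker_measurable_compose [measurable (raw)]:
  fixes \<phi> :: "'a::euclidean_space \<Rightarrow> complex" and u v :: "'b \<Rightarrow> real \<times> 'a"
  assumes [measurable]: "\<phi> \<in> borel_measurable borel" "u \<in> borel_measurable M" "v \<in> borel_measurable M"
  shows "(\<lambda>x. ker \<phi> (u x) (v x)) \<in> borel_measurable M"
  unfolding ker_def ip_def by measurable

lemma wavelet_unit: "wavelet \<phi> (1, 0) = \<phi>"
  by (simp add: fun_eq_iff)

lemma ker_grp_mult:
  fixes \<phi> :: "'a::euclidean_space \<Rightarrow> complex"
  assumes [measurable]: "\<phi> \<in> borel_measurable borel" and "fst p > 0" "fst q > 0" "fst r > 0"
  shows "ker \<phi> (grp_mult p q) (grp_mult p r) = ker \<phi> q r"
  unfolding ker_def using assms by (simp add: wavelet_grp_mult integral_wavelet)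

text \<open>The kernel depends only on p^-1 q. The form with q = p r is the one that the
  substitution \<open>nn_integral_hm_left_invariant\<close> produces.\<close>

lemma ker_grp_mult_unit:
  fixes \<phi> :: "'a::euclidean_space \<Rightarrow> complex"
  assumes "\<phi> \<in> borel_measurable borel" "fst p > 0" "fst r > 0"
  shows "ker \<phi> p (grp_mult p r) = ker \<phi> (1, 0) r"
  using ker_grp_mult[OF assms(1,2) _ assms(3), of "(1, 0)"] by (cases p) simp

text \<open>This is all that the main argument takes from admissibility. The Fourier transform does
  not occur again until \<open>admissible_representative\<close> establishes these
  assumptions.\<close>

locale wavelet_isometry =
  fixes \<phi> :: "'a::euclidean_space \<Rightarrow> complex"
  assumes \<phi>: "sq_integrable lborel \<phi>"
    and wt_sq_integrable: "\<And>f. sq_integrable lborel f \<Longrightarrow> sq_integrable hm (wt \<phi> f)"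
    and nrm_wt: "\<And>f. sq_integrable lborel f \<Longrightarrow> nrm hm (wt \<phi> f) = nrm lborel f"
begin

lemma \<phi>_measurable [measurable]: "\<phi> \<in> borel_measurable borel"
  using \<phi> by (simp add: sq_integrable_def)

lemma sq_integrable_\<phi>: "fst p > 0 \<Longrightarrow> sq_integrable lborel (wavelet \<phi> p)"
  and nrm_\<phi>: "fst p > 0 \<Longrightarrow> nrm lborel (wavelet \<phi> p) = nrm lborel \<phi>"
  using sq_integrable_wavelet[OF \<phi>] by auto

lemma wt_add:
  assumes "sq_integrable lborel f" "sq_integrable lborel g" "fst p > 0"
  shows "wt \<phi> (\<lambda>x. f x + g x) p = wt \<phi> f p + wt \<phi> g p"
  unfolding wt_def by (rule ip_add_left) (use assms sq_integrable_\<phi> in auto)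

lemma wt_diff:
  assumes "sq_integrable lborel f" "sq_integrable lborel g" "fst p > 0"
  shows "wt \<phi> (\<lambda>x. f x - g x) p = wt \<phi> f p - wt \<phi> g p"
  unfolding wt_def by (rule ip_diff_left) (use assms sq_integrable_\<phi> in auto)

lemma wt_cmult: "wt \<phi> (\<lambda>x. c * f x) p = c * wt \<phi> f p"
  unfolding wt_def by (rule ip_cmult_left)

lemma wt_bound:
  assumes "sq_integrable lborel f" "fst p > 0"
  shows "cmod (wt \<phi> f p) \<le> nrm lborel f * nrm lborel \<phi>"
  unfolding wt_def using Cauchy_Schwarz_ip(2)[OF assms(1) sq_integrable_\<phi>[OF assms(2)]] assms(2)
  by (simp add: nrm_\<phi>)

lemma nn_integral_wt:
  assumes "sq_integrable lborel f"
  shows "(\<integral>\<^sup>+p. ennreal ((cmod (wt \<phi> f p))\<^sup>2) \<partial>hm) = ennreal ((nrm lborel f)\<^sup>2)"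
  using nn_integral_square_eq_nrm[OF wt_sq_integrable[OF assms]] by (simp add: nrm_wt assms)

lemma Re_ip_wt:
  assumes f: "sq_integrable lborel f" and g: "sq_integrable lborel g"
  shows "Re (ip hm (wt \<phi> f) (wt \<phi> g)) = Re (ip lborel f g)"
proof -
  have [measurable]: "f \<in> borel_measurable borel" "g \<in> borel_measurable borel"
    using f g by (auto simp: sq_integrable_def)
  have "nrm hm (\<lambda>p. wt \<phi> f p + wt \<phi> g p) = nrm hm (wt \<phi> (\<lambda>x. f x + g x))"
    unfolding nrm_def by (intro arg_cong[where f=sqrt] integral_cong_AE)
      (measurable, use AE_hm_fst in eventually_elim, simp add: wt_add f g)
  also have "\<dots> = nrm lborel (\<lambda>x. f x + g x)" by (intro nrm_wt sq_integrable_add f g)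
  finally have "(nrm hm (\<lambda>p. wt \<phi> f p + wt \<phi> g p))\<^sup>2 = (nrm lborel (\<lambda>x. f x + g x))\<^sup>2" by simp
  then show ?thesis
    unfolding nrm_add_square[OF f g] nrm_add_square[OF wt_sq_integrable[OF f] wt_sq_integrable[OF g]]
    by (simp add: nrm_wt f g)
qed

text \<open>Polarization: expanding the norm of a sum gives the real parts, and replacing g by i g
  turns the imaginary part into a real part.\<close>

lemma ip_wt:
  assumes f: "sq_integrable lborel f" and g: "sq_integrable lborel g"
  shows "ip hm (wt \<phi> f) (wt \<phi> g) = ip lborel f g"
proof (rule complex_eqI)
  show "Re (ip hm (wt \<phi> f) (wt \<phi> g)) = Re (ip lborel f g)" by (rule Re_ip_wt[OF f g])
  have "Re (ip hm (wt \<phi> f) (wt \<phi> (\<lambda>x. \<i> * g x))) = Re (ip lborel f (\<lambda>x. \<i> * g x))"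
    by (intro Re_ip_wt sq_integrable_cmult f g)
  moreover have "wt \<phi> (\<lambda>x. \<i> * g x) = (\<lambda>p. \<i> * wt \<phi> g p)" by (simp add: wt_cmult fun_eq_iff)
  ultimately show "Im (ip hm (wt \<phi> f) (wt \<phi> g)) = Im (ip lborel f g)" by (simp add: ip_cmult_right)
qed

text \<open>The value of the transform at p is the inner product of f with
  \<open>wavelet \<phi> p\<close>; carried over by the isometry it becomes an integral against the
  kernel. The nonnegative integral on the right can be split and estimated freely.\<close>

lemma reproducing_bound:
  assumes f: "sq_integrable lborel f" and p: "fst p > 0"
  shows "ennreal (cmod (wt \<phi> f p)) \<le> (\<integral>\<^sup>+q. ennreal (cmod (wt \<phi> f q) * ker \<phi> p q) \<partial>hm)"
proof -
  have s: "sq_integrable hm (wt \<phi> f)" "sq_integrable hm (wt \<phi> (wavelet \<phi> p))"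
    by (intro wt_sq_integrable f sq_integrable_\<phi> p)+
  have "wt \<phi> f p = ip hm (wt \<phi> f) (wt \<phi> (wavelet \<phi> p))"
    unfolding ip_wt[OF f sq_integrable_\<phi>[OF p]] by (simp add: wt_def)
  then have "cmod (wt \<phi> f p) \<le> (\<integral>q. cmod (wt \<phi> f q * cnj (wt \<phi> (wavelet \<phi> p) q)) \<partial>hm)"
    by (simp add: ip_def)
  also have "\<dots> = (\<integral>q. cmod (wt \<phi> f q) * ker \<phi> p q \<partial>hm)"
    by (simp add: norm_mult ker_def wt_def)
  finally have "ennreal (cmod (wt \<phi> f p)) \<le> ennreal (\<integral>q. cmod (wt \<phi> f q) * ker \<phi> p q \<partial>hm)"
    by (rule ennreal_leI)
  also have "\<dots> = (\<integral>\<^sup>+q. ennreal (cmod (wt \<phi> f q) * ker \<phi> p q) \<partial>hm)"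
    using sq_integrable_mult_integrable[OF s] unfolding wt_def[of _ "wavelet \<phi> p"]
    by (intro nn_integral_eq_integral[symmetric]) (auto simp: ker_def)
  finally show ?thesis .
qed

lemma nn_integral_ker_square: "(\<integral>\<^sup>+r. ennreal ((ker \<phi> (1, 0) r)\<^sup>2) \<partial>hm) < \<infinity>"
  using nn_integral_wt[OF \<phi>] by (simp add: ker_def wt_def wavelet_unit)

end

text \<open>\<open>thinE\<close> is thinness with the metric already replaced by boxes, and
  \<open>E\<close> is a Borel version of the given set. The exponent \<open>s\<close> will be d/2 +
  \<epsilon>, for which \<open>ker_integrable\<close> expresses membership in
  \<open>B1\<close>.\<close>

locale thin_set = wavelet_isometry \<phi> for \<phi> :: "'a::euclidean_space \<Rightarrow> complex" +
  fixes E :: "(real \<times> 'a) set" and s :: real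
  assumes E [measurable]: "E \<in> sets borel"
    and ker_integrable: "(\<integral>\<^sup>+r. ennreal (ker \<phi> (1, 0) r * fst r powr s) \<partial>hm) < \<infinity>"
    and thinE: "\<And>e::ennreal. e > 0 \<Longrightarrow> \<exists>R\<ge>1. \<forall>q. fst q > 0 \<longrightarrow> q \<notin> box_grp R \<longrightarrow>
       (\<integral>\<^sup>+p. ennreal ((ker \<phi> p q)\<^sup>2) * indicator E p \<partial>hm) \<le> e"
begin

text \<open>Thinness settles the q outside a box of size \<open>R1\<close>. For q inside, the kernel
  is concentrated near q uniformly in q: writing p = q r, a point p outside the box of size R1 m + m
  forces r out of the box of size m, where the kernel at the identity has small square
  integral.\<close>

lemma ker_uniform_tail:
  assumes e: "(e::ennreal) > 0"
  shows "\<exists>R\<ge>1. \<forall>q. fst q > 0 \<longrightarrow> (\<integral>\<^sup>+p. ennreal ((ker \<phi> p q)\<^sup>2) * indicator (E - box_grp R) p \<partial>hm) \<le> e"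
proof -
  obtain R1 where R1: "R1 \<ge> 1" and far: "\<And>q. fst q > 0 \<Longrightarrow> q \<notin> box_grp R1 \<Longrightarrow>
       (\<integral>\<^sup>+p. ennreal ((ker \<phi> p q)\<^sup>2) * indicator E p \<partial>hm) \<le> e" using thinE[OF e] by blast
  obtain m where m: "m \<ge> 1" and tail: "(\<integral>\<^sup>+r. ennreal ((ker \<phi> (1, 0) r)\<^sup>2) * indicator (- box_grp m) r \<partial>hm) \<le> e"
    using nn_integral_hm_tail[OF _ nn_integral_ker_square e] by auto
  define R where "R = R1 * m + m"
  have "R \<ge> 1" using R1 m by (simp add: R_def add_increasing)
  moreover have "(\<integral>\<^sup>+p. ennreal ((ker \<phi> p q)\<^sup>2) * indicator (E - box_grp R) p \<partial>hm) \<le> e" if q: "fst q > 0" for q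
  proof (cases "q \<in> box_grp R1")
    case False
    have "(\<integral>\<^sup>+p. ennreal ((ker \<phi> p q)\<^sup>2) * indicator (E - box_grp R) p \<partial>hm)
      \<le> (\<integral>\<^sup>+p. ennreal ((ker \<phi> p q)\<^sup>2) * indicator E p \<partial>hm)"
      by (intro nn_integral_mono) (auto simp: indicator_def)
    also have "\<dots> \<le> e" by (rule far[OF q False])
    finally show ?thesis .
  next
    case True
    have "(\<integral>\<^sup>+p. ennreal ((ker \<phi> p q)\<^sup>2) * indicator (E - box_grp R) p \<partial>hm)
      \<le> (\<integral>\<^sup>+p. ennreal ((ker \<phi> p q)\<^sup>2) * indicator (- box_grp R) p \<partial>hm)"
      by (intro nn_integral_mono) (auto simp: indicator_def)
    also have "\<dots> = (\<integral>\<^sup>+r. ennreal ((ker \<phi> (grp_mult q r) q)\<^sup>2) * indicator (- box_grp R) (grp_mult q r) \<partial>hm)"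
      by (rule nn_integral_hm_left_invariant[OF _ q, symmetric]) measurable
    also have "\<dots> \<le> (\<integral>\<^sup>+r. ennreal ((ker \<phi> (1, 0) r)\<^sup>2) * indicator (- box_grp m) r \<partial>hm)"
    proof (rule nn_integral_hm_mono)
      fix r :: "real \<times> 'a" assume r: "fst r > 0"
      have "indicator (- box_grp R) (grp_mult q r) \<le> (indicator (- box_grp m) r :: ennreal)"
        using box_grp_mult[OF True _ R1 m, of r] by (auto simp: indicator_def R_def)
      moreover have "ker \<phi> (grp_mult q r) q = ker \<phi> (1, 0) r"
        by (subst ker_commute) (rule ker_grp_mult_unit[OF \<phi>_measurable q r])
      ultimately show "ennreal ((ker \<phi> (grp_mult q r) q)\<^sup>2) * indicator (- box_grp R) (grp_mult q r)
        \<le> ennreal ((ker \<phi> (1, 0) r)\<^sup>2) * indicator (- box_grp m) r"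
        by (simp add: mult_left_mono)
    qed
    also have "\<dots> \<le> e" by (rule tail)
    finally show ?thesis .
  qed
  ultimately show ?thesis by blast
qed

text \<open>\<open>wgt\<close> is the weight \<open>a powr s\<close>, made positive off \<open>grp\<close>. Since \<open>ker\<close> is symmetric and
  invariant, it is a Schur test weight in both variables at once.\<close>

definition wgt :: "real \<times> 'a \<Rightarrow> real" where
  "wgt p = (if fst p > 0 then fst p powr s else 1)"

lemma wgt_measurable [measurable (raw)]:
  assumes [measurable]: "u \<in> borel_measurable M"
  shows "(\<lambda>x. wgt (u x)) \<in> borel_measurable M"
  unfolding wgt_def by measurable

lemma wgt_pos: "wgt p > 0"
  by (simp add: wgt_def)

lemma wgt_grp_mult: "fst p > 0 \<Longrightarrow> fst q > 0 \<Longrightarrow> wgt (grp_mult p q) = wgt p * wgt q"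
  by (simp add: wgt_def powr_mult)

definition Cs :: ennreal where
  "Cs = (\<integral>\<^sup>+r. ennreal (ker \<phi> (1, 0) r * wgt r) \<partial>hm)"

lemma Cs_finite: "Cs < \<infinity>"
proof -
  have "Cs = (\<integral>\<^sup>+r. ennreal (ker \<phi> (1, 0) r * fst r powr s) \<partial>hm)"
    unfolding Cs_def by (rule nn_integral_hm_cong) (simp add: wgt_def)
  with ker_integrable show ?thesis by simp
qed

text \<open>After substituting q = p r the kernel depends on r alone, and multiplicativity of
  \<open>wgt\<close> pulls out \<open>wgt p\<close>. This is the Schur condition with equality, also
  for the kernel restricted to p^-1 q in B.\<close>

lemma schur_indicator:
  fixes B :: "(real \<times> 'a) set"
  assumes [measurable]: "B \<in> sets borel" and p: "fst p > 0"
  shows "(\<integral>\<^sup>+q. ennreal (ker \<phi> p q * indicator B (grp_mult (ginv p) q) * wgt q) \<partial>hm)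
    = ennreal (wgt p) * (\<integral>\<^sup>+r. ennreal (ker \<phi> (1, 0) r * wgt r) * indicator B r \<partial>hm)"
proof -
  have "(\<integral>\<^sup>+q. ennreal (ker \<phi> p q * indicator B (grp_mult (ginv p) q) * wgt q) \<partial>hm)
    = (\<integral>\<^sup>+r. ennreal (ker \<phi> p (grp_mult p r) * indicator B (grp_mult (ginv p) (grp_mult p r)) * wgt (grp_mult p r)) \<partial>hm)"
    by (rule nn_integral_hm_left_invariant[OF _ p, symmetric]) measurable
  also have "\<dots> = (\<integral>\<^sup>+r. ennreal (wgt p) * (ennreal (ker \<phi> (1, 0) r * wgt r) * indicator B r) \<partial>hm)"
  proof (rule nn_integral_hm_cong)
    fix r :: "real \<times> 'a" assume r: "fst r > 0"
    have "ker \<phi> p (grp_mult p r) = ker \<phi> (1, 0) r" by (rule ker_grp_mult_unit[OF \<phi>_measurable p r])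
    moreover have "grp_mult (ginv p) (grp_mult p r) = r" by (rule ginv_grp_mult) (use p r in auto)
    ultimately show "ennreal (ker \<phi> p (grp_mult p r) * indicator B (grp_mult (ginv p) (grp_mult p r)) * wgt (grp_mult p r))
      = ennreal (wgt p) * (ennreal (ker \<phi> (1, 0) r * wgt r) * indicator B r)"
      using wgt_pos[of p] wgt_pos[of r] p r
      by (auto simp: wgt_grp_mult indicator_def mult_ac ennreal_mult' less_imp_le)
  qed
  also have "\<dots> = ennreal (wgt p) * (\<integral>\<^sup>+r. ennreal (ker \<phi> (1, 0) r * wgt r) * indicator B r \<partial>hm)"
    by (rule nn_integral_cmult) measurable
  finally show ?thesis .
qed

text \<open>Schur's test in which the restriction to B is kept in one factor only. That factor
  supplies the integral over B, small when B lies far out; the other keeps the whole kernel and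
  gives \<open>Cs\<close> once Tonelli lets the integration over p come first, by symmetry of the
  kernel.\<close>

lemma far_estimate:
  fixes B :: "(real \<times> 'a) set"
  assumes [measurable]: "B \<in> sets borel" and f: "sq_integrable lborel f"
  shows "(\<integral>\<^sup>+p. (\<integral>\<^sup>+q. ennreal (cmod (wt \<phi> f q) * (ker \<phi> p q * indicator B (grp_mult (ginv p) q))) \<partial>hm)\<^sup>2 \<partial>hm)
    \<le> (\<integral>\<^sup>+r. ennreal (ker \<phi> (1, 0) r * wgt r) * indicator B r \<partial>hm) * Cs * ennreal ((nrm lborel f)\<^sup>2)"
proof -
  have [measurable]: "f \<in> borel_measurable borel" using f by (simp add: sq_integrable_def)
  interpret sigma_finite_measure "hm :: (real \<times> 'a) measure" by (rule sigma_finite_hm)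
  interpret pair_sigma_finite "hm :: (real \<times> 'a) measure" "hm :: (real \<times> 'a) measure" ..
  define \<delta> where "\<delta> = (\<integral>\<^sup>+r. ennreal (ker \<phi> (1, 0) r * wgt r) * indicator B r \<partial>hm)"
  define F where "F q = cmod (wt \<phi> f q)" for q
  have [measurable]: "F \<in> borel_measurable borel" unfolding F_def by measurable
  have F0: "F q \<ge> 0" for q by (simp add: F_def)
  define H where "H p q = ennreal (wgt p) * ennreal ((F q)\<^sup>2 * ker \<phi> p q / wgt q)" for p q
  have [measurable]: "(\<lambda>(p, q). H p q) \<in> borel_measurable (hm \<Otimes>\<^sub>M hm)" unfolding H_def by measurable
  have "(\<integral>\<^sup>+p. (\<integral>\<^sup>+q. ennreal (F q * (ker \<phi> p q * indicator B (grp_mult (ginv p) q))) \<partial>hm)\<^sup>2 \<partial>hm)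
    \<le> (\<integral>\<^sup>+p. \<delta> * (\<integral>\<^sup>+q. H p q \<partial>hm) \<partial>hm)"
  proof (rule nn_integral_hm_mono)
    fix p :: "real \<times> 'a" assume p: "fst p > 0"
    have "(\<integral>\<^sup>+q. ennreal (F q * (ker \<phi> p q * indicator B (grp_mult (ginv p) q))) \<partial>hm)\<^sup>2
      \<le> (\<integral>\<^sup>+q. ennreal (ker \<phi> p q * indicator B (grp_mult (ginv p) q) * wgt q) \<partial>hm)
        * (\<integral>\<^sup>+q. ennreal ((F q)\<^sup>2 * (ker \<phi> p q * indicator B (grp_mult (ginv p) q)) / wgt q) \<partial>hm)"
      by (rule weighted_Cauchy_Schwarz) (measurable, auto simp: F0 wgt_pos)
    also have "\<dots> \<le> (ennreal (wgt p) * \<delta>) * (\<integral>\<^sup>+q. ennreal ((F q)\<^sup>2 * ker \<phi> p q / wgt q) \<partial>hm)"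
      unfolding schur_indicator[OF assms(1) p] \<delta>_def
      by (intro mult_left_mono nn_integral_mono ennreal_leI) (auto simp: indicator_def wgt_pos less_imp_le)
    also have "\<dots> = \<delta> * (\<integral>\<^sup>+q. H p q \<partial>hm)"
      unfolding H_def by (subst nn_integral_cmult) (auto simp: mult_ac)
    finally show "(\<integral>\<^sup>+q. ennreal (F q * (ker \<phi> p q * indicator B (grp_mult (ginv p) q))) \<partial>hm)\<^sup>2 \<le> \<delta> * (\<integral>\<^sup>+q. H p q \<partial>hm)" .
  qed
  also have "\<dots> = \<delta> * (\<integral>\<^sup>+p. (\<integral>\<^sup>+q. H p q \<partial>hm) \<partial>hm)"
    by (rule nn_integral_cmult) measurable
  also have "(\<integral>\<^sup>+p. (\<integral>\<^sup>+q. H p q \<partial>hm) \<partial>hm) = (\<integral>\<^sup>+q. (\<integral>\<^sup>+p. H p q \<partial>hm) \<partial>hm)"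
    by (rule Fubini'[symmetric]) measurable
  also have "\<dots> = (\<integral>\<^sup>+q. Cs * ennreal ((F q)\<^sup>2) \<partial>hm)"
  proof (rule nn_integral_hm_cong)
    fix q :: "real \<times> 'a" assume q: "fst q > 0"
    have "(\<integral>\<^sup>+p. H p q \<partial>hm) = (\<integral>\<^sup>+p. ennreal ((F q)\<^sup>2 / wgt q) * ennreal (ker \<phi> q p * indicator UNIV (grp_mult (ginv q) p) * wgt p) \<partial>hm)"
      unfolding H_def using wgt_pos
      by (intro nn_integral_cong) (simp add: ennreal_mult[symmetric] less_imp_le ker_commute[of \<phi> q] mult_ac)
    also have "\<dots> = ennreal ((F q)\<^sup>2 / wgt q) * (\<integral>\<^sup>+p. ennreal (ker \<phi> q p * indicator UNIV (grp_mult (ginv q) p) * wgt p) \<partial>hm)"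
      by (rule nn_integral_cmult) measurable
    also have "\<dots> = ennreal ((F q)\<^sup>2 / wgt q) * (ennreal (wgt q) * Cs)"
      by (subst schur_indicator[OF _ q]) (auto simp: Cs_def)
    also have "\<dots> = Cs * ennreal ((F q)\<^sup>2)"
      using wgt_pos[of q] by (simp add: mult.assoc[symmetric] ennreal_mult[symmetric] less_imp_le) (simp add: mult.commute)
    finally show "(\<integral>\<^sup>+p. H p q \<partial>hm) = Cs * ennreal ((F q)\<^sup>2)" .
  qed
  also have "\<dots> = Cs * ennreal ((nrm lborel f)\<^sup>2)"
    unfolding F_def nn_integral_wt[OF f, symmetric] by (rule nn_integral_cmult) measurable
  finally show ?thesis by (simp add: \<delta>_def F_def mult.assoc)
qed

text \<open>Here Cauchy--Schwarz separates the indicator from the kernel. The indicator contributes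
  the measure of the translate p B, which is that of B; in the other factor the integration over p
  in X comes first and gives at most e for every q.\<close>

lemma near_estimate:
  fixes B X :: "(real \<times> 'a) set"
  assumes [measurable]: "B \<in> sets borel" "X \<in> sets borel" and f: "sq_integrable lborel f"
    and X: "\<And>q. fst q > 0 \<Longrightarrow> (\<integral>\<^sup>+p. ennreal ((ker \<phi> p q)\<^sup>2) * indicator X p \<partial>hm) \<le> e"
  shows "(\<integral>\<^sup>+p. (\<integral>\<^sup>+q. ennreal (cmod (wt \<phi> f q) * (ker \<phi> p q * indicator B (grp_mult (ginv p) q))) \<partial>hm)\<^sup>2 * indicator X p \<partial>hm)
    \<le> emeasure hm B * e * ennreal ((nrm lborel f)\<^sup>2)"
proof -
  have [measurable]: "f \<in> borel_measurable borel" using f by (simp add: sq_integrable_def)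
  interpret sigma_finite_measure "hm :: (real \<times> 'a) measure" by (rule sigma_finite_hm)
  interpret pair_sigma_finite "hm :: (real \<times> 'a) measure" "hm :: (real \<times> 'a) measure" ..
  define F where "F q = cmod (wt \<phi> f q)" for q
  have [measurable]: "F \<in> borel_measurable borel" unfolding F_def by measurable
  have F0: "F q \<ge> 0" for q by (simp add: F_def)
  define H where "H p q = ennreal ((F q)\<^sup>2) * (ennreal ((ker \<phi> p q)\<^sup>2) * indicator X p)" for p q
  have [measurable]: "(\<lambda>(p, q). H p q) \<in> borel_measurable (hm \<Otimes>\<^sub>M hm)" unfolding H_def by measurable
  have "(\<integral>\<^sup>+p. (\<integral>\<^sup>+q. ennreal (F q * (ker \<phi> p q * indicator B (grp_mult (ginv p) q))) \<partial>hm)\<^sup>2 * indicator X p \<partial>hm)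
    \<le> (\<integral>\<^sup>+p. emeasure hm B * (\<integral>\<^sup>+q. H p q \<partial>hm) \<partial>hm)"
  proof (rule nn_integral_hm_mono)
    fix p :: "real \<times> 'a" assume p: "fst p > 0"
    have "(\<integral>\<^sup>+q. ennreal (F q * (ker \<phi> p q * indicator B (grp_mult (ginv p) q))) \<partial>hm)\<^sup>2
      = (\<integral>\<^sup>+q. indicator B (grp_mult (ginv p) q) * ennreal (F q * ker \<phi> p q) \<partial>hm)\<^sup>2"
      by (intro arg_cong[where f="\<lambda>x. x\<^sup>2"] nn_integral_cong) (auto simp: indicator_def)
    also have "\<dots> \<le> (\<integral>\<^sup>+q. (indicator B (grp_mult (ginv p) q))\<^sup>2 \<partial>hm) * (\<integral>\<^sup>+q. (ennreal (F q * ker \<phi> p q))\<^sup>2 \<partial>hm)"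
      by (rule Cauchy_Schwarz_nn_integral) measurable
    also have "(\<integral>\<^sup>+q. (indicator B (grp_mult (ginv p) q))\<^sup>2 \<partial>hm)
      = (\<integral>\<^sup>+r. (indicator B (grp_mult (ginv p) (grp_mult p r)))\<^sup>2 \<partial>(hm :: (real \<times> 'a) measure))"
      by (rule nn_integral_hm_left_invariant[OF _ p, symmetric]) measurable
    also have "\<dots> = (\<integral>\<^sup>+r. indicator B r \<partial>hm)"
      by (rule nn_integral_hm_cong) (use p in \<open>simp add: ginv_grp_mult indicator_def\<close>)
    also have "\<dots> = emeasure hm B" by simp
    finally have "(\<integral>\<^sup>+q. ennreal (F q * (ker \<phi> p q * indicator B (grp_mult (ginv p) q))) \<partial>hm)\<^sup>2 * indicator X p
      \<le> emeasure hm B * (\<integral>\<^sup>+q. (ennreal (F q * ker \<phi> p q))\<^sup>2 \<partial>hm) * indicator X p"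
      by (rule mult_right_mono) simp
    also have "\<dots> = emeasure hm B * (\<integral>\<^sup>+q. (ennreal (F q * ker \<phi> p q))\<^sup>2 * indicator X p \<partial>hm)"
      by (subst nn_integral_multc) (auto simp: mult.assoc)
    also have "\<dots> = emeasure hm B * (\<integral>\<^sup>+q. H p q \<partial>hm)"
      unfolding H_def using F0
      by (intro arg_cong[where f="\<lambda>x. emeasure hm B * x"] nn_integral_cong)
         (simp add: ennreal_power power_mult_distrib ennreal_mult mult_ac)
    finally show "(\<integral>\<^sup>+q. ennreal (F q * (ker \<phi> p q * indicator B (grp_mult (ginv p) q))) \<partial>hm)\<^sup>2 * indicator X p
      \<le> emeasure hm B * (\<integral>\<^sup>+q. H p q \<partial>hm)" .
  qed
  also have "\<dots> = emeasure hm B * (\<integral>\<^sup>+p. (\<integral>\<^sup>+q. H p q \<partial>hm) \<partial>hm)"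
    by (rule nn_integral_cmult) measurable
  also have "(\<integral>\<^sup>+p. (\<integral>\<^sup>+q. H p q \<partial>hm) \<partial>hm) = (\<integral>\<^sup>+q. (\<integral>\<^sup>+p. H p q \<partial>hm) \<partial>hm)"
    by (rule Fubini'[symmetric]) measurable
  also have "\<dots> \<le> (\<integral>\<^sup>+q. e * ennreal ((F q)\<^sup>2) \<partial>hm)"
  proof (rule nn_integral_hm_mono)
    fix q :: "real \<times> 'a" assume q: "fst q > 0"
    have "(\<integral>\<^sup>+p. H p q \<partial>hm) = ennreal ((F q)\<^sup>2) * (\<integral>\<^sup>+p. ennreal ((ker \<phi> p q)\<^sup>2) * indicator X p \<partial>hm)"
      unfolding H_def by (rule nn_integral_cmult) measurable
    also have "\<dots> \<le> ennreal ((F q)\<^sup>2) * e" by (intro mult_left_mono X q) simp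
    finally show "(\<integral>\<^sup>+p. H p q \<partial>hm) \<le> e * ennreal ((F q)\<^sup>2)" by (simp add: mult.commute)
  qed
  also have "\<dots> = e * ennreal ((nrm lborel f)\<^sup>2)"
    unfolding F_def nn_integral_wt[OF f, symmetric] by (rule nn_integral_cmult) measurable
  finally show ?thesis by (simp add: F_def mult.assoc mult_left_mono)
qed

text \<open>The bound is uniform in f. Thus the transform restricted to \<open>E\<close> is
  approximated in operator norm by its restrictions to boxes, and this is where its compactness
  comes from.\<close>

lemma wt_tail:
  assumes e: "(e::ennreal) > 0"
  shows "\<exists>R\<ge>1. \<forall>f. sq_integrable lborel f \<longrightarrow>
    (\<integral>\<^sup>+p. ennreal ((cmod (wt \<phi> f p))\<^sup>2) * indicator (E - box_grp R) p \<partial>hm) \<le> e * ennreal ((nrm lborel f)\<^sup>2)"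
proof -
  have small: "\<exists>d>0. 2 * (d * c) \<le> e / 2" if fin: "c < \<infinity>" for c :: ennreal
  proof -
    obtain c' where c': "c = ennreal c'" "c' \<ge> 0" using fin by (cases c) auto
    obtain e' where e': "e' > 0" "ennreal e' \<le> e"
    proof (cases e)
      case (real r) then show ?thesis using that[of r] e by (auto simp: ennreal_less_zero_iff)
    next
      case top then show ?thesis using that[of 1] by simp
    qed
    \<comment> \<open>The 1 in the denominator covers c' = 0; since c' <= c' + 1, four times the
      product x c' is at most e'.\<close>
    define x where "x = e' / (4 * (c' + 1))"
    have x: "x > 0" using c' e' by (simp add: x_def)
    have "2 * (ennreal x * c) = ennreal (2 * (x * c'))"
      using c' x by (simp add: ennreal_mult)
    also have "\<dots> \<le> ennreal (e' / 2)"
      using c' e' by (intro ennreal_leI) (simp add: x_def field_simps)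
    also have "\<dots> = ennreal e' / 2" using e' by (simp add: divide_ennreal[symmetric] ennreal_numeral)
    also have "\<dots> \<le> e / 2" using e' by (intro divide_right_mono_ennreal)
    finally show ?thesis using x by (intro exI[of _ "ennreal x"]) auto
  qed
  \<comment> \<open>The order of choices matters: the tolerance \<open>d\<close> for the far part
    fixes m and with it the measure of the box; only then is \<open>d'\<close> chosen against that
    measure, and R against \<open>d'\<close>. The factor 2 comes from (u + v)^2 <= 2 u^2 + 2
    v^2.\<close>
  obtain d where d: "d > 0" "2 * (d * Cs) \<le> e / 2" using small[OF Cs_finite] by auto
  have "\<exists>m\<ge>1. (\<integral>\<^sup>+r. ennreal (ker \<phi> (1, 0) r * wgt r) * indicator (- box_grp m) r \<partial>hm) \<le> d"
    by (rule nn_integral_hm_tail[OF _ _ d(1)]) (use Cs_finite in \<open>measurable, simp add: Cs_def\<close>)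
  then obtain m where m: "m \<ge> 1"
    and md: "(\<integral>\<^sup>+r. ennreal (ker \<phi> (1, 0) r * wgt r) * indicator (- box_grp m) r \<partial>hm) \<le> d" by blast
  define B :: "(real \<times> 'a) set" where "B = box_grp m"
  have [measurable]: "B \<in> sets borel" by (simp add: B_def)
  obtain d' where d': "d' > 0" "2 * (d' * emeasure hm B) \<le> e / 2"
    using small[OF emeasure_box_grp_finite[OF m]] unfolding B_def by auto
  obtain R where R: "R \<ge> 1"
    and Rd: "\<And>q. fst q > 0 \<Longrightarrow> (\<integral>\<^sup>+p. ennreal ((ker \<phi> p q)\<^sup>2) * indicator (E - box_grp R) p \<partial>hm) \<le> d'"
    using ker_uniform_tail[OF d'(1)] by blast
  define X where "X = E - box_grp R"
  have [measurable]: "X \<in> sets borel" by (simp add: X_def E)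
  have "(\<integral>\<^sup>+p. ennreal ((cmod (wt \<phi> f p))\<^sup>2) * indicator X p \<partial>hm) \<le> e * ennreal ((nrm lborel f)\<^sup>2)"
    if f: "sq_integrable lborel f" for f
  proof -
    have [measurable]: "f \<in> borel_measurable borel" using f by (simp add: sq_integrable_def)
    interpret sigma_finite_measure "hm :: (real \<times> 'a) measure" by (rule sigma_finite_hm)
    define near where "near A p = (\<integral>\<^sup>+q. ennreal (cmod (wt \<phi> f q) * (ker \<phi> p q * indicator A (grp_mult (ginv p) q))) \<partial>hm)"
      for A and p :: "real \<times> 'a"
    have [measurable]: "near B \<in> borel_measurable hm" "near (- B) \<in> borel_measurable hm"
      unfolding near_def by measurable
    have "(\<integral>\<^sup>+p. ennreal ((cmod (wt \<phi> f p))\<^sup>2) * indicator X p \<partial>hm)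
      \<le> (\<integral>\<^sup>+p. 2 * ((near B p)\<^sup>2 * indicator X p) + 2 * (near (- B) p)\<^sup>2 \<partial>hm)"
    proof (rule nn_integral_hm_mono)
      fix p :: "real \<times> 'a" assume p: "fst p > 0"
      have "(\<integral>\<^sup>+q. ennreal (cmod (wt \<phi> f q) * ker \<phi> p q) \<partial>hm) = near B p + near (- B) p"
        unfolding near_def by (subst nn_integral_add[symmetric]) (auto intro!: nn_integral_cong simp: indicator_def)
      with reproducing_bound[OF f p]
      have "ennreal (cmod (wt \<phi> f p)) \<le> near B p + near (- B) p" by simp
      then have "(ennreal (cmod (wt \<phi> f p)))\<^sup>2 \<le> (near B p + near (- B) p)\<^sup>2" by (rule power_mono) simp
      also have "\<dots> \<le> 2 * (near B p)\<^sup>2 + 2 * (near (- B) p)\<^sup>2" by (rule ennreal_square_add_le)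
      finally show "ennreal ((cmod (wt \<phi> f p))\<^sup>2) * indicator X p \<le> 2 * ((near B p)\<^sup>2 * indicator X p) + 2 * (near (- B) p)\<^sup>2"
        by (auto simp: indicator_def ennreal_power)
    qed
    also have "\<dots> = 2 * (\<integral>\<^sup>+p. (near B p)\<^sup>2 * indicator X p \<partial>hm) + 2 * (\<integral>\<^sup>+p. (near (- B) p)\<^sup>2 \<partial>hm)"
      by (simp add: nn_integral_add nn_integral_cmult)
    also have "\<dots> \<le> 2 * (emeasure hm B * d' * ennreal ((nrm lborel f)\<^sup>2)) + 2 * (d * Cs * ennreal ((nrm lborel f)\<^sup>2))"
    proof (intro add_mono mult_left_mono)
      show "(\<integral>\<^sup>+p. (near B p)\<^sup>2 * indicator X p \<partial>hm) \<le> emeasure hm B * d' * ennreal ((nrm lborel f)\<^sup>2)"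
        unfolding near_def by (rule near_estimate[OF _ _ f]) (use Rd in \<open>auto simp: X_def\<close>)
      have "(\<integral>\<^sup>+p. (near (- B) p)\<^sup>2 \<partial>hm)
        \<le> (\<integral>\<^sup>+r. ennreal (ker \<phi> (1, 0) r * wgt r) * indicator (- B) r \<partial>hm) * Cs * ennreal ((nrm lborel f)\<^sup>2)"
        unfolding near_def by (rule far_estimate[OF _ f]) simp
      also have "\<dots> \<le> d * Cs * ennreal ((nrm lborel f)\<^sup>2)"
        using md unfolding B_def by (intro mult_right_mono) auto
      finally show "(\<integral>\<^sup>+p. (near (- B) p)\<^sup>2 \<partial>hm) \<le> d * Cs * ennreal ((nrm lborel f)\<^sup>2)" .
    qed auto
    also have "\<dots> = (2 * (d' * emeasure hm B) + 2 * (d * Cs)) * ennreal ((nrm lborel f)\<^sup>2)"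
      by (simp add: distrib_right distrib_left mult_ac)
    also have "\<dots> \<le> (e / 2 + e / 2) * ennreal ((nrm lborel f)\<^sup>2)"
      by (intro mult_right_mono add_mono d d') auto
    also have "e / 2 + e / 2 = e"
    proof (cases e)
      case (real r)
      have "ennreal r / 2 = ennreal (r / 2)"
        using divide_ennreal[of r 2] real by simp
      then show ?thesis using real by (simp flip: ennreal_plus)
    qed (simp add: ennreal_top_divide)
    finally show ?thesis .
  qed
  with R show ?thesis unfolding X_def by blast
qed

end

section \<open>Compactness\<close>

lemma dense_sequence_grp:
  obtains d :: "nat \<Rightarrow> real \<times> 'a::euclidean_space"
  where "\<And>i. fst (d i) > 0"
    and "\<And>p. fst p > 0 \<Longrightarrow> \<exists>r. (\<lambda>n. d (r n)) \<longlonglongrightarrow> p"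
proof -
  obtain D :: "(real \<times> 'a) set" where D: "countable D" "\<And>X. open X \<Longrightarrow> X \<noteq> {} \<Longrightarrow> \<exists>d\<in>D. d \<in> X"
    by (rule countable_dense_setE) blast
  define P where "P = {p :: real \<times> 'a. fst p > 0}"
  have P: "open P" unfolding P_def by (intro open_Collect_less continuous_intros)
  define D' where "D' = D \<inter> P"
  have "(1, 0) \<in> P" by (simp add: P_def)
  then have ne: "D' \<noteq> {}" using D(2)[OF P] by (auto simp: D'_def)
  have c: "countable D'" using D(1) by (simp add: D'_def)
  show thesis
  proof (rule that[of "from_nat_into D'"])
    show "fst (from_nat_into D' i) > 0" for i
      using from_nat_into[OF ne, of i] by (simp add: D'_def P_def)
    show "\<exists>r. (\<lambda>n. from_nat_into D' (r n)) \<longlonglongrightarrow> p" if p: "fst p > 0" for p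
    proof -
      have "\<exists>i. dist (from_nat_into D' i) p < 1 / real (Suc n)" for n
      proof -
        have "open (ball p (1 / real (Suc n)) \<inter> P)" using P by blast
        moreover have "p \<in> ball p (1 / real (Suc n)) \<inter> P" using p by (simp add: P_def)
        ultimately obtain x where x: "x \<in> D" "x \<in> ball p (1 / real (Suc n)) \<inter> P" using D(2) by blast
        then have "x \<in> D'" by (simp add: D'_def)
        then obtain i where "from_nat_into D' i = x" using from_nat_into_surj[OF c] by blast
        with x show ?thesis by (auto simp: dist_commute)
      qed
      then obtain r where r: "\<And>n. dist (from_nat_into D' (r n)) p < 1 / real (Suc n)" by metis
      have "(\<lambda>n. dist (from_nat_into D' (r n)) p) \<longlonglongrightarrow> 0"
        by (rule Lim_null_comparison[OF _ LIMSEQ_Suc[OF lim_1_over_n]])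
           (use r in \<open>auto intro!: always_eventually less_imp_le\<close>)
      then show ?thesis using tendsto_dist_iff by blast
    qed
  qed
qed

context wavelet_isometry
begin

text \<open>Transforms of norm-bounded functions are equicontinuous at p, because the wavelets move
  continuously in norm; convergence at a dense set of points therefore spreads to all
  points.\<close>

lemma wt_tendsto_zero_of_dense:
  assumes d: "\<And>i. fst (d i) > 0" "\<And>p. fst p > 0 \<Longrightarrow> \<exists>r. (\<lambda>n. d (r n)) \<longlonglongrightarrow> p"
    and g: "\<And>n. sq_integrable lborel (g n)" "\<And>n. nrm lborel (g n) \<le> M"
    and lim: "\<And>i. (\<lambda>n. wt \<phi> (g n) (d i)) \<longlonglongrightarrow> 0" and p: "fst p > 0"
  shows "(\<lambda>n. wt \<phi> (g n) p) \<longlonglongrightarrow> 0"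
proof (rule LIMSEQ_I)
  fix e :: real assume e: "e > 0"
  have M: "M \<ge> 0" using g(2)[of 0] nrm_nonneg[of lborel "g 0"] by linarith
  obtain r where r: "(\<lambda>n. d (r n)) \<longlonglongrightarrow> p" using d(2)[OF p] by blast
  have "(\<lambda>n. M * nrm lborel (\<lambda>x. wavelet \<phi> (d (r n)) x - wavelet \<phi> p x)) \<longlonglongrightarrow> 0"
    by (intro tendsto_mult_right_zero wavelet_continuous[OF \<phi> r] d p)
  from LIMSEQ_D[OF this, of "e/2"] e
  obtain k where k: "\<bar>M * nrm lborel (\<lambda>x. wavelet \<phi> (d (r k)) x - wavelet \<phi> p x)\<bar> < e/2" by auto
  from LIMSEQ_D[OF lim[of "r k"], of "e/2"] e
  obtain N where N: "\<And>n. n \<ge> N \<Longrightarrow> cmod (wt \<phi> (g n) (d (r k))) < e/2" by auto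
  have "cmod (wt \<phi> (g n) p) < e" if "n \<ge> N" for n
  proof -
    have "wt \<phi> (g n) (d (r k)) - wt \<phi> (g n) p = ip lborel (g n) (\<lambda>x. wavelet \<phi> (d (r k)) x - wavelet \<phi> p x)"
      unfolding wt_def by (intro ip_diff_right[symmetric] g sq_integrable_\<phi> d p)
    then have "cmod (wt \<phi> (g n) (d (r k)) - wt \<phi> (g n) p)
      \<le> nrm lborel (g n) * nrm lborel (\<lambda>x. wavelet \<phi> (d (r k)) x - wavelet \<phi> p x)"
      using Cauchy_Schwarz_ip(2)[OF g(1) sq_integrable_diff[OF sq_integrable_\<phi>[OF d(1)] sq_integrable_\<phi>[OF p]]] by simp
    also have "\<dots> \<le> M * nrm lborel (\<lambda>x. wavelet \<phi> (d (r k)) x - wavelet \<phi> p x)"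
      by (intro mult_right_mono g) simp
    also have "\<dots> < e/2" using k by linarith
    finally show ?thesis using N[OF that] norm_triangle_ineq2[of "wt \<phi> (g n) p" "wt \<phi> (g n) (d (r k))"]
      by (simp add: norm_minus_commute)
  qed
  then show "\<exists>no. \<forall>n\<ge>no. norm (wt \<phi> (g n) p - 0) < e" by auto
qed

end

context thin_set
begin

text \<open>The hypotheses amount to weak convergence to 0. On a box the transforms are uniformly
  bounded and the measure is finite, so dominated convergence applies; the rest of \<open>E\<close>
  is small uniformly in n by \<open>wt_tail\<close>.\<close>

lemma wt_compact:
  assumes g: "\<And>n. sq_integrable lborel (g n)" "\<And>n. nrm lborel (g n) \<le> M"
    and lim: "\<And>p. fst p > 0 \<Longrightarrow> (\<lambda>n. wt \<phi> (g n) p) \<longlonglongrightarrow> 0"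
  shows "(\<lambda>n. \<integral>\<^sup>+p. ennreal ((cmod (wt \<phi> (g n) p))\<^sup>2) * indicator E p \<partial>hm) \<longlonglongrightarrow> 0"
proof (rule order_tendstoI)
  have [measurable]: "g n \<in> borel_measurable borel" for n using g by (simp add: sq_integrable_def)
  have M: "M \<ge> 0" using g(2)[of 0] nrm_nonneg[of lborel "g 0"] by linarith
  fix a :: ennreal assume "0 < a"
  then obtain z where "0 < z" "z < a" using dense by blast
  then obtain e where e: "e > 0" "ennreal e < a" by (cases z) (auto simp: ennreal_less_zero_iff)
  \<comment> \<open>Chosen so that e1 M^2 <= e/2, with the 1 covering M = 0.\<close>
  define e1 where "e1 = e / (2 * (M\<^sup>2 + 1))"
  have M1: "M\<^sup>2 + 1 > 0" by (simp add: add_nonneg_pos)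
  have e1: "e1 > 0" using e M1 by (simp add: e1_def)
  have e1M: "e1 * M\<^sup>2 \<le> e / 2" using e M1 by (simp add: e1_def field_simps)
  obtain R where R: "R \<ge> 1" and tail: "\<And>f. sq_integrable lborel f \<Longrightarrow>
    (\<integral>\<^sup>+p. ennreal ((cmod (wt \<phi> f p))\<^sup>2) * indicator (E - box_grp R) p \<partial>hm) \<le> ennreal e1 * ennreal ((nrm lborel f)\<^sup>2)"
    using wt_tail[of "ennreal e1"] e1 by auto
  have "(\<lambda>n. \<integral>\<^sup>+p. ennreal ((cmod (wt \<phi> (g n) p))\<^sup>2) * indicator (E \<inter> box_grp R) p \<partial>hm)
    \<longlonglongrightarrow> (\<integral>\<^sup>+p. 0 \<partial>(hm :: (real \<times> 'a) measure))"
  proof (rule nn_integral_dominated_convergence[where w="\<lambda>p. ennreal ((M * nrm lborel \<phi>)\<^sup>2) * indicator (box_grp R) p"])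
    show "AE p in hm. ennreal ((cmod (wt \<phi> (g n) p))\<^sup>2) * indicator (E \<inter> box_grp R) p
      \<le> ennreal ((M * nrm lborel \<phi>)\<^sup>2) * indicator (box_grp R) p" for n
      using AE_hm_fst
    proof eventually_elim
      case (elim p)
      have "cmod (wt \<phi> (g n) p) \<le> M * nrm lborel \<phi>"
        using wt_bound[OF g(1) elim, of n] mult_right_mono[OF g(2)[of n], of "nrm lborel \<phi>"] by simp
      then show ?case by (auto simp: indicator_def intro!: ennreal_leI power_mono)
    qed
    show "(\<integral>\<^sup>+p. ennreal ((M * nrm lborel \<phi>)\<^sup>2) * indicator (box_grp R) p \<partial>(hm :: (real \<times> 'a) measure)) < \<infinity>"
      using emeasure_box_grp_finite[OF R, where 'a='a]
      by (subst nn_integral_cmult_indicator) (auto simp: ennreal_mult_less_top)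
    show "AE p in hm. (\<lambda>n. ennreal ((cmod (wt \<phi> (g n) p))\<^sup>2) * indicator (E \<inter> box_grp R) p) \<longlonglongrightarrow> 0"
      using AE_hm_fst
    proof eventually_elim
      case (elim p)
      have "(\<lambda>n. ennreal ((cmod (wt \<phi> (g n) p))\<^sup>2)) \<longlonglongrightarrow> ennreal ((cmod 0)\<^sup>2)"
        by (intro tendsto_ennrealI tendsto_power tendsto_norm lim elim)
      then show ?case by (cases "p \<in> E \<inter> box_grp R") auto
    qed
  qed measurable
  then have "(\<lambda>n. \<integral>\<^sup>+p. ennreal ((cmod (wt \<phi> (g n) p))\<^sup>2) * indicator (E \<inter> box_grp R) p \<partial>hm) \<longlonglongrightarrow> 0" by simp
  then have "\<forall>\<^sub>F n in sequentially. (\<integral>\<^sup>+p. ennreal ((cmod (wt \<phi> (g n) p))\<^sup>2) * indicator (E \<inter> box_grp R) p \<partial>hm) < ennreal (e/2)"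
    using e by (intro order_tendstoD(2)) auto
  then show "\<forall>\<^sub>F n in sequentially. (\<integral>\<^sup>+p. ennreal ((cmod (wt \<phi> (g n) p))\<^sup>2) * indicator E p \<partial>hm) < a"
  proof eventually_elim
    case (elim n)
    have "(\<integral>\<^sup>+p. ennreal ((cmod (wt \<phi> (g n) p))\<^sup>2) * indicator E p \<partial>hm)
      = (\<integral>\<^sup>+p. ennreal ((cmod (wt \<phi> (g n) p))\<^sup>2) * indicator (E \<inter> box_grp R) p \<partial>hm)
      + (\<integral>\<^sup>+p. ennreal ((cmod (wt \<phi> (g n) p))\<^sup>2) * indicator (E - box_grp R) p \<partial>hm)"
      by (subst nn_integral_add[symmetric]) (auto intro!: nn_integral_cong simp: indicator_def)
    also have "\<dots> \<le> ennreal (e/2) + ennreal e1 * ennreal ((nrm lborel (g n))\<^sup>2)"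
      by (intro add_mono tail g less_imp_le[OF elim])
    also have "\<dots> \<le> ennreal (e/2) + ennreal (e1 * M\<^sup>2)"
      using e1 g(2)[of n] by (subst ennreal_mult[symmetric]) (auto intro!: add_left_mono ennreal_leI mult_left_mono power_mono)
    also have "\<dots> \<le> ennreal (e/2) + ennreal (e/2)" by (intro add_left_mono ennreal_leI e1M)
    also have "\<dots> = ennreal e" using e by (simp flip: ennreal_plus)
    finally show ?case using e by simp
  qed
qed auto

lemma nn_integral_wt_split:
  assumes "sq_integrable lborel f"
  shows "(\<integral>\<^sup>+p. ennreal ((cmod (wt \<phi> f p))\<^sup>2) * indicator E p \<partial>hm)
    + (\<integral>\<^sup>+p. ennreal ((cmod (wt \<phi> f p))\<^sup>2) * indicator (- E) p \<partial>hm) = ennreal ((nrm lborel f)\<^sup>2)"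
proof -
  have [measurable]: "f \<in> borel_measurable borel" using assms by (simp add: sq_integrable_def)
  show ?thesis
    unfolding nn_integral_wt[OF assms, symmetric]
    by (subst nn_integral_add[symmetric]) (auto intro!: nn_integral_cong simp: indicator_def)
qed

lemma nn_integral_wt_diff_le:
  assumes f: "sq_integrable lborel f" and g: "sq_integrable lborel g" and [measurable]: "X \<in> sets borel"
  shows "(\<integral>\<^sup>+p. ennreal ((cmod (wt \<phi> (\<lambda>x. f x - g x) p))\<^sup>2) * indicator X p \<partial>hm)
    \<le> 2 * (\<integral>\<^sup>+p. ennreal ((cmod (wt \<phi> f p))\<^sup>2) * indicator X p \<partial>hm)
      + 2 * (\<integral>\<^sup>+p. ennreal ((cmod (wt \<phi> g p))\<^sup>2) * indicator X p \<partial>hm)"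
proof -
  have [measurable]: "f \<in> borel_measurable borel" "g \<in> borel_measurable borel"
    using f g by (simp_all add: sq_integrable_def)
  have "(\<integral>\<^sup>+p. ennreal ((cmod (wt \<phi> (\<lambda>x. f x - g x) p))\<^sup>2) * indicator X p \<partial>hm)
    \<le> (\<integral>\<^sup>+p. 2 * (ennreal ((cmod (wt \<phi> f p))\<^sup>2) * indicator X p) + 2 * (ennreal ((cmod (wt \<phi> g p))\<^sup>2) * indicator X p) \<partial>hm)"
  proof (rule nn_integral_hm_mono)
    fix p :: "real \<times> 'a" assume p: "fst p > 0"
    have "ennreal (cmod (wt \<phi> (\<lambda>x. f x - g x) p)) \<le> ennreal (cmod (wt \<phi> f p)) + ennreal (cmod (wt \<phi> g p))"
      unfolding wt_diff[OF f g p] by (metis ennreal_leI ennreal_plus norm_ge_zero norm_triangle_ineq4)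
    from order_trans[OF power_mono[OF this, of 2] ennreal_square_add_le]
    show "ennreal ((cmod (wt \<phi> (\<lambda>x. f x - g x) p))\<^sup>2) * indicator X p
      \<le> 2 * (ennreal ((cmod (wt \<phi> f p))\<^sup>2) * indicator X p) + 2 * (ennreal ((cmod (wt \<phi> g p))\<^sup>2) * indicator X p)"
      by (simp add: indicator_def ennreal_power)
  qed
  also have "\<dots> = 2 * (\<integral>\<^sup>+p. ennreal ((cmod (wt \<phi> f p))\<^sup>2) * indicator X p \<partial>hm)
      + 2 * (\<integral>\<^sup>+p. ennreal ((cmod (wt \<phi> g p))\<^sup>2) * indicator X p \<partial>hm)"
    by (simp add: nn_integral_add nn_integral_cmult)
  finally show ?thesis .
qed

text \<open>A diagonal subsequence makes the transforms converge at a dense set of points. Were it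
  not Cauchy, differences of ever later members would stay large in norm, yet their transforms
  vanish in the limit on \<open>E\<close> by compactness and off \<open>E\<close> by hypothesis,
  which the isometry forbids.\<close>

lemma convergent_subsequence:
  assumes f: "\<And>n. sq_integrable lborel (f n)" "\<And>n. nrm lborel (f n) \<le> M"
    and off: "(\<lambda>n. \<integral>\<^sup>+p. ennreal ((cmod (wt \<phi> (f n) p))\<^sup>2) * indicator (- E) p \<partial>hm) \<longlonglongrightarrow> 0"
  shows "\<exists>k g. strict_mono (k :: nat \<Rightarrow> nat) \<and> sq_integrable lborel g \<and> (\<lambda>n. nrm lborel (\<lambda>x. f (k n) x - g x)) \<longlonglongrightarrow> 0"
proof -
  obtain d :: "nat \<Rightarrow> real \<times> 'a" where d: "\<And>i. fst (d i) > 0"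
    "\<And>p. fst p > 0 \<Longrightarrow> \<exists>r. (\<lambda>n. d (r n)) \<longlonglongrightarrow> p" by (rule dense_sequence_grp) blast
  have bd: "cmod (wt \<phi> (f n) x) \<le> M * nrm lborel \<phi>" if "x \<in> range d" for n x
  proof -
    have "fst x > 0" using that d by auto
    from wt_bound[OF f(1) this, of n] mult_right_mono[OF f(2)[of n], of "nrm lborel \<phi>"] show ?thesis by simp
  qed
  have "countable (range d)" by simp
  from function_convergent_subsequence[of "range d" "\<lambda>n. wt \<phi> (f n)" "M * nrm lborel \<phi>", OF this bd]
  obtain k where k: "strict_mono (k :: nat \<Rightarrow> nat)"
    and kl: "\<And>x. x \<in> range d \<Longrightarrow> \<exists>l. (\<lambda>n. wt \<phi> (f (k n)) x) \<longlonglongrightarrow> l" by blast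
  define h where "h n = f (k n)" for n
  have h: "sq_integrable lborel (h n)" "nrm lborel (h n) \<le> M" for n using f by (simp_all add: h_def)
  have hoff: "(\<lambda>n. \<integral>\<^sup>+p. ennreal ((cmod (wt \<phi> (h n) p))\<^sup>2) * indicator (- E) p \<partial>hm) \<longlonglongrightarrow> 0"
    unfolding h_def using LIMSEQ_subseq_LIMSEQ[OF off k] by (simp add: o_def)
  have "\<exists>g. sq_integrable lborel g \<and> (\<lambda>n. nrm lborel (\<lambda>x. h n x - g x)) \<longlonglongrightarrow> 0"
  proof (rule sq_integrable_complete[OF h(1)], rule ccontr)
    fix e :: real assume e: "e > 0"
      and "\<not> (\<exists>N. \<forall>m\<ge>N. \<forall>n\<ge>N. nrm lborel (\<lambda>x. h m x - h n x) \<le> e)"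
    then have "\<forall>N. \<exists>m n. m \<ge> N \<and> n \<ge> N \<and> nrm lborel (\<lambda>x. h m x - h n x) > e"
      by (metis not_le)
    then obtain m n where mn: "\<And>N. m N \<ge> N" "\<And>N. n N \<ge> N"
      and big: "\<And>N::nat. nrm lborel (\<lambda>x. h (m N) x - h (n N) x) > e" by metis
    have fm: "filterlim m at_top sequentially" and fn: "filterlim n at_top sequentially"
      by (rule filterlim_at_top_mono[OF filterlim_ident]; use mn in simp)+
    define g where "g N x = h (m N) x - h (n N) x" for N x
    have g: "sq_integrable lborel (g N)" for N unfolding g_def by (intro sq_integrable_diff h)
    have gM: "nrm lborel (g N) \<le> 2 * M" for N
      using nrm_triangle[OF h(1) sq_integrable_cmult[OF h(1), of "-1"], of "m N" "n N"] h(2)[of "m N"] h(2)[of "n N"]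
      unfolding nrm_cmult by (simp add: g_def[abs_def])
    have gd: "(\<lambda>N. wt \<phi> (g N) (d i)) \<longlonglongrightarrow> 0" for i
    proof -
      obtain l where l: "(\<lambda>n. wt \<phi> (h n) (d i)) \<longlonglongrightarrow> l" using kl[of "d i"] by (auto simp: h_def)
      have "(\<lambda>N. wt \<phi> (h (m N)) (d i) - wt \<phi> (h (n N)) (d i)) \<longlonglongrightarrow> l - l"
        by (intro tendsto_diff filterlim_compose[OF l fm] filterlim_compose[OF l fn])
      then show ?thesis unfolding g_def by (simp add: wt_diff h d)
    qed
    have on: "(\<lambda>N. \<integral>\<^sup>+p. ennreal ((cmod (wt \<phi> (g N) p))\<^sup>2) * indicator E p \<partial>hm) \<longlonglongrightarrow> 0"
      by (rule wt_compact[OF g gM wt_tendsto_zero_of_dense[OF d g gM gd]])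
    have off2: "(\<lambda>N. \<integral>\<^sup>+p. ennreal ((cmod (wt \<phi> (g N) p))\<^sup>2) * indicator (- E) p \<partial>hm) \<longlonglongrightarrow> 0"
    proof (rule tendsto_sandwich[OF _ _ tendsto_const])
      show "\<forall>\<^sub>F N in sequentially. (\<integral>\<^sup>+p. ennreal ((cmod (wt \<phi> (g N) p))\<^sup>2) * indicator (- E) p \<partial>hm)
        \<le> 2 * (\<integral>\<^sup>+p. ennreal ((cmod (wt \<phi> (h (m N)) p))\<^sup>2) * indicator (- E) p \<partial>hm)
        + 2 * (\<integral>\<^sup>+p. ennreal ((cmod (wt \<phi> (h (n N)) p))\<^sup>2) * indicator (- E) p \<partial>hm)"
        unfolding g_def by (intro always_eventually allI nn_integral_wt_diff_le h) simp
      have "(\<lambda>N. 2 * (\<integral>\<^sup>+p. ennreal ((cmod (wt \<phi> (h (m N)) p))\<^sup>2) * indicator (- E) p \<partial>hm)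
        + 2 * (\<integral>\<^sup>+p. ennreal ((cmod (wt \<phi> (h (n N)) p))\<^sup>2) * indicator (- E) p \<partial>hm)) \<longlonglongrightarrow> 2 * 0 + 2 * 0"
        by (intro tendsto_add ennreal_tendsto_cmult filterlim_compose[OF hoff fm] filterlim_compose[OF hoff fn]) auto
      then show "(\<lambda>N. 2 * (\<integral>\<^sup>+p. ennreal ((cmod (wt \<phi> (h (m N)) p))\<^sup>2) * indicator (- E) p \<partial>hm)
        + 2 * (\<integral>\<^sup>+p. ennreal ((cmod (wt \<phi> (h (n N)) p))\<^sup>2) * indicator (- E) p \<partial>hm)) \<longlonglongrightarrow> 0" by simp
    qed auto
    have "(\<lambda>N. ennreal ((nrm lborel (g N))\<^sup>2)) \<longlonglongrightarrow> 0 + 0"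
      unfolding nn_integral_wt_split[OF g, symmetric] by (intro tendsto_add on off2)
    then have "(\<lambda>N. (nrm lborel (g N))\<^sup>2) \<longlonglongrightarrow> 0" by (simp add: ennreal_tendsto_0_iff)
    from LIMSEQ_D[OF this, of "e\<^sup>2"] e obtain N where "(nrm lborel (g N))\<^sup>2 < e\<^sup>2" by auto
    then have "nrm lborel (g N) < e" using e by (intro power2_less_imp_less[of _ e]) auto
    then show False using big[of N] by (simp add: g_def[abs_def])
  qed
  then show ?thesis using k unfolding h_def by blast
qed

text \<open>Failure of the constants 1/(n + 1) gives unit vectors whose mass off \<open>E\<close>
  tends to 0. They have a subsequence converging in norm, so that the limit still has norm
  1.\<close>

lemma exists_extremal:
  assumes no: "\<And>c::real. c > 0 \<Longrightarrow> \<exists>f. sq_integrable lborel f \<and>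
    (\<integral>\<^sup>+p. ennreal ((cmod (wt \<phi> f p))\<^sup>2) * indicator (- E) p \<partial>hm) < ennreal (c * (nrm lborel f)\<^sup>2)"
  shows "\<exists>f. sq_integrable lborel f \<and> nrm lborel f = 1 \<and>
    (\<integral>\<^sup>+p. ennreal ((cmod (wt \<phi> f p))\<^sup>2) * indicator (- E) p \<partial>hm) = 0"
proof -
  have "\<exists>f. sq_integrable lborel f \<and> nrm lborel f = 1 \<and>
    (\<integral>\<^sup>+p. ennreal ((cmod (wt \<phi> f p))\<^sup>2) * indicator (- E) p \<partial>hm) \<le> ennreal (1 / real (Suc n))" for n
  proof -
    obtain f where f: "sq_integrable lborel f"
      and lt: "(\<integral>\<^sup>+p. ennreal ((cmod (wt \<phi> f p))\<^sup>2) * indicator (- E) p \<partial>hm) < ennreal (1 / real (Suc n) * (nrm lborel f)\<^sup>2)"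
      using no[of "1 / real (Suc n)"] by auto
    have [measurable]: "f \<in> borel_measurable borel" using f by (simp add: sq_integrable_def)
    \<comment> \<open>The strict inequality excludes norm 0, for which its right-hand side would be
      0.\<close>
    have n0: "nrm lborel f > 0"
    proof (rule ccontr)
      assume "\<not> nrm lborel f > 0"
      then have "nrm lborel f = 0" using nrm_nonneg[of lborel f] by linarith
      with lt show False by simp
    qed
    define c where "c = complex_of_real (1 / nrm lborel f)"
    have c2: "(cmod c)\<^sup>2 = 1 / (nrm lborel f)\<^sup>2" by (simp add: c_def norm_divide power_divide)
    have "(\<integral>\<^sup>+p. ennreal ((cmod (wt \<phi> (\<lambda>x. c * f x) p))\<^sup>2) * indicator (- E) p \<partial>hm)
      = ennreal ((cmod c)\<^sup>2) * (\<integral>\<^sup>+p. ennreal ((cmod (wt \<phi> f p))\<^sup>2) * indicator (- E) p \<partial>hm)"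
      by (subst nn_integral_cmult[symmetric])
         (auto simp: wt_cmult norm_mult power_mult_distrib ennreal_mult mult.assoc)
    also have "\<dots> \<le> ennreal ((cmod c)\<^sup>2) * ennreal (1 / real (Suc n) * (nrm lborel f)\<^sup>2)"
      by (intro mult_left_mono less_imp_le[OF lt]) simp
    also have "\<dots> = ennreal (1 / real (Suc n))"
      using n0 by (subst ennreal_mult[symmetric]) (auto simp: c2)
    finally have small: "(\<integral>\<^sup>+p. ennreal ((cmod (wt \<phi> (\<lambda>x. c * f x) p))\<^sup>2) * indicator (- E) p \<partial>hm) \<le> ennreal (1 / real (Suc n))" .
    have unit: "nrm lborel (\<lambda>x. c * f x) = 1" unfolding nrm_cmult using n0 by (simp add: c_def norm_divide)
    show ?thesis by (rule exI[of _ "\<lambda>x. c * f x"]) (intro conjI sq_integrable_cmult f small unit)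
  qed
  then have "\<exists>f. \<forall>n. sq_integrable lborel (f n) \<and> nrm lborel (f n) = 1 \<and>
    (\<integral>\<^sup>+p. ennreal ((cmod (wt \<phi> (f n) p))\<^sup>2) * indicator (- E) p \<partial>hm) \<le> ennreal (1 / real (Suc n))"
    by (intro choice allI)
  then obtain f where all: "\<forall>n. sq_integrable lborel (f n) \<and> nrm lborel (f n) = 1 \<and>
    (\<integral>\<^sup>+p. ennreal ((cmod (wt \<phi> (f n) p))\<^sup>2) * indicator (- E) p \<partial>hm) \<le> ennreal (1 / real (Suc n))" ..
  then have f: "\<And>n. sq_integrable lborel (f n)" and f1: "\<And>n. nrm lborel (f n) = 1"
    and fo: "\<And>n. (\<integral>\<^sup>+p. ennreal ((cmod (wt \<phi> (f n) p))\<^sup>2) * indicator (- E) p \<partial>hm) \<le> ennreal (1 / real (Suc n))"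
    by simp_all
  have off: "(\<lambda>n. \<integral>\<^sup>+p. ennreal ((cmod (wt \<phi> (f n) p))\<^sup>2) * indicator (- E) p \<partial>hm) \<longlonglongrightarrow> 0"
  proof (rule tendsto_sandwich[OF _ _ tendsto_const])
    have "(\<lambda>n. ennreal (1 / real (Suc n))) \<longlonglongrightarrow> ennreal 0"
      by (intro tendsto_ennrealI LIMSEQ_Suc[OF lim_1_over_n])
    then show "(\<lambda>n. ennreal (1 / real (Suc n))) \<longlonglongrightarrow> 0" by simp
  qed (use fo in auto)
  obtain k g where k: "strict_mono (k :: nat \<Rightarrow> nat)" and g: "sq_integrable lborel g"
    and gl: "(\<lambda>n. nrm lborel (\<lambda>x. f (k n) x - g x)) \<longlonglongrightarrow> 0"
    using convergent_subsequence[OF f _ off, of 1] f1 by auto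
  have "(\<lambda>n. nrm lborel (f (k n))) \<longlonglongrightarrow> nrm lborel g" by (rule nrm_tendsto[OF f g gl])
  then have g1: "nrm lborel g = 1" by (simp add: f1 LIMSEQ_const_iff)
  define J where "J u = (\<integral>\<^sup>+p. ennreal ((cmod (wt \<phi> u p))\<^sup>2) * indicator (- E) p \<partial>hm)" for u
  \<comment> \<open>The limit is written as f (k n) - (f (k n) - g); both terms have mass off
    \<open>E\<close> tending to 0, the second one because its whole norm does.\<close>
  have "J g \<le> 2 * J (f (k n)) + 2 * ennreal ((nrm lborel (\<lambda>x. f (k n) x - g x))\<^sup>2)" for n
  proof -
    have "J (\<lambda>x. f (k n) x - (f (k n) x - g x)) \<le> 2 * J (f (k n)) + 2 * J (\<lambda>x. f (k n) x - g x)"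
      unfolding J_def by (intro nn_integral_wt_diff_le f sq_integrable_diff g) simp
    also have "J (\<lambda>x. f (k n) x - g x) \<le> ennreal ((nrm lborel (\<lambda>x. f (k n) x - g x))\<^sup>2)"
      unfolding J_def nn_integral_wt_split[OF sq_integrable_diff[OF f g], symmetric] by simp
    finally show ?thesis by (simp add: add_left_mono mult_left_mono)
  qed
  moreover have "(\<lambda>n. 2 * J (f (k n)) + 2 * ennreal ((nrm lborel (\<lambda>x. f (k n) x - g x))\<^sup>2)) \<longlonglongrightarrow> 2 * 0 + 2 * ennreal (0\<^sup>2)"
    using LIMSEQ_subseq_LIMSEQ[OF off k] unfolding J_def
    by (intro tendsto_add ennreal_tendsto_cmult tendsto_ennrealI tendsto_power gl) (auto simp: o_def)
  ultimately have "J g \<le> 2 * 0 + 2 * ennreal (0\<^sup>2)" by (intro LIMSEQ_le_const) auto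
  then have "J g = 0" by simp
  with g g1 show ?thesis unfolding J_def by blast
qed

end

section \<open>The Amrein--Berthier argument\<close>

text \<open>Elimination: a nonzero pivot \<open>w i0 k0\<close> solves the equation i0 for the
  unknown k0, and \<open>w'\<close> is the system that remains after substituting this. The value of
  \<open>c'\<close> at k0 undoes the substitution.\<close>

lemma homogeneous_solution:
  fixes w :: "'i \<Rightarrow> 'k \<Rightarrow> complex"
  assumes "finite I" "finite K" "card I < card K"
  shows "\<exists>c. (\<exists>k\<in>K. c k \<noteq> 0) \<and> (\<forall>i\<in>I. (\<Sum>k\<in>K. c k * w i k) = 0)"
  using assms
proof (induction I arbitrary: K w rule: finite_induct)
  case empty
  then obtain k where "k \<in> K" by fastforce
  then show ?case by (intro exI[of _ "\<lambda>_. 1"]) auto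
next
  case (insert i0 I)
  show ?case
  proof (cases "\<forall>k\<in>K. w i0 k = 0")
    case True
    obtain c where "\<exists>k\<in>K. c k \<noteq> 0" "\<forall>i\<in>I. (\<Sum>k\<in>K. c k * w i k) = 0"
      using insert.IH[of K w] insert.prems insert.hyps by fastforce
    with True show ?thesis by (intro exI[of _ c]) auto
  next
    case False
    then obtain k0 where k0: "k0 \<in> K" "w i0 k0 \<noteq> 0" by blast
    define K' where "K' = K - {k0}"
    define w' where "w' i k = w i k - w i k0 * (w i0 k / w i0 k0)" for i k
    have K': "finite K'" "card I < card K'" using insert k0 by (auto simp: K'_def)
    obtain c where c: "\<exists>k\<in>K'. c k \<noteq> 0" "\<forall>i\<in>I. (\<Sum>k\<in>K'. c k * w' i k) = 0"
      using insert.IH[OF K', of w'] by auto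
    define S where "S = (\<Sum>k\<in>K'. c k * w i0 k)"
    define c' where "c' k = (if k = k0 then - S / w i0 k0 else c k)" for k
    have split: "(\<Sum>k\<in>K. c' k * w i k) = - S / w i0 k0 * w i k0 + (\<Sum>k\<in>K'. c k * w i k)" for i
    proof -
      have "(\<Sum>k\<in>K. c' k * w i k) = c' k0 * w i k0 + (\<Sum>k\<in>K'. c' k * w i k)"
        unfolding K'_def using insert.prems k0 by (intro sum.remove) auto
      also have "(\<Sum>k\<in>K'. c' k * w i k) = (\<Sum>k\<in>K'. c k * w i k)"
        by (intro sum.cong) (auto simp: c'_def K'_def)
      finally show ?thesis by (simp add: c'_def)
    qed
    have "(\<Sum>k\<in>K. c' k * w i0 k) = 0"
      unfolding split using k0 by (simp add: S_def)
    moreover have "(\<Sum>k\<in>K. c' k * w i k) = 0" if "i \<in> I" for i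
    proof -
      have "0 = (\<Sum>k\<in>K'. c k * w' i k)" using c that by simp
      also have "\<dots> = (\<Sum>k\<in>K'. c k * w i k - (w i k0 / w i0 k0) * (c k * w i0 k))"
        by (intro sum.cong) (auto simp: w'_def field_simps)
      also have "\<dots> = (\<Sum>k\<in>K'. c k * w i k) - (w i k0 / w i0 k0) * S"
        by (simp add: sum_subtractf S_def sum_distrib_left)
      also have "\<dots> = (\<Sum>k\<in>K. c' k * w i k)" unfolding split by simp
      finally show ?thesis by simp
    qed
    moreover have "\<exists>k\<in>K. c' k \<noteq> 0" using c by (auto simp: c'_def K'_def)
    ultimately show ?thesis by (intro exI[of _ c']) auto
  qed
qed

section \<open>Linear independence of translates\<close>

lemma nrm_translate_power:
  fixes g :: "'a::euclidean_space \<Rightarrow> complex"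
  assumes g: "sq_integrable lborel g" and eig: "nrm lborel (\<lambda>x. g (x - y) - z * g x) = 0"
  shows "nrm lborel (\<lambda>x. g (x - real k *\<^sub>R y) - z ^ k * g x) = 0"
proof (induction k)
  case 0
  show ?case by (simp add: nrm_def)
next
  case (Suc k)
  note st = sq_integrable_translate[OF g]
  have a: "sq_integrable lborel (\<lambda>x. g (x - real (Suc k) *\<^sub>R y))"
    "sq_integrable lborel (\<lambda>x. z ^ k * g (x - y))" "sq_integrable lborel (\<lambda>x. z ^ Suc k * g x)"
    by (intro st sq_integrable_cmult g)+
  have d: "sq_integrable lborel (\<lambda>x. g (x - real k *\<^sub>R y) - z ^ k * g x)"
    by (intro sq_integrable_diff st sq_integrable_cmult g)
  have "nrm lborel (\<lambda>x. g (x - real (Suc k) *\<^sub>R y) - z ^ k * g (x - y)) = 0"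
    using sq_integrable_translate(2)[OF d, of y] Suc by (simp add: algebra_simps)
  moreover have "nrm lborel (\<lambda>x. z ^ k * g (x - y) - z ^ Suc k * g x) = 0"
  proof -
    have "(\<lambda>x. z ^ k * g (x - y) - z ^ Suc k * g x) = (\<lambda>x. z ^ k * (g (x - y) - z * g x))"
      by (auto simp: algebra_simps)
    then show ?thesis using nrm_cmult[of lborel "z ^ k" "\<lambda>x. g (x - y) - z * g x"] eig by simp
  qed
  ultimately have "nrm lborel (\<lambda>x. g (x - real (Suc k) *\<^sub>R y) - z ^ Suc k * g x) \<le> 0"
    using nrm_triangle_diff[OF a] by simp
  then show ?case using nrm_nonneg[of lborel "\<lambda>x. g (x - real (Suc k) *\<^sub>R y) - z ^ Suc k * g x"] by linarith
qed

text \<open>An eigenfunction would have the same mass on every translate of a ball.\<close>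

lemma translation_no_eigenvector:
  fixes g :: "'a::euclidean_space \<Rightarrow> complex"
  assumes g: "sq_integrable lborel g" and y: "y \<noteq> 0" and n: "nrm lborel g > 0"
  shows "nrm lborel (\<lambda>x. g (x - y) - z * g x) > 0"
proof (rule ccontr)
  assume "\<not> nrm lborel (\<lambda>x. g (x - y) - z * g x) > 0"
  then have eig: "nrm lborel (\<lambda>x. g (x - y) - z * g x) = 0"
    using nrm_nonneg[of lborel "\<lambda>x. g (x - y) - z * g x"] by linarith
  have [measurable]: "g \<in> borel_measurable borel" using g by (simp add: sq_integrable_def)
  note st = sq_integrable_translate[OF g]
  \<comment> \<open>Translation preserves the norm, so an eigenvalue must have modulus 1.\<close>
  have "nrm lborel g = cmod z * nrm lborel g"
    using nrm_diff_le[OF st(1) sq_integrable_cmult[OF g], of y z] by (simp add: eig st(2) nrm_cmult)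
  then have z: "cmod z = 1" using n by simp
  have "nrm lborel (trunc (real R) g) = 0" for R :: nat
  proof -
    define B where "B = cball (0::'a) (real R)"
    have [measurable]: "B \<in> sets borel" by (simp add: B_def)
    have sh: "sq_integrable lborel (\<lambda>x. indicator B (x + real k *\<^sub>R y) * g x)" for k
      unfolding sq_integrable_def
    proof (intro conjI)
      show "integrable lborel (\<lambda>x. (cmod (indicator B (x + real k *\<^sub>R y) * g x))\<^sup>2)"
        by (rule Bochner_Integration.integrable_bound[OF sq_integrable_integrable[OF g]])
           (auto simp: indicator_def)
    qed measurable
    \<comment> \<open>The left side measures g on the ball shifted by - k y. Translating by k y
      moves the shift onto g, where the eigenvalue equation replaces it by z^k, of modulus
      1.\<close>
    have eq: "nrm lborel (\<lambda>x. indicator B (x + real k *\<^sub>R y) * g x) = nrm lborel (trunc (real R) g)" for k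
    proof -
      have "nrm lborel (\<lambda>x. indicator B (x + real k *\<^sub>R y) * g x) = nrm lborel (trunc (real R) (\<lambda>x. g (x - real k *\<^sub>R y)))"
        using sq_integrable_translate(2)[OF sh[of k], of "real k *\<^sub>R y"] by (simp add: trunc_def[abs_def] B_def)
      also have "\<dots> = nrm lborel (\<lambda>x. z ^ k * trunc (real R) g x)"
      proof -
        have s1: "sq_integrable lborel (trunc (real R) (\<lambda>x. g (x - real k *\<^sub>R y)))"
          "sq_integrable lborel (\<lambda>x. z ^ k * trunc (real R) g x)"
          by (intro sq_integrable_trunc sq_integrable_cmult st g)+
        have d: "sq_integrable lborel (\<lambda>x. g (x - real k *\<^sub>R y) - z ^ k * g x)"
          by (intro sq_integrable_diff st sq_integrable_cmult g)
        have "nrm lborel (\<lambda>x. trunc (real R) (\<lambda>x. g (x - real k *\<^sub>R y)) x - z ^ k * trunc (real R) g x)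
          = nrm lborel (trunc (real R) (\<lambda>x. g (x - real k *\<^sub>R y) - z ^ k * g x))"
          by (simp add: trunc_def[abs_def] algebra_simps)
        also have "\<dots> \<le> nrm lborel (\<lambda>x. g (x - real k *\<^sub>R y) - z ^ k * g x)"
          unfolding nrm_def
          by (intro real_sqrt_le_mono integral_mono sq_integrable_integrable sq_integrable_trunc d)
             (auto simp: trunc_def indicator_def)
        finally show ?thesis
          using nrm_diff_le[OF s1] nrm_translate_power[OF g eig, of k] by simp
      qed
      also have "\<dots> = nrm lborel (trunc (real R) g)" unfolding nrm_cmult by (simp add: norm_power z)
      finally show ?thesis .
    qed
    \<comment> \<open>The shifted balls leave every bounded set because y is not 0, so their masses
      tend to 0; being constant in k, they are all 0.\<close>
    have "(\<lambda>k. nrm lborel (\<lambda>x. indicator B (x + real k *\<^sub>R y) * g x)) \<longlonglongrightarrow> 0"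
    proof (rule nrm_tendsto_zero_dominated[OF _ sq_integrable_integrable[OF g]])
      have "(\<lambda>k. indicator B (x + real k *\<^sub>R y) * g x) \<longlonglongrightarrow> 0" for x
      proof (rule tendsto_eventually)
        have "\<forall>\<^sub>F k in sequentially. (real R + norm x + 1) / norm y \<le> real k"
          using filterlim_real_sequentially unfolding filterlim_at_top by blast
        then show "\<forall>\<^sub>F k in sequentially. indicator B (x + real k *\<^sub>R y) * g x = 0"
        proof eventually_elim
          case (elim k)
          then have "real R + norm x + 1 \<le> real k * norm y" using y by (simp add: field_simps)
          moreover have "norm (real k *\<^sub>R y) \<le> norm (x + real k *\<^sub>R y) + norm x"
            using norm_triangle_ineq4[of "x + real k *\<^sub>R y" x] by simp
          ultimately have "norm (x + real k *\<^sub>R y) > real R" by simp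
          then show ?case by (simp add: B_def)
        qed
      qed
      then show "AE x in lborel. (\<lambda>k. indicator B (x + real k *\<^sub>R y) * g x) \<longlonglongrightarrow> 0" by simp
    qed (auto simp: indicator_def)
    then show ?thesis unfolding eq by (simp add: LIMSEQ_const_iff)
  qed
  moreover have "(\<lambda>R. nrm lborel (trunc (real R) g)) \<longlonglongrightarrow> nrm lborel g"
    by (rule nrm_tendsto[OF sq_integrable_trunc[OF g] g trunc_tendsto[OF g]])
  ultimately show False using n by (simp add: LIMSEQ_const_iff)
qed

text \<open>The polynomial p evaluated at the operator of translation by y, applied to f. This turns
  linear combinations of the translates by multiples of y into a question about polynomials.\<close>

definition translate_poly :: "'a::euclidean_space \<Rightarrow> complex poly \<Rightarrow> ('a \<Rightarrow> complex) \<Rightarrow> 'a \<Rightarrow> complex" where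
  "translate_poly y p f x = (\<Sum>k\<le>degree p. coeff p k * f (x - real k *\<^sub>R y))"

lemma translate_poly_bound:
  assumes "degree p \<le> n"
  shows "translate_poly y p f x = (\<Sum>k\<le>n. coeff p k * f (x - real k *\<^sub>R y))"
  unfolding translate_poly_def
  by (rule sum.mono_neutral_left) (use assms in \<open>auto simp: coeff_eq_0\<close>)

lemma translate_poly_linear_factor:
  "translate_poly y ([:-z, 1:] * q) f x = translate_poly y q f (x - y) - z * translate_poly y q f x"
proof -
  define n where "n = degree q"
  have c: "coeff ([:-z, 1:] * q) k = (case k of 0 \<Rightarrow> 0 | Suc j \<Rightarrow> coeff q j) - z * coeff q k" for k
    by (simp add: coeff_pCons split: nat.split)
  have deg: "degree ([:-z, 1:] * q) \<le> Suc n"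
    unfolding n_def by (rule order_trans[OF degree_mult_le]) simp
  have "translate_poly y ([:-z, 1:] * q) f x
    = (\<Sum>k\<le>Suc n. (case k of 0 \<Rightarrow> 0 | Suc j \<Rightarrow> coeff q j) * f (x - real k *\<^sub>R y)) - (\<Sum>k\<le>Suc n. z * (coeff q k * f (x - real k *\<^sub>R y)))"
    unfolding translate_poly_bound[OF deg] c
    by (simp only: left_diff_distrib sum_subtractf mult.assoc)
  also have "(\<Sum>k\<le>Suc n. (case k of 0 \<Rightarrow> 0 | Suc j \<Rightarrow> coeff q j) * f (x - real k *\<^sub>R y)) = translate_poly y q f (x - y)"
    unfolding sum.atMost_Suc_shift translate_poly_def n_def by (simp add: algebra_simps)
  also have "(\<Sum>k\<le>Suc n. z * (coeff q k * f (x - real k *\<^sub>R y))) = z * translate_poly y q f x"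
    unfolding translate_poly_bound[of q "Suc n", unfolded n_def[symmetric], OF le_SucI[OF order_refl]] sum_distrib_left ..
  finally show ?thesis .
qed

lemma sq_integrable_translate_poly:
  fixes f :: "'a::euclidean_space \<Rightarrow> complex"
  assumes "sq_integrable lborel f"
  shows "sq_integrable lborel (translate_poly y p f)"
  unfolding translate_poly_def[abs_def]
  by (intro sq_integrable_sum sq_integrable_cmult sq_integrable_translate assms)

text \<open>Over the complex numbers p splits into linear factors. Each of them acts as translation
  minus a scalar, which is injective on square integrable functions by
  \<open>translation_no_eigenvector\<close>.\<close>

lemma translates_independent:
  fixes f :: "'a::euclidean_space \<Rightarrow> complex"
  assumes f: "sq_integrable lborel f" and n: "nrm lborel f > 0" and y: "y \<noteq> 0" and p: "p \<noteq> 0"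
  shows "nrm lborel (translate_poly y p f) > 0"
  using p
proof (induction "degree p" arbitrary: p)
  case 0
  then obtain a where "p = [:a:]" "a \<noteq> 0" by (metis degree_eq_zeroE pCons_0_0)
  then have "translate_poly y p f = (\<lambda>x. a * f x)" by (simp add: translate_poly_def fun_eq_iff)
  then show ?case using \<open>a \<noteq> 0\<close> n by (simp add: nrm_cmult)
next
  case (Suc d)
  then have "\<not> constant (poly p)" by (simp add: constant_degree)
  then obtain z where "poly p z = 0" using fundamental_theorem_of_algebra by blast
  then obtain q where q: "p = [:-z, 1:] * q" by (auto simp: poly_eq_0_iff_dvd)
  with Suc have q0: "q \<noteq> 0" by auto
  then have "degree p = Suc (degree q)" unfolding q by (subst degree_mult_eq) auto
  with Suc q0 have "nrm lborel (translate_poly y q f) > 0" by auto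
  from translation_no_eigenvector[OF sq_integrable_translate_poly[OF f] y this, of z]
  show ?case unfolding q translate_poly_linear_factor[abs_def] .
qed

section \<open>Translations acting on transforms and on subsets of the group\<close>

lemma translate_grp_cancel: "fst p \<noteq> 0 \<Longrightarrow> grp_mult (1, y) (grp_mult (1, - y) p) = p"
  by (simp add: grp_mult_alt prod_eq_iff)

text \<open>Translating f left-translates its transform, so translates of an extremal f have
  transforms living on left translates of \<open>E\<close>.\<close>

lemma wt_translate:
  fixes \<phi> f :: "'a::euclidean_space \<Rightarrow> complex"
  assumes [measurable]: "\<phi> \<in> borel_measurable borel" "f \<in> borel_measurable borel" and p: "fst p > 0"
  shows "wt \<phi> (\<lambda>x. f (x - y)) p = wt \<phi> f (grp_mult (1, - y) p)"
proof -
  have "wavelet \<phi> p = wavelet (wavelet \<phi> (grp_mult (1, - y) p)) (1, y)"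
    using p by (subst wavelet_grp_mult[symmetric]) (auto simp: translate_grp_cancel)
  then have "wt \<phi> (\<lambda>x. f (x - y)) p = ip lborel (wavelet f (1, y)) (wavelet (wavelet \<phi> (grp_mult (1, - y) p)) (1, y))"
    by (simp add: wt_def wavelet_one)
  also have "\<dots> = wt \<phi> f (grp_mult (1, - y) p)"
    unfolding wt_def by (rule integral_wavelet) auto
  finally show ?thesis .
qed

text \<open>The element (1, y) lies in the box of size 1, and the bound R m + m of
  \<open>box_grp_mult\<close> is then 2 m.\<close>

lemma translate_box_grp:
  fixes q :: "real \<times> 'a::euclidean_space"
  assumes "q \<in> box_grp m" "1 \<le> m" "norm y \<le> 1"
  shows "grp_mult (1, y) q \<in> box_grp (2 * m)"
  using box_grp_mult[of "(1, y)" 1 q m] assms by (auto simp: box_grp_def)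

text \<open>By regularity A lies between a compact K and an open U of nearly the same measure inside
  the box. A small shift keeps K within U, so a point that is new after shifting comes either from A
  - K, whose shift has the same measure, or lies in U - A.\<close>

lemma emeasure_translate_diff_small:
  fixes A :: "(real \<times> 'a::euclidean_space) set"
  assumes A [measurable]: "A \<in> sets borel" and AR: "A \<subseteq> box_grp R" and R: "1 \<le> R" and e: "(e::real) > 0"
  shows "\<exists>\<delta>>0. \<forall>y. norm y < \<delta> \<longrightarrow> emeasure hm {p \<in> box_grp R. grp_mult (1, - y) p \<in> A \<and> p \<notin> A} \<le> ennreal e"
proof -
  let ?hm = "hm :: (real \<times> 'a) measure"
  \<comment> \<open>Regularity is applied to a finite Borel measure, hence the restriction of
    \<open>hm\<close> to the box.\<close>
  define M where "M = density ?hm (indicator (box_grp R))"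
  have sM: "sets M = sets borel" by (simp add: M_def)
  have eM: "emeasure M X = emeasure ?hm (box_grp R \<inter> X)" if [measurable]: "X \<in> sets borel" for X
  proof -
    have "emeasure M X = (\<integral>\<^sup>+p. indicator (box_grp R) p * indicator X p \<partial>?hm)"
      unfolding M_def by (subst emeasure_density) auto
    also have "\<dots> = (\<integral>\<^sup>+p. indicator (box_grp R \<inter> X) p \<partial>?hm)"
      by (intro nn_integral_cong) (simp add: indicator_def)
    finally show ?thesis by simp
  qed
  have fin: "emeasure M (space M) \<noteq> \<infinity>"
    using eM[of UNIV] emeasure_box_grp_finite[OF R, where 'a='a] sM by (simp add: M_def)
  then have finX: "emeasure M X \<noteq> \<infinity>" for X
    using finite_measure.emeasure_finite[OF finite_measureI[OF fin]] by simp
  have e2: "ennreal (e/2) > 0" using e by simp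
  have AM: "A \<in> sets borel" by fact
  have "emeasure M A < \<infinity>" using finX[of A] by (simp add: less_top)
  have "\<exists>K. K \<subseteq> A \<and> compact K \<and> emeasure M A < emeasure M K + ennreal (e/2)"
  proof (rule ccontr)
    assume no: "\<not> ?thesis"
    have "(SUP K \<in> {K. K \<subseteq> A \<and> compact K}. emeasure M K) + ennreal (e/2)
      = (SUP K \<in> {K. K \<subseteq> A \<and> compact K}. emeasure M K + ennreal (e/2))"
      by (rule ennreal_SUP_add_left[symmetric]) (auto intro: exI[of _ "{}"])
    also have "\<dots> \<le> emeasure M A" by (rule SUP_least) (use no in \<open>auto simp: not_less\<close>)
    finally have "emeasure M A + ennreal (e/2) \<le> emeasure M A"
      unfolding inner_regular[OF sM fin AM, symmetric] .
    then show False using e2 finX[of A] by (metis add.right_neutral ennreal_add_left_cancel_le infinity_ennreal_def linorder_not_le)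
  qed
  then obtain K where K: "K \<subseteq> A" "compact K" "emeasure M A < emeasure M K + ennreal (e/2)" by blast
  have "(INF U \<in> {U. A \<subseteq> U \<and> open U}. emeasure M U) < emeasure M A + ennreal (e/2)"
    unfolding outer_regular[OF sM fin AM, symmetric] using e2 finX[of A]
    using ennreal_add_left_cancel_less[of "emeasure M A" 0 "ennreal (e/2)"] by simp
  then obtain U where U: "A \<subseteq> U" "open U" "emeasure M U < emeasure M A + ennreal (e/2)"
    by (auto simp: INF_less_iff)
  have [measurable]: "K \<in> sets borel" "U \<in> sets borel" using K U by (auto intro: borel_compact)
  have dK: "emeasure ?hm (A - K) \<le> ennreal (e/2)"
  proof -
    have "box_grp R \<inter> (A - K) = A - K" using AR by auto
    then have "emeasure ?hm (A - K) = emeasure M (A - K)" by (simp add: eM)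
    also have "\<dots> = emeasure M A - emeasure M K"
      by (rule emeasure_Diff) (use K finX sM in auto)
    also have "\<dots> \<le> ennreal (e/2)" using K(3) finX[of A] finX[of K] by (simp add: ennreal_minus_le_iff less_imp_le add.commute finX)
    finally show ?thesis .
  qed
  have dU: "emeasure ?hm (box_grp R \<inter> (U - A)) \<le> ennreal (e/2)"
  proof -
    have "emeasure ?hm (box_grp R \<inter> (U - A)) = emeasure M (U - A)" by (simp add: eM)
    also have "\<dots> = emeasure M U - emeasure M A"
      by (rule emeasure_Diff) (use U finX sM in auto)
    also have "\<dots> \<le> ennreal (e/2)" using U(3) finX[of A] finX[of U] by (simp add: ennreal_minus_le_iff less_imp_le add.commute finX)
    finally show ?thesis .
  qed
  obtain r where r: "r > 0" "(\<Union>x\<in>K. cball x r) \<subseteq> U"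
    using compact_subset_open_imp_cball_epsilon_subset[OF K(2) U(2) subset_trans[OF K(1) U(1)]] by auto
  \<comment> \<open>At scale a the shift moves the second coordinate by y / a, which on the box has
    norm at most R times that of y; this explains the bound r / R.\<close>
  have "emeasure ?hm {p \<in> box_grp R. grp_mult (1, - y) p \<in> A \<and> p \<notin> A} \<le> ennreal e" if y: "norm y < r / R" for y :: 'a
  proof -
    let ?T = "{p. grp_mult (1, - y) p \<in> A - K}"
    have Tm [measurable]: "?T \<in> sets borel"
    proof -
      have "{p \<in> space borel. grp_mult (1, - y) p \<in> A - K} \<in> sets borel" by measurable
      then show ?thesis by simp
    qed
    have "{p \<in> box_grp R. grp_mult (1, - y) p \<in> A \<and> p \<notin> A} \<subseteq> ?T \<union> (box_grp R \<inter> (U - A))"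
    proof
      fix p assume p: "p \<in> {p \<in> box_grp R. grp_mult (1, - y) p \<in> A \<and> p \<notin> A}"
      show "p \<in> ?T \<union> (box_grp R \<inter> (U - A))"
      proof (cases "grp_mult (1, - y) p \<in> K")
        case True
        have fp: "fst p > 0" using p box_grp_fst_pos R by blast
        have "inverse (fst p) \<le> R" using p R fp
          by (auto simp: box_grp_def) (metis inverse_inverse_eq le_imp_inverse_le inverse_positive_iff_positive less_le_trans zero_less_one)
        then have "inverse (fst p) * norm y \<le> R * (r / R)" using y R by (intro mult_mono) auto
        then have "dist (grp_mult (1, - y) p) p \<le> r"
        proof -
          have "grp_mult (1, - y) p - p = (0, - (inverse (fst p) *\<^sub>R y))"
            by (simp add: grp_mult_alt prod_eq_iff)
          then have "dist (grp_mult (1, - y) p) p = inverse (fst p) * norm y"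
            using fp by (simp add: dist_norm norm_Pair)
          with \<open>inverse (fst p) * norm y \<le> R * (r / R)\<close> show ?thesis using R by simp
        qed
        then have "p \<in> cball (grp_mult (1, - y) p) r" by (simp only: mem_cball)
        then have "p \<in> U" using r(2) True by blast
        with p show ?thesis by auto
      qed (use p in auto)
    qed
    then have "emeasure ?hm {p \<in> box_grp R. grp_mult (1, - y) p \<in> A \<and> p \<notin> A} \<le> emeasure ?hm (?T \<union> (box_grp R \<inter> (U - A)))"
      by (rule emeasure_mono) simp
    also have "\<dots> \<le> emeasure ?hm ?T + emeasure ?hm (box_grp R \<inter> (U - A))"
      by (rule emeasure_subadditive) auto
    also have "emeasure ?hm ?T = emeasure ?hm (A - K)"
    proof -
      have "emeasure ?hm ?T = (\<integral>\<^sup>+p. indicator (A - K) (grp_mult (1, - y) p) \<partial>?hm)"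
      proof -
        have "(\<integral>\<^sup>+p. indicator (A - K) (grp_mult (1, - y) p) \<partial>?hm) = (\<integral>\<^sup>+p. indicator ?T p \<partial>?hm)"
          by (intro nn_integral_cong) (simp add: indicator_def)
        then show ?thesis by simp
      qed
      also have "\<dots> = (\<integral>\<^sup>+p. indicator (A - K) p \<partial>?hm)"
        by (rule nn_integral_hm_left_invariant) auto
      finally show ?thesis by simp
    qed
    also have "emeasure ?hm (A - K) + emeasure ?hm (box_grp R \<inter> (U - A)) \<le> ennreal (e/2) + ennreal (e/2)"
      by (intro add_mono dK dU)
    also have "\<dots> = ennreal e" using e by (simp flip: ennreal_plus)
    finally show ?thesis .
  qed
  with r R show ?thesis by (intro exI[of _ "r / R"]) auto
qed

context thin_set
begin

text \<open>The mass that any h puts on the shifted \<open>E\<close> outside \<open>E\<close>. Where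
  the unshifted point is outside a box, the tail estimate is applied to a translate of h, which has
  the same norm; inside, a pointwise bound meets a set of small measure.\<close>

lemma wt_shift_small:
  assumes e: "(e::real) > 0"
  shows "\<exists>\<delta>>0. \<forall>y. norm y < \<delta> \<longrightarrow> (\<forall>h. sq_integrable lborel h \<longrightarrow>
    (\<integral>\<^sup>+p. ennreal ((cmod (wt \<phi> h p))\<^sup>2) * indicator {p. grp_mult (1, - y) p \<in> E \<and> p \<notin> E} p \<partial>hm)
      \<le> ennreal (e * (nrm lborel h)\<^sup>2))"
proof -
  obtain R where R: "R \<ge> 1" and tail: "\<And>f. sq_integrable lborel f \<Longrightarrow>
    (\<integral>\<^sup>+p. ennreal ((cmod (wt \<phi> f p))\<^sup>2) * indicator (E - box_grp R) p \<partial>hm) \<le> ennreal (e/2) * ennreal ((nrm lborel f)\<^sup>2)"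
    using wt_tail[of "ennreal (e/2)"] e by auto
  \<comment> \<open>Shifts by vectors of norm at most 1 at most double a box. The factor 4 leaves
    room for going from the shifted point in the box of size R to p and back again.\<close>
  define A where "A = E \<inter> box_grp (4 * R)"
  have [measurable]: "A \<in> sets borel" by (simp add: A_def)
  \<comment> \<open>The squared pointwise bound of the transform is at most c times the squared norm
    of h; a set of measure e / (2 c) then costs half of the allowance. The 1 makes c
    positive.\<close>
  define c where "c = (nrm lborel \<phi>)\<^sup>2 + 1"
  have c: "c > 0" by (simp add: c_def add_nonneg_pos)
  have "0 < e / (2 * c)" using e c by simp
  from emeasure_translate_diff_small[of A "4 * R", OF _ _ _ this] R
  obtain \<delta> where \<delta>: "\<delta> > 0" "\<And>y. norm y < \<delta> \<Longrightarrow>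
     emeasure hm {p \<in> box_grp (4 * R). grp_mult (1, - y) p \<in> A \<and> p \<notin> A} \<le> ennreal (e / (2 * c))"
    by (auto simp: A_def)
  have "(\<integral>\<^sup>+p. ennreal ((cmod (wt \<phi> h p))\<^sup>2) * indicator {p. grp_mult (1, - y) p \<in> E \<and> p \<notin> E} p \<partial>hm)
      \<le> ennreal (e * (nrm lborel h)\<^sup>2)" if y: "norm y < min \<delta> 1" and h: "sq_integrable lborel h" for y h
  proof -
    have [measurable]: "h \<in> borel_measurable borel" using h by (simp add: sq_integrable_def)
    define T where "T = {p \<in> box_grp (4 * R). grp_mult (1, - y) p \<in> A \<and> p \<notin> A}"
    have [measurable]: "T \<in> sets borel"
    proof -
      have "{p \<in> space borel. p \<in> box_grp (4 * R) \<and> grp_mult (1, - y) p \<in> A \<and> p \<notin> A} \<in> sets borel" by measurable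
      then show ?thesis by (simp add: T_def)
    qed
    have y1: "norm y \<le> 1" "norm (- y) \<le> 1" using y by auto
    define X where "X = E - box_grp R"
    have [measurable]: "X \<in> sets borel" by (simp add: X_def)
    have cover: "grp_mult (1, - y) p \<in> X \<or> p \<in> T"
      if p: "fst p > 0" "grp_mult (1, - y) p \<in> E" "p \<notin> E" for p
    proof (cases "grp_mult (1, - y) p \<in> box_grp R")
      case True
      from translate_box_grp[OF True R y1(1)] p
      have "p \<in> box_grp (2 * R)" by (simp add: translate_grp_cancel)
      moreover from translate_box_grp[OF this _ y1(2)] R
      have "grp_mult (1, - y) p \<in> box_grp (4 * R)" by simp
      ultimately show ?thesis using p R box_grp_mono[of "2 * R" "4 * R"] by (auto simp: T_def A_def)
    qed (use p in \<open>auto simp: X_def\<close>)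
    have "(\<integral>\<^sup>+p. ennreal ((cmod (wt \<phi> h p))\<^sup>2) * indicator {p. grp_mult (1, - y) p \<in> E \<and> p \<notin> E} p \<partial>hm)
      \<le> (\<integral>\<^sup>+p. ennreal ((cmod (wt \<phi> h p))\<^sup>2) * indicator X (grp_mult (1, - y) p) + ennreal ((nrm lborel h * nrm lborel \<phi>)\<^sup>2) * indicator T p \<partial>hm)"
    proof (rule nn_integral_hm_mono)
      fix p :: "real \<times> 'a" assume p: "fst p > 0"
      have "ennreal ((cmod (wt \<phi> h p))\<^sup>2) \<le> ennreal ((nrm lborel h * nrm lborel \<phi>)\<^sup>2)"
        by (intro ennreal_leI power_mono wt_bound h p) simp
      then show "ennreal ((cmod (wt \<phi> h p))\<^sup>2) * indicator {p. grp_mult (1, - y) p \<in> E \<and> p \<notin> E} p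
        \<le> ennreal ((cmod (wt \<phi> h p))\<^sup>2) * indicator X (grp_mult (1, - y) p) + ennreal ((nrm lborel h * nrm lborel \<phi>)\<^sup>2) * indicator T p"
        using cover[OF p] by (auto simp: indicator_def intro: add_increasing)
    qed
    also have "\<dots> = (\<integral>\<^sup>+p. ennreal ((cmod (wt \<phi> h p))\<^sup>2) * indicator X (grp_mult (1, - y) p) \<partial>hm)
      + ennreal ((nrm lborel h * nrm lborel \<phi>)\<^sup>2) * emeasure hm T"
      by (subst nn_integral_add) (auto simp: nn_integral_cmult_indicator)
    also have "(\<integral>\<^sup>+p. ennreal ((cmod (wt \<phi> h p))\<^sup>2) * indicator X (grp_mult (1, - y) p) \<partial>hm)
      = (\<integral>\<^sup>+q. ennreal ((cmod (wt \<phi> (\<lambda>x. h (x - (- y))) q))\<^sup>2) * indicator X q \<partial>hm)"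
    proof -
      have "(\<integral>\<^sup>+p. ennreal ((cmod (wt \<phi> h p))\<^sup>2) * indicator X (grp_mult (1, - y) p) \<partial>hm)
        = (\<integral>\<^sup>+q. ennreal ((cmod (wt \<phi> h (grp_mult (1, y) q)))\<^sup>2) * indicator X (grp_mult (1, - y) (grp_mult (1, y) q)) \<partial>hm)"
      proof (rule nn_integral_hm_left_invariant[symmetric])
        show "0 < fst (1 :: real, y)" by simp
      qed measurable
      also have "\<dots> = (\<integral>\<^sup>+q. ennreal ((cmod (wt \<phi> (\<lambda>x. h (x - (- y))) q))\<^sup>2) * indicator X q \<partial>hm)"
      proof (rule nn_integral_hm_cong)
        fix q :: "real \<times> 'a" assume q: "fst q > 0"
        have "grp_mult (1, - y) (grp_mult (1, y) q) = q"
          using translate_grp_cancel[of q "- y"] q by simp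
        moreover have "wt \<phi> h (grp_mult (1, y) q) = wt \<phi> (\<lambda>x. h (x - (- y))) q"
          using wt_translate[of \<phi> h q "- y"] q by simp
        ultimately show "ennreal ((cmod (wt \<phi> h (grp_mult (1, y) q)))\<^sup>2) * indicator X (grp_mult (1, - y) (grp_mult (1, y) q))
          = ennreal ((cmod (wt \<phi> (\<lambda>x. h (x - (- y))) q))\<^sup>2) * indicator X q" by simp
      qed
      finally show ?thesis .
    qed
    also have "\<dots> \<le> ennreal (e/2) * ennreal ((nrm lborel h)\<^sup>2)"
      using tail[OF sq_integrable_translate(1)[OF h, of "- y"]]
      unfolding sq_integrable_translate(2)[OF h, of "- y"] X_def .
    also have "ennreal ((nrm lborel h * nrm lborel \<phi>)\<^sup>2) * emeasure hm T \<le> ennreal ((nrm lborel h)\<^sup>2 * c) * ennreal (e / (2 * c))"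
      using \<delta>(2)[of y] y unfolding T_def
      by (intro mult_mono ennreal_leI) (auto simp: power_mult_distrib c_def algebra_simps)
    also have "\<dots> = ennreal (e/2) * ennreal ((nrm lborel h)\<^sup>2)"
      using c e by (subst (1 2) ennreal_mult[symmetric]) (auto simp: field_simps)
    also have "ennreal (e/2) * ennreal ((nrm lborel h)\<^sup>2) + ennreal (e/2) * ennreal ((nrm lborel h)\<^sup>2) = ennreal (e * (nrm lborel h)\<^sup>2)"
      using e by (simp flip: ennreal_plus ennreal_mult)
    finally show ?thesis by (simp add: add_right_mono)
  qed
  with \<delta>(1) show ?thesis by (intro exI[of _ "min \<delta> 1"]) auto
qed

text \<open>For every N some normalized combination of N + 1 translates of f has a transform
  vanishing at the first N points of a dense sequence, yet keeps at least half of its mass on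
  \<open>E\<close>. As N grows these functions satisfy the hypotheses of \<open>wt_compact\<close>
  and contradict its conclusion.\<close>

lemma no_extremal:
  assumes f: "sq_integrable lborel f" and f1: "nrm lborel f = 1"
    and off: "(\<integral>\<^sup>+p. ennreal ((cmod (wt \<phi> f p))\<^sup>2) * indicator (- E) p \<partial>hm) = 0"
  shows False
proof -
  have [measurable]: "f \<in> borel_measurable borel" using f by (simp add: sq_integrable_def)
  obtain d :: "nat \<Rightarrow> real \<times> 'a" where d: "\<And>i. fst (d i) > 0"
    "\<And>p. fst p > 0 \<Longrightarrow> \<exists>r. (\<lambda>n. d (r n)) \<longlonglongrightarrow> p" by (rule dense_sequence_grp) blast
  obtain b :: 'a where b: "b \<in> Basis" using nonempty_Basis by blast
  have "\<exists>h. sq_integrable lborel h \<and> nrm lborel h = 1 \<and> (\<forall>i<N. wt \<phi> h (d i) = 0) \<and>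
    (\<integral>\<^sup>+p. ennreal ((cmod (wt \<phi> h p))\<^sup>2) * indicator E p \<partial>hm) \<ge> ennreal (1/2)" for N :: nat
  proof -
    \<comment> \<open>Each of the N + 1 translates may leak e of the mass, 1/2 altogether.\<close>
    define e where "e = 1 / (2 * real (Suc N))"
    have "e > 0" by (simp add: e_def)
    from wt_shift_small[OF this] obtain \<delta> where \<delta>: "\<delta> > 0" and sh: "\<And>y h. norm y < \<delta> \<Longrightarrow> sq_integrable lborel h \<Longrightarrow>
      (\<integral>\<^sup>+p. ennreal ((cmod (wt \<phi> h p))\<^sup>2) * indicator {p. grp_mult (1, - y) p \<in> E \<and> p \<notin> E} p \<partial>hm)
        \<le> ennreal (e * (nrm lborel h)\<^sup>2)" by blast
    \<comment> \<open>Small enough for all the multiples k y with k <= N to stay below \<delta>; the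
      direction is arbitrary, only y nonzero matters.\<close>
    define y where "y = (\<delta> / (2 * real (Suc N))) *\<^sub>R b"
    have y0: "y \<noteq> 0" using \<delta> b nonzero_Basis by (auto simp: y_def)
    have ky: "norm (real k *\<^sub>R y) < \<delta>" if "k \<le> N" for k
    proof -
      have "norm (real k *\<^sub>R y) = real k * (\<delta> / (2 * real (Suc N)))"
        using \<delta> b by (simp add: y_def)
      also have "\<dots> \<le> real (Suc N) * (\<delta> / (2 * real (Suc N)))"
        using that \<delta> by (intro mult_right_mono) auto
      also have "\<dots> = \<delta> / 2" by (simp add: field_simps)
      also have "\<dots> < \<delta>" using \<delta> by simp
      finally show ?thesis .
    qed
    define ty where "ty k x = f (x - real k *\<^sub>R y)" for k :: nat and x
    have ty: "sq_integrable lborel (ty k)" for k unfolding ty_def by (rule sq_integrable_translate[OF f])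
    \<comment> \<open>There are N + 1 unknowns, since \<open>{..N}\<close> includes N, against N
      equations.\<close>
    have "\<exists>c. (\<exists>k\<in>{..N}. c k \<noteq> 0) \<and> (\<forall>i\<in>{..<N}. (\<Sum>k\<in>{..N}. c k * wt \<phi> (ty k) (d i)) = 0)"
      by (rule homogeneous_solution) auto
    then obtain c where c: "\<exists>k\<in>{..N}. c k \<noteq> 0" "\<forall>i\<in>{..<N}. (\<Sum>k\<in>{..N}. c k * wt \<phi> (ty k) (d i)) = 0"
      by blast
    define p where "p = Abs_poly (\<lambda>k. if k \<le> N then c k else 0)"
    have pc: "coeff p k = (if k \<le> N then c k else 0)" for k
      unfolding p_def by (subst coeff_Abs_poly[of N]) auto
    have p0: "p \<noteq> 0" using c(1) pc by (metis atMost_iff coeff_0)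
    have dp: "degree p \<le> N" by (rule degree_le) (simp add: pc)
    define g where "g = translate_poly y p f"
    have g_sum: "g = (\<lambda>x. \<Sum>k\<le>N. c k * ty k x)"
      unfolding g_def using translate_poly_bound[OF dp, of y f] by (simp add: fun_eq_iff pc ty_def)
    have g: "sq_integrable lborel g" unfolding g_def by (rule sq_integrable_translate_poly[OF f])
    have ng: "nrm lborel g > 0"
      unfolding g_def by (rule translates_independent[OF f _ y0 p0]) (simp add: f1)
    have wg: "wt \<phi> g q = (\<Sum>k\<le>N. c k * wt \<phi> (ty k) q)" if "fst q > 0" for q
      unfolding g_sum wt_def by (subst ip_sum_left) (auto intro: sq_integrable_cmult ty sq_integrable_\<phi> that simp: ip_cmult_left)
    define h where "h x = of_real (1 / nrm lborel g) * g x" for x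
    have h: "sq_integrable lborel h" unfolding h_def by (rule sq_integrable_cmult[OF g])
    have [measurable]: "h \<in> borel_measurable borel" using h by (simp add: sq_integrable_def)
    have h1: "nrm lborel h = 1" unfolding h_def nrm_cmult using ng by (simp add: norm_divide)
    have wh: "wt \<phi> h q = of_real (1 / nrm lborel g) * wt \<phi> g q" for q unfolding h_def by (rule wt_cmult)
    have hd: "\<forall>i<N. wt \<phi> h (d i) = 0" using c(2) d(1) by (simp add: wh wg)
    have "AE q in hm. ennreal ((cmod (wt \<phi> f (grp_mult (1, - (real k *\<^sub>R y)) q)))\<^sup>2) * indicator (- E) (grp_mult (1, - (real k *\<^sub>R y)) q) = 0" for k
    proof -
      have "(\<integral>\<^sup>+q. ennreal ((cmod (wt \<phi> f (grp_mult (1, - (real k *\<^sub>R y)) q)))\<^sup>2) * indicator (- E) (grp_mult (1, - (real k *\<^sub>R y)) q) \<partial>hm)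
        = (\<integral>\<^sup>+q. ennreal ((cmod (wt \<phi> f q))\<^sup>2) * indicator (- E) q \<partial>hm)"
      proof (rule nn_integral_hm_left_invariant[where u="\<lambda>q. ennreal ((cmod (wt \<phi> f q))\<^sup>2) * indicator (- E) q"])
        show "0 < fst (1 :: real, - (real k *\<^sub>R y))" by simp
      qed measurable
      with off show ?thesis by (subst nn_integral_0_iff_AE[symmetric]) auto
    qed
    then have "AE q in hm. \<forall>k. ennreal ((cmod (wt \<phi> f (grp_mult (1, - (real k *\<^sub>R y)) q)))\<^sup>2) * indicator (- E) (grp_mult (1, - (real k *\<^sub>R y)) q) = 0"
      by (simp add: AE_all_countable)
    then have ae: "AE q in hm. wt \<phi> h q = 0 \<or> (\<exists>k\<le>N. grp_mult (1, - (real k *\<^sub>R y)) q \<in> E)"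
      using AE_hm_fst
    proof eventually_elim
      case (elim q)
      show ?case
      proof (cases "\<exists>k\<le>N. grp_mult (1, - (real k *\<^sub>R y)) q \<in> E")
        case False
        have "wt \<phi> (ty k) q = 0" if "k \<le> N" for k
        proof -
          have "wt \<phi> (ty k) q = wt \<phi> f (grp_mult (1, - (real k *\<^sub>R y)) q)"
            unfolding ty_def by (rule wt_translate) (use elim in auto)
          moreover have "indicator (- E) (grp_mult (1, - (real k *\<^sub>R y)) q) = (1 :: ennreal)" using False that by simp
          ultimately show ?thesis using elim(1)[rule_format, of k] by simp
        qed
        then show ?thesis using elim by (simp add: wh wg)
      qed simp
    qed
    \<comment> \<open>\<open>S k\<close> is what the k-th shift adds to \<open>E\<close>. Off
      \<open>E\<close> and the \<open>S k\<close> with k <= N the transform of \<open>h\<close>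
      vanishes almost everywhere, so the total mass 1 is at most \<open>J\<close> plus N + 1
      leaks.\<close>
    define S where "S k = {q. grp_mult (1, - (real k *\<^sub>R y)) q \<in> E \<and> q \<notin> E}" for k
    have [measurable]: "S k \<in> sets borel" for k
    proof -
      have "{q \<in> space borel. grp_mult (1, - (real k *\<^sub>R y)) q \<in> E \<and> q \<notin> E} \<in> sets borel" by measurable
      then show ?thesis by (simp add: S_def)
    qed
    define J where "J = (\<integral>\<^sup>+q. ennreal ((cmod (wt \<phi> h q))\<^sup>2) * indicator E q \<partial>hm)"
    have "1 = (\<integral>\<^sup>+q. ennreal ((cmod (wt \<phi> h q))\<^sup>2) \<partial>hm)" by (simp add: nn_integral_wt h h1)
    also have "\<dots> \<le> (\<integral>\<^sup>+q. ennreal ((cmod (wt \<phi> h q))\<^sup>2) * indicator E q + (\<Sum>k\<le>N. ennreal ((cmod (wt \<phi> h q))\<^sup>2) * indicator (S k) q) \<partial>hm)"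
    proof (rule nn_integral_mono_AE, use ae in eventually_elim)
      case (elim q)
      show ?case
      proof (cases "wt \<phi> h q = 0 \<or> q \<in> E")
        case True then show ?thesis by auto
      next
        case False
        with elim obtain k where k: "k \<le> N" "q \<in> S k" by (auto simp: S_def)
        then have "ennreal ((cmod (wt \<phi> h q))\<^sup>2) * indicator (S k) q \<le> (\<Sum>k\<le>N. ennreal ((cmod (wt \<phi> h q))\<^sup>2) * indicator (S k) q)"
          by (intro member_le_sum) auto
        with False k show ?thesis by simp
      qed
    qed
    also have "\<dots> = J + (\<integral>\<^sup>+q. (\<Sum>k\<le>N. ennreal ((cmod (wt \<phi> h q))\<^sup>2) * indicator (S k) q) \<partial>hm)"
      unfolding J_def by (rule nn_integral_add) measurable
    also have "(\<integral>\<^sup>+q. (\<Sum>k\<le>N. ennreal ((cmod (wt \<phi> h q))\<^sup>2) * indicator (S k) q) \<partial>hm)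
      = (\<Sum>k\<le>N. \<integral>\<^sup>+q. ennreal ((cmod (wt \<phi> h q))\<^sup>2) * indicator (S k) q \<partial>hm)"
      by (rule nn_integral_sum) measurable
    also have "J + \<dots> \<le> J + (\<Sum>k\<le>N. ennreal e)"
    proof (intro add_left_mono sum_mono)
      fix k assume "k \<in> {..N}"
      then show "(\<integral>\<^sup>+q. ennreal ((cmod (wt \<phi> h q))\<^sup>2) * indicator (S k) q \<partial>hm) \<le> ennreal e"
        using sh[OF ky h, of k] unfolding S_def h1 by simp
    qed
    also have "(\<Sum>k\<le>N. ennreal e) = ennreal (1/2)"
    proof -
      have "(\<Sum>k\<le>N. ennreal e) = ennreal (\<Sum>k\<le>N. e)" using \<open>e > 0\<close> by (intro sum_ennreal) auto
      also have "(\<Sum>k\<le>N. e) = 1/2" by (simp add: e_def field_simps)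
      finally show ?thesis .
    qed
    finally have "1 \<le> J + ennreal (1/2)" .
    then have "ennreal (1/2) \<le> J"
    proof (cases J)
      case (real r)
      with \<open>1 \<le> J + ennreal (1/2)\<close> have "ennreal 1 \<le> ennreal (r + 1/2)" by simp
      then have "1 \<le> r + 1/2" using real by (subst (asm) ennreal_le_iff) auto
      then have "ennreal (1/2) \<le> ennreal r" by (intro ennreal_leI) simp
      with real show ?thesis by (simp only:)
    qed simp
    with h h1 hd show ?thesis unfolding J_def by blast
  qed
  then have "\<exists>h. \<forall>N::nat. sq_integrable lborel (h N) \<and> nrm lborel (h N) = 1 \<and> (\<forall>i<N. wt \<phi> (h N) (d i) = 0) \<and>
    (\<integral>\<^sup>+p. ennreal ((cmod (wt \<phi> (h N) p))\<^sup>2) * indicator E p \<partial>hm) \<ge> ennreal (1/2)"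
    by (intro choice allI)
  then obtain h where all: "\<forall>N::nat. sq_integrable lborel (h N) \<and> nrm lborel (h N) = 1 \<and> (\<forall>i<N. wt \<phi> (h N) (d i) = 0) \<and>
    (\<integral>\<^sup>+p. ennreal ((cmod (wt \<phi> (h N) p))\<^sup>2) * indicator E p \<partial>hm) \<ge> ennreal (1/2)" ..
  then have h: "\<And>N. sq_integrable lborel (h N)" and h1: "\<And>N. nrm lborel (h N) \<le> 1"
    and hd: "\<And>N i. i < N \<Longrightarrow> wt \<phi> (h N) (d i) = 0"
    and hE: "\<And>N. (\<integral>\<^sup>+p. ennreal ((cmod (wt \<phi> (h N) p))\<^sup>2) * indicator E p \<partial>hm) \<ge> ennreal (1/2)"
    by simp_all
  have lim: "(\<lambda>N. wt \<phi> (h N) (d i)) \<longlonglongrightarrow> 0" for i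
    by (rule tendsto_eventually[OF eventually_mono[OF eventually_gt_at_top[of i] hd]])
  have "(\<lambda>N. \<integral>\<^sup>+p. ennreal ((cmod (wt \<phi> (h N) p))\<^sup>2) * indicator E p \<partial>hm) \<longlonglongrightarrow> 0"
    by (rule wt_compact[OF h h1 wt_tendsto_zero_of_dense[OF d h h1 lim]])
  from LIMSEQ_le_const[OF this, of "ennreal (1/2)"] hE show False by (auto simp: ennreal_le_iff2)
qed

lemma wt_lower_bound:
  "\<exists>c::real. c > 0 \<and> (\<forall>f. sq_integrable lborel f \<longrightarrow>
    ennreal (c * (nrm lborel f)\<^sup>2) \<le> (\<integral>\<^sup>+p. ennreal ((cmod (wt \<phi> f p))\<^sup>2) * indicator (- E) p \<partial>hm))"
proof (rule ccontr)
  assume "\<not> ?thesis"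
  then have "\<exists>f. sq_integrable lborel f \<and>
    (\<integral>\<^sup>+p. ennreal ((cmod (wt \<phi> f p))\<^sup>2) * indicator (- E) p \<partial>hm) < ennreal (c * (nrm lborel f)\<^sup>2)" if "c > 0" for c
    using that by (auto simp: not_le)
  from exists_extremal[OF this] show False using no_extremal by blast
qed

end

section \<open>Passing to Borel representatives\<close>

lemma AE_lborel_affine:
  fixes t :: "'a::euclidean_space"
  assumes "AE x in lborel. P x" and c: "c \<noteq> 0"
  shows "AE x in lborel. P (t + c *\<^sub>R x)"
proof -
  obtain N where N: "N \<in> null_sets lborel" and P: "{x. \<not> P x} \<subseteq> N"
    using assms(1) by (auto simp: eventually_ae_filter)
  have [measurable]: "N \<in> sets borel" using N by (auto simp: null_sets_def)
  have "AE x in lborel. x \<notin> N" by (rule AE_not_in[OF N])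
  then have "(\<integral>\<^sup>+x. indicator N x \<partial>lborel) = 0" using N by (auto simp: null_sets_def)
  then have "ennreal (\<bar>c\<bar> ^ DIM('a)) * (\<integral>\<^sup>+x. indicator N (t + c *\<^sub>R x) \<partial>lborel) = 0"
    by (subst nn_integral_lborel_affine[symmetric, OF _ c]) auto
  then have "(\<integral>\<^sup>+x. indicator N (t + c *\<^sub>R x) \<partial>lborel) = 0" using c by auto
  then have "AE x in lborel. indicator N (t + c *\<^sub>R x) = (0::ennreal)"
    by (subst (asm) nn_integral_0_iff_AE) auto
  then show ?thesis
    by eventually_elim (use P in \<open>auto simp: indicator_def split: if_splits\<close>)
qed

lemma AE_wavelet:
  fixes f g :: "'a::euclidean_space \<Rightarrow> complex"
  assumes "AE x in lborel. f x = g x" and p: "fst p > 0"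
  shows "AE x in lborel. wavelet f p x = wavelet g p x"
proof -
  have "AE x in lborel. f (- snd p + inverse (fst p) *\<^sub>R x) = g (- snd p + inverse (fst p) *\<^sub>R x)"
    by (rule AE_lborel_affine[OF assms(1)]) (use p in simp)
  then show ?thesis by eventually_elim (simp add: wavelet_alt)
qed

lemma integral_lebesgue_AE_borel:
  fixes h h' :: "'a::euclidean_space \<Rightarrow> complex"
  assumes [measurable]: "h' \<in> borel_measurable borel" and ae: "AE x in lborel. h x = h' x"
  shows "(\<integral>x. h x \<partial>lebesgue) = (\<integral>x. h' x \<partial>lborel)"
proof -
  have m': "h' \<in> borel_measurable lebesgue" by (rule measurable_completion) simp
  have aeL: "AE x in lebesgue. h' x = h x"
    using AE_completion[OF ae] by eventually_elim simp
  have m: "h \<in> borel_measurable lebesgue"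
    by (rule borel_measurable_AE[OF m' aeL])
  have "(\<integral>x. h x \<partial>lebesgue) = (\<integral>x. h' x \<partial>lebesgue)"
    by (rule integral_cong_AE[OF m m']) (use aeL in eventually_elim, simp)
  also have "\<dots> = (\<integral>x. h' x \<partial>lborel)" by (rule integral_completion) simp
  finally show ?thesis .
qed

lemma L2_inner_eq_ip:
  fixes f g :: "'a::euclidean_space \<Rightarrow> complex"
  assumes [measurable]: "f' \<in> borel_measurable borel" "g' \<in> borel_measurable borel"
    and "AE x in lborel. f x = f' x" "AE x in lborel. g x = g' x"
  shows "L2_inner f g = ip lborel f' g'"
  unfolding L2_inner_def ip_def
  by (rule integral_lebesgue_AE_borel) (measurable, use assms(3,4) in eventually_elim, simp)

lemma L2_representative:
  fixes f :: "'a::euclidean_space \<Rightarrow> complex"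
  assumes "f \<in> L2"
  obtains f' where "sq_integrable lborel f'" "AE x in lborel. f x = f' x" "L2_norm f = nrm lborel f'"
proof -
  from assms have m: "f \<in> borel_measurable lebesgue" and i: "integrable lebesgue (\<lambda>x. (cmod (f x))\<^sup>2)"
    by (auto simp: L2_def)
  obtain f' where [measurable]: "f' \<in> borel_measurable borel" and ae: "AE x in lborel. f x = f' x"
    by (rule borel_representative[OF m])
  have eq: "(\<integral>\<^sup>+x. ennreal ((cmod (f' x))\<^sup>2) \<partial>lborel) = (\<integral>\<^sup>+x. ennreal ((cmod (f x))\<^sup>2) \<partial>lebesgue)"
    unfolding nn_integral_completion
    by (rule nn_integral_cong_AE) (use ae in eventually_elim, simp)
  also have "\<dots> < \<infinity>" using i by (simp add: integrable_iff_bounded)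
  finally have s: "sq_integrable lborel f'" by (simp add: sq_integrable_iff_nn_integral)
  have "(\<integral>x. (cmod (f x))\<^sup>2 \<partial>lebesgue) = (\<integral>x. (cmod (f' x))\<^sup>2 \<partial>lborel)"
  proof -
    have "(\<integral>x. (cmod (f x))\<^sup>2 \<partial>lebesgue) = enn2real (\<integral>\<^sup>+x. ennreal ((cmod (f x))\<^sup>2) \<partial>lebesgue)"
      by (rule integral_eq_nn_integral) (use i in auto)
    also have "\<dots> = (\<integral>x. (cmod (f' x))\<^sup>2 \<partial>lborel)"
      unfolding eq[symmetric] by (rule integral_eq_nn_integral[symmetric]) auto
    finally show ?thesis .
  qed
  then have "L2_norm f = nrm lborel f'" by (simp add: L2_norm_def nrm_def)
  with s ae show thesis by (rule that)
qed

lemma fourier_integral_AE_cong: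
  fixes f :: "'a::euclidean_space \<Rightarrow> complex"
  assumes [measurable]: "f' \<in> borel_measurable borel" and ae: "AE x in lborel. f x = f' x"
  shows "fourier_integral (\<lambda>x. indicator (cball 0 R) x * f x) \<xi>
    = fourier_integral (\<lambda>x. indicator (cball 0 R) x * f' x) \<xi>"
proof -
  have "fourier_integral (\<lambda>x. indicator (cball 0 R) x * f x) \<xi> = ft (trunc R f') \<xi>"
    unfolding fourier_integral_def ft_def
    by (rule integral_lebesgue_AE_borel) (measurable, use ae in eventually_elim, simp add: trunc_def)
  then show ?thesis by (simp add: fourier_integral_trunc)
qed

text \<open>The two functions are equal, not merely equal almost everywhere: the Fourier integrals
  of the truncations agree at every frequency, so the choice operator is applied to one and the same
  predicate.\<close>

lemma fourier_L2_AE_cong: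
  fixes f :: "'a::euclidean_space \<Rightarrow> complex"
  assumes "f' \<in> borel_measurable borel" and "AE x in lborel. f x = f' x"
  shows "fourier_L2 f = fourier_L2 f'"
  unfolding fourier_L2_def is_fourier_L2_def fourier_integral_AE_cong[OF assms] ..

text \<open>Admissibility evaluates the transform along rays, where a change on a null set could
  matter. Null sets are invariant under scaling, so by Tonelli almost every ray meets the
  exceptional set in a null set of parameters.\<close>

lemma AE_ray:
  fixes g g' :: "'a::euclidean_space \<Rightarrow> complex"
  assumes "AE x in lborel. g x = g' x"
  shows "AE x in lborel. AE \<xi> in lborel. \<xi> > 0 \<longrightarrow> g (\<xi> *\<^sub>R x) = g' ((\<xi>::real) *\<^sub>R x)"
proof -
  obtain N where N: "N \<in> null_sets lborel" and P: "{x. g x \<noteq> g' x} \<subseteq> N"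
    using assms by (auto simp: eventually_ae_filter)
  have [measurable]: "N \<in> sets borel" using N by (auto simp: null_sets_def)
  have aeN: "AE x in lborel. x \<notin> N" by (rule AE_not_in[OF N])
  have "(\<integral>\<^sup>+x. \<integral>\<^sup>+\<xi>. indicator {0<..} (\<xi>::real) * indicator N (\<xi> *\<^sub>R x) \<partial>lborel \<partial>(lborel :: 'a measure))
    = (\<integral>\<^sup>+\<xi>. \<integral>\<^sup>+x. indicator {0<..} (\<xi>::real) * indicator N (\<xi> *\<^sub>R x) \<partial>(lborel :: 'a measure) \<partial>lborel)"
    by (rule lborel_pair.Fubini') measurable
  also have "\<dots> = (\<integral>\<^sup>+(\<xi>::real). 0 \<partial>lborel)"
  proof (rule nn_integral_cong)
    fix \<xi> :: real
    show "(\<integral>\<^sup>+x. indicator {0<..} \<xi> * indicator N (\<xi> *\<^sub>R x) \<partial>(lborel :: 'a measure)) = 0"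
    proof (cases "\<xi> > 0")
      case True
      then have "AE x in lborel. 0 + \<xi> *\<^sub>R x \<notin> N" by (intro AE_lborel_affine[OF aeN]) auto
      then have "AE x in (lborel :: 'a measure). indicator {0<..} \<xi> * indicator N (\<xi> *\<^sub>R x) = (0::ennreal)"
        by eventually_elim simp
      then show ?thesis by (subst nn_integral_0_iff_AE) auto
    qed simp
  qed
  also have "\<dots> = 0" by simp
  finally have "AE x in (lborel :: 'a measure). (\<integral>\<^sup>+\<xi>. indicator {0<..} (\<xi>::real) * indicator N (\<xi> *\<^sub>R x) \<partial>lborel) = 0"
    by (subst (asm) nn_integral_0_iff_AE) auto
  then show ?thesis
  proof eventually_elim
    case (elim x)
    then have "AE \<xi> in lborel. indicator {0<..} (\<xi>::real) * indicator N (\<xi> *\<^sub>R x) = (0::ennreal)"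
      by (subst (asm) nn_integral_0_iff_AE) auto
    then show ?case
      by eventually_elim (use P in \<open>auto simp: indicator_def split: if_splits\<close>)
  qed
qed

text \<open>The transform chosen for the given function is also the one chosen for its Borel
  version; its own Borel version is then put into the admissibility condition through
  \<open>AE_ray\<close>.\<close>

lemma admissible_representative:
  fixes \<phi> :: "'a::euclidean_space \<Rightarrow> complex"
  assumes adm: "\<phi> \<in> admissible" and \<phi>': "sq_integrable lborel \<phi>'" and ae: "AE x in lborel. \<phi> x = \<phi>' x"
  shows "wavelet_isometry \<phi>'"
proof -
  have [measurable]: "\<phi>' \<in> borel_measurable borel" using \<phi>' by (simp add: sq_integrable_def)
  define g where "g = fourier_L2 \<phi>"
  have "g = fourier_L2 \<phi>'"
    unfolding g_def by (rule fourier_L2_AE_cong[OF _ ae]) simp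
  then have "is_fourier_L2 \<phi>' g"
    unfolding fourier_L2_def by (simp only:) (rule someI_ex[OF is_fourier_L2_exists[OF \<phi>']])
  then obtain g' where g': "sq_integrable lborel g'" and gg: "AE x in lborel. g x = g' x"
    and lim: "(\<lambda>n. nrm lborel (\<lambda>x. ft (trunc (real n) \<phi>') x - g' x)) \<longlonglongrightarrow> 0"
    by (rule is_fourier_L2_representative[OF \<phi>'])
  have "AE x in lborel. (\<integral>\<^sup>+\<xi>\<in>{0<..}. ennreal ((cmod (g (\<xi> *\<^sub>R x)))\<^sup>2 / \<xi>) \<partial>lebesgue) = 1"
    using adm by (simp add: admissible_def g_def AE_completion_iff)
  then have "AE \<xi> in lborel. (\<integral>\<^sup>+a. ennreal (indicator {0<..} a / a) * ennreal ((cmod (g' (a *\<^sub>R \<xi>)))\<^sup>2) \<partial>lborel) = 1"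
    using AE_ray[OF gg]
  proof eventually_elim
    case (elim x)
    have "(\<integral>\<^sup>+a. ennreal (indicator {0<..} a / a) * ennreal ((cmod (g' (a *\<^sub>R x)))\<^sup>2) \<partial>lborel)
      = (\<integral>\<^sup>+\<xi>. ennreal ((cmod (g (\<xi> *\<^sub>R x)))\<^sup>2 / \<xi>) * indicator {0<..} \<xi> \<partial>lborel)"
      by (rule nn_integral_cong_AE) (use elim(2) in eventually_elim, auto simp: indicator_def simp flip: ennreal_mult)
    with elim(1) show ?case by (simp add: nn_integral_completion)
  qed
  from wt_isometry[OF \<phi>' g' lim this] \<phi>' show ?thesis
    by unfold_locales
qed

section \<open>The measure \<open>haar\<close> on Lebesgue sets compared with its Borel counterpart
  \<open>hm\<close>\<close>

lemma grp_lebesgue [measurable]: "(grp :: (real \<times> 'a::euclidean_space) set) \<in> sets borel"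
  unfolding grp_def by (simp add: borel_open open_Times)

lemma haar_density_measurable:
  "(\<lambda>(a, b). ennreal (1 / a)) \<in> borel_measurable (lebesgue_on (grp :: (real \<times> 'a::euclidean_space) set))"
proof -
  have "(\<lambda>p::real \<times> 'a. ennreal (1 / fst p)) \<in> borel_measurable borel" by measurable
  then have "(\<lambda>p::real \<times> 'a. ennreal (1 / fst p)) \<in> borel_measurable lebesgue"
    by (intro measurable_completion) simp
  then have "(\<lambda>p::real \<times> 'a. ennreal (1 / fst p)) \<in> borel_measurable (lebesgue_on grp)"
    by (rule measurable_restrict_space1)
  then show ?thesis by (simp add: split_def)
qed

lemma space_haar: "space haar = grp"
  by (simp add: haar_def)

lemma AE_haar_lborel:
  fixes P :: "real \<times> 'a::euclidean_space \<Rightarrow> bool"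
  assumes "AE p in lborel. P p"
  shows "AE p in haar. P p"
proof -
  have "AE p in lebesgue_on grp. P p"
    using AE_completion[OF assms] grp_lebesgue by (subst AE_restrict_space_iff) (auto simp: sets_completionI_sets)
  then show ?thesis unfolding haar_def AE_density[OF haar_density_measurable] by eventually_elim simp
qed

lemma nn_integral_haar:
  fixes v :: "real \<times> 'a::euclidean_space \<Rightarrow> ennreal"
  assumes [measurable]: "v \<in> borel_measurable borel"
  shows "(\<integral>\<^sup>+p. v p \<partial>haar) = (\<integral>\<^sup>+p. v p \<partial>hm)"
proof -
  have "v \<in> borel_measurable lebesgue" by (rule measurable_completion) simp
  then have vm: "v \<in> borel_measurable (lebesgue_on grp)" by (rule measurable_restrict_space1)
  have gl: "(grp :: (real \<times> 'a) set) \<in> sets lebesgue" using grp_lebesgue by (simp add: sets_completionI_sets)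
  have "(\<integral>\<^sup>+p. v p \<partial>haar) = (\<integral>\<^sup>+p. (case p of (a, b) \<Rightarrow> ennreal (1 / a)) * v p \<partial>lebesgue_on grp)"
    unfolding haar_def by (rule nn_integral_density[OF haar_density_measurable vm])
  also have "\<dots> = (\<integral>\<^sup>+p. (case p of (a, b) \<Rightarrow> ennreal (1 / a)) * v p * indicator grp p \<partial>lebesgue)"
    using gl by (subst nn_integral_restrict_space) auto
  also have "\<dots> = (\<integral>\<^sup>+p. ennreal (indicator {0<..} (fst p) / fst p) * v p \<partial>lborel)"
    unfolding nn_integral_completion
    by (rule nn_integral_cong) (auto simp: grp_def indicator_def split_def)
  also have "\<dots> = (\<integral>\<^sup>+p. v p \<partial>hm)"
    unfolding hm_def by (subst nn_integral_density) auto
  finally show ?thesis .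
qed

lemma nn_integral_haar_cong:
  fixes v :: "real \<times> 'a::euclidean_space \<Rightarrow> ennreal"
  assumes [measurable]: "v \<in> borel_measurable borel" and "AE p in lborel. p \<in> grp \<longrightarrow> u p = v p"
  shows "(\<integral>\<^sup>+p. u p \<partial>haar) = (\<integral>\<^sup>+p. v p \<partial>hm)"
proof -
  have "AE p in haar. u p = v p"
    using AE_haar_lborel[OF assms(2)] AE_space[of haar] by eventually_elim (simp add: space_haar)
  then have "(\<integral>\<^sup>+p. u p \<partial>haar) = (\<integral>\<^sup>+p. v p \<partial>haar)" by (rule nn_integral_cong_AE)
  then show ?thesis by (simp add: nn_integral_haar)
qed

text \<open>The indicator is taken with complex values so that \<open>borel_representative\<close>
  applies; the Borel set is where the representative equals 1.\<close>

lemma haar_set_representative: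
  fixes E :: "(real \<times> 'a::euclidean_space) set"
  assumes "E \<in> sets haar"
  obtains E' where "E' \<in> sets borel" "AE p in lborel. p \<in> E \<longleftrightarrow> p \<in> E'"
proof -
  have gl: "(grp :: (real \<times> 'a) set) \<in> sets lebesgue" using grp_lebesgue by (simp add: sets_completionI_sets)
  have "E \<in> sets (lebesgue_on grp)" using assms by (simp add: haar_def)
  then have "E \<in> sets lebesgue" using gl by (simp add: sets_restrict_space_iff)
  then have "(indicator E :: real \<times> 'a \<Rightarrow> complex) \<in> borel_measurable lebesgue" by (rule borel_measurable_indicator)
  then obtain h where [measurable]: "h \<in> borel_measurable borel" and h: "AE p in lborel. (indicator E p :: complex) = h p"
    by (rule borel_representative)
  have "{p \<in> space borel. h p = 1} \<in> sets borel" by measurable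
  then have "{p. h p = 1} \<in> sets borel" by simp
  moreover have "AE p in lborel. p \<in> E \<longleftrightarrow> p \<in> {p. h p = 1}"
    using h by eventually_elim (auto simp: indicator_def split: if_splits)
  ultimately show thesis by (rule that)
qed

text \<open>This is where properness enters: the closure of a ball is compact, hence contained in a
  box, so that leaving the boxes forces the distance to the identity to grow.\<close>

lemma ball_subset_box_grp:
  fixes \<rho> :: "real \<times> 'a::euclidean_space \<Rightarrow> real \<times> 'a \<Rightarrow> real"
  assumes \<rho>: "proper_left_invariant_metric \<rho>"
  shows "\<exists>R\<ge>1. \<forall>q\<in>grp. q \<notin> box_grp R \<longrightarrow> \<rho> q (1, 0) \<ge> r"
proof -
  interpret Metric_space grp \<rho> using \<rho> by (simp add: proper_left_invariant_metric_def)
  have one: "(1, 0) \<in> (grp :: (real \<times> 'a) set)" by (simp add: grp_def)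
  define C where "C = top_of_set grp closure_of mball (1, 0) r"
  have "compactin (top_of_set grp) C"
    using \<rho> one by (simp add: proper_left_invariant_metric_def C_def)
  then have C: "compact C" "C \<subseteq> grp" by (auto simp: compactin_subtopology)
  have sub: "mball (1, 0) r \<subseteq> C"
    unfolding C_def by (rule closure_of_subset) auto
  \<comment> \<open>One continuous function that bounds the scale, its inverse and the shift at
    once; its maximum over the compact set is the size of the box.\<close>
  have "continuous_on C (\<lambda>p. fst p + inverse (fst p) + norm (snd p))"
    using C(2) by (intro continuous_intros) (auto simp: grp_def)
  then have "compact ((\<lambda>p. fst p + inverse (fst p) + norm (snd p)) ` C)"
    by (rule compact_continuous_image) (rule C)
  then have "bounded ((\<lambda>p. fst p + inverse (fst p) + norm (snd p)) ` C)" by (rule compact_imp_bounded)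
  then have "\<exists>B. \<forall>x\<in>(\<lambda>p. fst p + inverse (fst p) + norm (snd p)) ` C. norm x \<le> B" by (simp add: bounded_iff)
  then obtain B where B: "\<forall>x\<in>(\<lambda>p. fst p + inverse (fst p) + norm (snd p)) ` C. norm x \<le> B" ..
  define R where "R = max B 1"
  have "\<rho> q (1, 0) \<ge> r" if q: "q \<in> grp" "q \<notin> box_grp R" for q
  proof (rule ccontr)
    assume "\<not> \<rho> q (1, 0) \<ge> r"
    then have "q \<in> C" using q one sub by (auto simp: commute)
    then have b: "fst q + inverse (fst q) + norm (snd q) \<le> B" using B by fastforce
    have q0: "fst q > 0" using q by (auto simp: grp_def)
    have "fst q \<le> R" "inverse (fst q) \<le> R" "norm (snd q) \<le> R"
      using b q0 norm_ge_zero[of "snd q"] by (auto simp: R_def simp del: norm_ge_zero) (smt (verit) positive_imp_inverse_positive)+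
    moreover have "inverse R \<le> fst q"
      using le_imp_inverse_le[OF \<open>inverse (fst q) \<le> R\<close>] q0 by simp
    ultimately show False using q by (simp add: box_grp_def)
  qed
  then show ?thesis by (intro exI[of _ R]) (auto simp: R_def)
qed

lemma W_eq_wt:
  fixes f \<phi> :: "'a::euclidean_space \<Rightarrow> complex"
  assumes [measurable]: "f' \<in> borel_measurable borel" "\<phi>' \<in> borel_measurable borel"
    and "AE x in lborel. f x = f' x" "AE x in lborel. \<phi> x = \<phi>' x" and p: "p \<in> grp"
  shows "W \<phi> f p = wt \<phi>' f' p"
  unfolding W_def wt_def
  by (rule L2_inner_eq_ip) (use p in \<open>auto simp: grp_def intro!: assms AE_wavelet\<close>)

text \<open>The integral off \<open>E\<close> is the nonnegative one, so the bound does not depend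
  on the default value of a Bochner integral.\<close>

theorem corollary3:
  fixes \<phi> :: "real ^ 'd \<Rightarrow> complex"
    and \<rho> :: "real \<times> (real ^ 'd) \<Rightarrow> real \<times> (real ^ 'd) \<Rightarrow> real"
    and E :: "(real \<times> (real ^ 'd)) set"
  assumes "proper_left_invariant_metric \<rho>"
    and "\<phi> \<in> A1"
    and "E \<in> sets haar"
    and "thin \<rho> \<phi> E"
  shows "\<exists>c::real. c > 0 \<and>
    (\<forall>f\<in>L2. (\<integral>\<^sup>+p\<in>grp - E. ennreal ((cmod (W \<phi> f p))\<^sup>2) \<partial>haar) \<ge> ennreal (c * (L2_norm f)\<^sup>2))"
proof -
  from \<open>\<phi> \<in> A1\<close> obtain \<epsilon> where adm: "\<phi> \<in> admissible" and B1: "\<phi> \<in> B1 (weight \<epsilon>)"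
    by (auto simp: A1_def)
  then have "\<phi> \<in> L2" by (simp add: B1_def)
  then obtain \<phi>' where \<phi>': "sq_integrable lborel \<phi>'" and ae\<phi>: "AE x in lborel. \<phi> x = \<phi>' x"
    by (rule L2_representative)
  have [measurable]: "\<phi>' \<in> borel_measurable borel" using \<phi>' by (simp add: sq_integrable_def)
  obtain E' where [measurable]: "E' \<in> sets borel" and aeE: "AE p in lborel. p \<in> E \<longleftrightarrow> p \<in> E'"
    by (rule haar_set_representative[OF \<open>E \<in> sets haar\<close>])
  define s where "s = real DIM(real ^ 'd) / 2 + \<epsilon>"
  have wm: "weight \<epsilon> = (\<lambda>p::real \<times> (real ^ 'd). fst p powr s)"
    by (auto simp: weight_def s_def fun_eq_iff)
  have intW: "integrable (density haar (\<lambda>p. ennreal (fst p powr s))) (W \<phi> \<phi>)"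
    using B1 unfolding B1_def wm by simp
  have weight_measurable: "(\<lambda>p::real \<times> (real ^ 'd). ennreal (fst p powr s)) \<in> borel_measurable haar"
  proof -
    have "(\<lambda>p::real \<times> (real ^ 'd). ennreal (fst p powr s)) \<in> borel_measurable borel" by measurable
    then have "(\<lambda>p::real \<times> (real ^ 'd). ennreal (fst p powr s)) \<in> borel_measurable lebesgue"
      by (intro measurable_completion) simp
    then have "(\<lambda>p::real \<times> (real ^ 'd). ennreal (fst p powr s)) \<in> borel_measurable (lebesgue_on grp)"
      by (rule measurable_restrict_space1)
    then show ?thesis by (simp add: haar_def)
  qed
  \<comment> \<open>The wavelet at the identity is the function itself, so the kernel at the
    identity is the modulus of \<open>W \<phi> \<phi>\<close>, and membership in \<open>B1\<close>
    becomes the Schur condition with exponent s = d/2 + \<epsilon>.\<close>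
  have ker_int: "(\<integral>\<^sup>+r. ennreal (ker \<phi>' (1, 0) r * fst r powr s) \<partial>hm) < \<infinity>"
  proof -
    have Wm: "W \<phi> \<phi> \<in> borel_measurable haar"
      using borel_measurable_integrable[OF intW] by simp
    have "(\<integral>\<^sup>+r. ennreal (ker \<phi>' (1, 0) r * fst r powr s) \<partial>hm)
      = (\<integral>\<^sup>+p. ennreal (fst p powr s) * ennreal (cmod (W \<phi> \<phi> p)) \<partial>haar)"
      by (rule nn_integral_haar_cong[symmetric])
         (measurable, auto simp: W_eq_wt[OF _ _ ae\<phi> ae\<phi>] ker_def wavelet_unit wt_def ennreal_mult mult.commute)
    also have "\<dots> = (\<integral>\<^sup>+p. ennreal (cmod (W \<phi> \<phi> p)) \<partial>density haar (\<lambda>p. ennreal (fst p powr s)))"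
      using Wm by (intro nn_integral_density[symmetric] weight_measurable) simp
    also have "\<dots> < \<infinity>" using intW by (simp add: integrable_iff_bounded)
    finally show ?thesis .
  qed
  have thin_eq: "(\<integral>\<^sup>+p\<in>E. ennreal ((cmod (L2_inner (wavelet \<phi> p) (wavelet \<phi> q)))\<^sup>2) \<partial>haar)
    = (\<integral>\<^sup>+p. ennreal ((ker \<phi>' p q)\<^sup>2) * indicator E' p \<partial>hm)" if q: "fst q > 0" for q
  proof (rule nn_integral_haar_cong)
    show "AE p in lborel. p \<in> grp \<longrightarrow> ennreal ((cmod (L2_inner (wavelet \<phi> p) (wavelet \<phi> q)))\<^sup>2) * indicator E p
      = ennreal ((ker \<phi>' p q)\<^sup>2) * indicator E' p"
      using aeE
    proof eventually_elim
      case (elim p)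
      show ?case
      proof
        assume "p \<in> grp"
        then have "L2_inner (wavelet \<phi> p) (wavelet \<phi> q) = ip lborel (wavelet \<phi>' p) (wavelet \<phi>' q)"
          using q by (intro L2_inner_eq_ip AE_wavelet ae\<phi>) (auto simp: grp_def)
        with elim show "ennreal ((cmod (L2_inner (wavelet \<phi> p) (wavelet \<phi> q)))\<^sup>2) * indicator E p
          = ennreal ((ker \<phi>' p q)\<^sup>2) * indicator E' p" by (simp add: ker_def indicator_def)
      qed
    qed
  qed measurable
  interpret wavelet_isometry \<phi>' by (rule admissible_representative[OF adm \<phi>' ae\<phi>])
  interpret thin_set \<phi>' E' s
  proof unfold_locales
    show "E' \<in> sets borel" by fact
    show "(\<integral>\<^sup>+r. ennreal (ker \<phi>' (1, 0) r * fst r powr s) \<partial>hm) < \<infinity>" by (rule ker_int)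
    fix e :: ennreal assume "e > 0"
    with \<open>thin \<rho> \<phi> E\<close> have "\<forall>\<^sub>F q in to_infinity \<rho>.
      (\<integral>\<^sup>+p\<in>E. ennreal ((cmod (L2_inner (wavelet \<phi> p) (wavelet \<phi> q)))\<^sup>2) \<partial>haar) < e"
      unfolding thin_def by (rule order_tendstoD(2))
    \<comment> \<open>The filter is pulled back along the distance to the identity, so the eventual
      property is a condition \<open>Q\<close> on that distance, from which a radius r is read off
      and then converted into the size of a box.\<close>
    then obtain Q where "eventually Q at_top" and Q: "\<And>q. Q (\<rho> q (1, 0)) \<Longrightarrow> q \<in> grp \<Longrightarrow>
      (\<integral>\<^sup>+p\<in>E. ennreal ((cmod (L2_inner (wavelet \<phi> p) (wavelet \<phi> q)))\<^sup>2) \<partial>haar) < e"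
      unfolding to_infinity_def eventually_inf_principal eventually_filtercomap by blast
    then obtain r where rQ: "\<And>t. t \<ge> r \<Longrightarrow> Q t" by (auto simp: eventually_at_top_linorder)
    have r: "(\<integral>\<^sup>+p\<in>E. ennreal ((cmod (L2_inner (wavelet \<phi> p) (wavelet \<phi> q)))\<^sup>2) \<partial>haar) < e"
      if "q \<in> grp" "\<rho> q (1, 0) \<ge> r" for q
      by (rule Q[OF rQ]) (use that in simp_all)
    obtain R where R: "R \<ge> 1" "\<And>q. q \<in> grp \<Longrightarrow> q \<notin> box_grp R \<Longrightarrow> \<rho> q (1, 0) \<ge> r"
      using ball_subset_box_grp[OF \<open>proper_left_invariant_metric \<rho>\<close>, of r] by blast
    have "(\<integral>\<^sup>+p. ennreal ((ker \<phi>' p q)\<^sup>2) * indicator E' p \<partial>hm) \<le> e" if q: "fst q > 0" "q \<notin> box_grp R" for q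
    proof -
      have "q \<in> grp" using q by (cases q) (auto simp: grp_def)
      from r[OF this R(2)[OF this q(2)]] show ?thesis unfolding thin_eq[OF q(1)] by (rule less_imp_le)
    qed
    with R(1) show "\<exists>R\<ge>1. \<forall>q. fst q > 0 \<longrightarrow> q \<notin> box_grp R \<longrightarrow>
       (\<integral>\<^sup>+p. ennreal ((ker \<phi>' p q)\<^sup>2) * indicator E' p \<partial>hm) \<le> e" by blast
  qed
  obtain c where c: "c > 0" and bound: "\<And>f. sq_integrable lborel f \<Longrightarrow>
    ennreal (c * (nrm lborel f)\<^sup>2) \<le> (\<integral>\<^sup>+p. ennreal ((cmod (wt \<phi>' f p))\<^sup>2) * indicator (- E') p \<partial>hm)"
    using wt_lower_bound by blast
  have "ennreal (c * (L2_norm f)\<^sup>2) \<le> (\<integral>\<^sup>+p\<in>grp - E. ennreal ((cmod (W \<phi> f p))\<^sup>2) \<partial>haar)" if "f \<in> L2" for f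
  proof -
    obtain f' where f': "sq_integrable lborel f'" and aef: "AE x in lborel. f x = f' x"
      and nf: "L2_norm f = nrm lborel f'" by (rule L2_representative[OF \<open>f \<in> L2\<close>])
    have [measurable]: "f' \<in> borel_measurable borel" using f' by (simp add: sq_integrable_def)
    have "(\<integral>\<^sup>+p\<in>grp - E. ennreal ((cmod (W \<phi> f p))\<^sup>2) \<partial>haar)
      = (\<integral>\<^sup>+p. ennreal ((cmod (wt \<phi>' f' p))\<^sup>2) * indicator (- E') p \<partial>hm)"
    proof (rule nn_integral_haar_cong)
      show "AE p in lborel. p \<in> grp \<longrightarrow> ennreal ((cmod (W \<phi> f p))\<^sup>2) * indicator (grp - E) p
        = ennreal ((cmod (wt \<phi>' f' p))\<^sup>2) * indicator (- E') p"
        using aeE by eventually_elim (auto simp: W_eq_wt[OF _ _ aef ae\<phi>] indicator_def)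
    qed measurable
    then show ?thesis using bound[OF f'] by (simp add: nf)
  qed
  with c show ?thesis by blast
qed

end
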